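(* Let $\mathsf{A}_{15}^+$ be the lattice defined in the context, and let \[ \mathbf{a}=\tfrac14(-3,-3,-3,-3,1,1,1,1,1,1,1,1,1,1,1,1),\quad \mathbf{b}=\tfrac14(-3,-3,-3,1,-3,1,1,1,1,1,1,1,1,1,1,1), \] \[ \mathbf{c}=\tfrac14(-3,1,1,1,1,-3,-3,-3,1,1,1,1,1,1,1,1),\quad \mathbf{c}'=\tfrac14(1,1,1,-3,-3,-3,-3,1,1,1,1,1,1,1,1,1), \] all of which lie in $\mathsf{A}_{15}^+$. Then, up to the action of $\operatorname{Aut}(\mathsf{A}_{15}^+)$, there are precisely two sublattices of $\mathsf{A}_{15}^+$ having Gram matrix \[ \begin{pmatrix}3&2&0\\2&3&0\\0&0&3\end{pmatrix} \] with respect to some basis, and they are $\langle \mathbf{a},\mathbf{b},\mathbf{c}\rangle$ and $\langle \mathbf{a},\mathbf{b},\mathbf{c}'\rangle$. Moreover, the orthogonal complements $\langle \mathbf{a},\mathbf{b},\mathbf{c}\rangle^{\perp}$ and $\langle \mathbf{a},\mathbf{b},\mathbf{c}'\rangle^{\perp}$ in $\mathsf{A}_{15}^+$ are non-isometric, and each of them is a minimal non $2$-integrable lattice of rank $12$ and determinant $15$.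
   Context: A lattice means a positive definite integral $\mathbb{Z}$-lattice, i.e. a subgroup of some $\mathbb{R}^n$ generated by linearly independent vectors, with the standard inner product, on which all inner products are integers. The norm of a vector $\mathbf{x}$ is $(\mathbf{x},\mathbf{x})$. For a positive integer $n$, $\mathsf{A}_n=\{\mathbf{x}\in\mathbb{Z}^{n+1}: \sum_i x_i=0\}$. $\mathsf{A}_{15}^+$ is the lattice in $\mathbb{R}^{16}$ generated by $\mathsf{A}_{15}$ and the vector $[4]=\tfrac14(1,1,1,1,1,1,1,1,1,1,1,1,-3,-3,-3,-3)$; it is a unimodular lattice. $\operatorname{Aut}(\mathsf{A}_{15}^+)$ is its group of isometries (orthogonal linear maps of $\mathbb{R}^{16}$ mapping $\mathsf{A}_{15}^+$ onto itself). The orthogonal complement of a sublattice $M\subseteq L$ is $\{\mathbf{u}\in L:(\mathbf{u},\mathbf{v})=0\ \forall \mathbf{v}\in M\}$. For a positive integer $s$, a lattice $L$ is $s$-integrable if $\sqrt{s}\cdot L$ is isometric to a sublattice of $\mathbb{Z}^n$ for some $n$. A lattice $L$ is non $s$-minimal if there exist a lattice $M$ and a positive integer $m$ such that $\sqrt{s}\cdot L$ is isometric to a sublattice of $\sqrt{s}\cdot M\perp\mathbb{Z}^m$ not contained in $\sqrt{s}\cdot M$; otherwise $L$ is $s$-minimal. A minimal non $s$-integrable lattice is a lattice that is not $s$-integrable and is $s$-minimal. *)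

theory Defs
  imports
    Complex_Main
    "HOL-Algebra.Generated_Groups"
    "HOL-Algebra.Group_Action"
    "Jordan_Normal_Form.Determinant"
    "Jordan_Normal_Form.VS_Connect"
begin

text \<open>
  The dimension of the ambient space varies inside the notions below (``for some \<open>n\<close>''), so vectors
  of \<open>\<real>\<^sup>n\<close> are elements of \<^term>\<open>carrier_vec n :: real vec set\<close>, and a lattice is a
  set of such vectors.
\<close>

definition zspan :: "nat \<Rightarrow> real vec set \<Rightarrow> real vec set" where
  "zspan n S = generate (monoid_vec TYPE(real) n) S"

definition lattice_basis :: "nat \<Rightarrow> real vec set \<Rightarrow> real vec list \<Rightarrow> bool" where
  "lattice_basis n L bs \<longleftrightarrow>
     set bs \<subseteq> carrier_vec n \<and> distinct bs \<and>
     \<not> module.lin_dep class_ring (module_vec TYPE(real) n) (set bs) \<and>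
     L = zspan n (set bs)"

definition int_lattice :: "nat \<Rightarrow> real vec set \<Rightarrow> bool" where
  "int_lattice n L \<longleftrightarrow>
     (\<exists>bs. lattice_basis n L bs) \<and> (\<forall>x\<in>L. \<forall>y\<in>L. x \<bullet> y \<in> \<int>)"

definition sublattice :: "nat \<Rightarrow> real vec set \<Rightarrow> real vec set \<Rightarrow> bool" where
  "sublattice n M L \<longleftrightarrow> int_lattice n M \<and> M \<subseteq> L"

definition gram_matrix :: "real vec list \<Rightarrow> real mat" where
  "gram_matrix bs = mat (length bs) (length bs) (\<lambda>(i, j). (bs ! i) \<bullet> (bs ! j))"

text \<open>Neither the length of a basis nor its Gram determinant depends on the basis chosen.\<close>

definition lattice_rank :: "nat \<Rightarrow> real vec set \<Rightarrow> nat" where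
  "lattice_rank n L = length (SOME bs. lattice_basis n L bs)"

definition lattice_det :: "nat \<Rightarrow> real vec set \<Rightarrow> real" where
  "lattice_det n L = det (gram_matrix (SOME bs. lattice_basis n L bs))"

definition isometric :: "real vec set \<Rightarrow> real vec set \<Rightarrow> bool" where
  "isometric L M \<longleftrightarrow>
     (\<exists>f. bij_betw f L M \<and>
          (\<forall>x\<in>L. \<forall>y\<in>L. f (x + y) = f x + f y) \<and>
          (\<forall>x\<in>L. \<forall>y\<in>L. f x \<bullet> f y = x \<bullet> y))"

definition scale_lattice :: "real \<Rightarrow> real vec set \<Rightarrow> real vec set" where
  "scale_lattice r L = (\<lambda>x. r \<cdot>\<^sub>v x) ` L"

definition orthogonal_sum :: "real vec set \<Rightarrow> real vec set \<Rightarrow> real vec set" where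
  "orthogonal_sum L M = {x @\<^sub>v y | x y. x \<in> L \<and> y \<in> M}"

definition Z_lattice :: "nat \<Rightarrow> real vec set" where
  "Z_lattice n = {x \<in> carrier_vec n. \<forall>i<n. x $ i \<in> \<int>}"

definition s_integrable :: "nat \<Rightarrow> real vec set \<Rightarrow> bool" where
  "s_integrable s L \<longleftrightarrow>
     (\<exists>n K. sublattice n K (Z_lattice n) \<and> isometric (scale_lattice (sqrt (real s)) L) K)"

text \<open>Inside \<open>\<surd>s\<cdot>M \<bottom> \<int>\<^sup>m\<close>, the summand \<open>\<surd>s\<cdot>M\<close> is the orthogonal sum with \<open>{0}\<close>.\<close>

definition non_s_minimal :: "nat \<Rightarrow> real vec set \<Rightarrow> bool" where
  "non_s_minimal s L \<longleftrightarrow>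
     (\<exists>k M m K. int_lattice k M \<and> m > 0 \<and>
        sublattice (k + m) K
          (orthogonal_sum (scale_lattice (sqrt (real s)) M) (Z_lattice m)) \<and>
        isometric (scale_lattice (sqrt (real s)) L) K \<and>
        \<not> K \<subseteq> orthogonal_sum (scale_lattice (sqrt (real s)) M) {0\<^sub>v m})"

definition s_minimal :: "nat \<Rightarrow> real vec set \<Rightarrow> bool" where
  "s_minimal s L \<longleftrightarrow> \<not> non_s_minimal s L"

definition minimal_non_s_integrable :: "nat \<Rightarrow> nat \<Rightarrow> real vec set \<Rightarrow> bool" where
  "minimal_non_s_integrable n s L \<longleftrightarrow>
     int_lattice n L \<and> \<not> s_integrable s L \<and> s_minimal s L"

definition lattice_orth :: "real vec set \<Rightarrow> real vec set \<Rightarrow> real vec set" where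
  "lattice_orth L M = {u \<in> L. \<forall>v\<in>M. u \<bullet> v = 0}"

text \<open>Orthogonal linear maps of \<open>\<real>\<^sup>n\<close> are represented by their matrices.\<close>

definition lattice_Aut :: "nat \<Rightarrow> real vec set \<Rightarrow> real mat monoid" where
  "lattice_Aut n L =
     \<lparr>carrier = {P \<in> carrier_mat n n. P\<^sup>T * P = 1\<^sub>m n \<and> (\<lambda>x. P *\<^sub>v x) ` L = L},
      mult = (*), one = 1\<^sub>m n\<rparr>"

definition mat_action :: "real mat \<Rightarrow> real vec set \<Rightarrow> real vec set" where
  "mat_action P M = (\<lambda>x. P *\<^sub>v x) ` M"

definition A_lattice :: "nat \<Rightarrow> real vec set" where
  "A_lattice n = {x \<in> Z_lattice (n + 1). (\<Sum>i<n + 1. x $ i) = 0}"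

definition A15_plus :: "real vec set" where
  "A15_plus = zspan 16 (A_lattice 15 \<union>
     {(1/4) \<cdot>\<^sub>v vec_of_list [1,1,1,1,1,1,1,1,1,1,1,1,-3,-3,-3,-3]})"

definition sublattices_with_gram :: "nat \<Rightarrow> real vec set \<Rightarrow> real mat \<Rightarrow> real vec set set" where
  "sublattices_with_gram n L G =
     {M. sublattice n M L \<and> (\<exists>bs. lattice_basis n M bs \<and> gram_matrix bs = G)}"

end

theory Submission
  imports Defs "HOL-Combinatorics.Permutations"
begin

text \<open>
  The norm 3 vectors of \<open>A15_plus\<close> are \<open>\<plusminus>(1/4 - e\<^sub>S)\<close> for 4-subsets \<open>S\<close> of the 16 coordinates, and two of
  them with subsets \<open>S\<close>, \<open>T\<close> have inner product \<open>\<plusminus>(|S \<inter> T| - 1)\<close>. A sublattice with the given Gram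
  matrix is therefore a triple of 4-subsets with pairwise intersections of sizes 3, 1, 1, and up to
  permutations only the size, 0 or 1, of the triple intersection remains. The two complements have 64
  and 80 vectors of norm 2.

  For minimality, let \<open>N\<close> be one of the complements and suppose \<open>\<surd>2 N\<close> embeds into \<open>\<surd>2 M \<bottom> \<int>\<^sup>m\<close>. This
  writes the form of \<open>N\<close> as a sum of two integral semidefinite forms. Neither takes the value 1, because
  a vector of value 1 would give a nonzero functional of norm at most 1 on \<open>N\<close>; by unimodularity of
  \<open>A15_plus\<close>, and since the discriminant group of \<open>\<langle>a, b, c\<rangle>\<close> has short representatives, such a functional
  lifts to a vector of norm less than 2, which is 0. As \<open>N\<close> has a connected basis of vectors of norm 2
  and 3, one of the two forms vanishes. If it is the form on \<open>M\<close>, the coordinate functionals in \<open>\<int>\<^sup>m\<close> have norm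
  at most 2 and lift to 0 or to roots \<open>e\<^sub>p - e\<^sub>q\<close>. Then \<open>\<Sum>\<^sub>i (u\<^bsub>p i\<^esub> - u\<^bsub>q i\<^esub>)\<^sup>2 = 2 (u, u)\<close> on \<open>N\<close>. No root lies
  inside the large block of coordinates not separated by \<open>a, b, c\<close>, and for the remaining roots a weighted
  sum of these identities is contradictory.
\<close>

section \<open>Integral spans and bases\<close>

text \<open>Both lifting steps rest on the constant 14/15. A vector with inner products A, B, C with
  a, b, c has a component along their span of norm (9A^2 - 12AB + 9B^2 + 5C^2)/15, and adding
  multiples of a, b, c to the vector brings this down to at most 14/15. A functional of norm at most
  t therefore lifts to norm below t + 1. For t = 1 this is below 2, the minimum of
  \<open>A15_plus\<close>; for t = 2 it is below 3, the least norm of a vector with nonintegral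
  coordinates, so that only 0 and roots remain. Unimodularity enters through explicit vectors of
  \<open>A15_plus\<close> dual to a basis of N. The large block has to be treated before the
  weighted sum: the certificates give it a negative weight, so they are nonnegative only after the
  roots inside it have been excluded by a separate argument.\<close>

lemma scalar_prod_sum_lessThan:
  assumes "y \<in> carrier_vec n"
  shows "x \<bullet> y = (\<Sum>i<n. x $ i * y $ i)"
  using assms by (simp add: scalar_prod_def atLeast0LessThan)

lemma zspan_carrier:
  assumes "S \<subseteq> carrier_vec n"
  shows "zspan n S \<subseteq> carrier_vec n"
proof -
  interpret comm_group "monoid_vec TYPE(real) n" by (rule comm_group_vec)
  show ?thesis
    using generate_incl[of S] assms by (simp add: zspan_def monoid_vec_simps)
qed

lemma inv_monoid_vec:
  fixes x :: "real vec"
  assumes "x \<in> carrier_vec n"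
  shows "inv\<^bsub>monoid_vec TYPE(real) n\<^esub> x = - x"
proof -
  interpret comm_group "monoid_vec TYPE(real) n" by (rule comm_group_vec)
  have "inv\<^bsub>monoid_vec TYPE(real) n\<^esub> x = - x"
    by (rule inv_equality) (use assms in \<open>auto simp: monoid_vec_simps\<close>)
  then show ?thesis .
qed

lemma zspan_zero: "0\<^sub>v n \<in> zspan n S"
  using generate.one[of "monoid_vec TYPE(real) n" S] by (simp add: zspan_def monoid_vec_simps)

lemma zspan_incl: "x \<in> S \<Longrightarrow> x \<in> zspan n S"
  unfolding zspan_def by (rule generate.incl)

lemma zspan_add: "x \<in> zspan n S \<Longrightarrow> y \<in> zspan n S \<Longrightarrow> x + y \<in> zspan n S"
  using generate.eng[of x "monoid_vec TYPE(real) n" S y] by (simp add: zspan_def monoid_vec_simps)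

lemma zspan_uminus:
  assumes "S \<subseteq> carrier_vec n" "x \<in> zspan n S"
  shows "- x \<in> zspan n S"
proof -
  interpret comm_group "monoid_vec TYPE(real) n" by (rule comm_group_vec)
  have "x \<in> carrier_vec n" using zspan_carrier assms by auto
  then show ?thesis
    using generate_m_inv_closed[of S x] assms inv_monoid_vec[of x n] by (simp add: zspan_def monoid_vec_simps)
qed

lemma zspan_smult_nat:
  assumes "S \<subseteq> carrier_vec n" "x \<in> zspan n S"
  shows "real k \<cdot>\<^sub>v x \<in> zspan n S"
proof (induction k)
  case 0
  have "x \<in> carrier_vec n" using zspan_carrier assms by auto
  then have "real 0 \<cdot>\<^sub>v x = 0\<^sub>v n" by auto
  then show ?case using zspan_zero[of n S] by simp
next
  case (Suc k)
  have "real (Suc k) \<cdot>\<^sub>v x = real k \<cdot>\<^sub>v x + x"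
    by (auto simp: algebra_simps)
  then show ?case using zspan_add[OF Suc assms(2)] by simp
qed

lemma zspan_smult:
  assumes "S \<subseteq> carrier_vec n" "x \<in> zspan n S"
  shows "real_of_int k \<cdot>\<^sub>v x \<in> zspan n S"
proof (cases "k \<ge> 0")
  case True
  then show ?thesis using zspan_smult_nat[OF assms, of "nat k"] by simp
next
  case False
  have "- (real (nat (- k)) \<cdot>\<^sub>v x) \<in> zspan n S"
    by (intro zspan_uminus zspan_smult_nat assms)
  moreover have "- (real (nat (- k)) \<cdot>\<^sub>v x) = real_of_int k \<cdot>\<^sub>v x"
    using False by auto
  ultimately show ?thesis by simp
qed

text \<open>Coefficients are attached to list positions, so the definition makes sense before the
  entries are known to be distinct. Real coefficients let it serve linear independence and, through
  \<open>of_int\<close>, integral spans.\<close>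

definition lcomb :: "nat \<Rightarrow> real vec list \<Rightarrow> (nat \<Rightarrow> real) \<Rightarrow> real vec" where
  "lcomb n bs c = vec n (\<lambda>k. \<Sum>i<length bs. c i * bs ! i $ k)"

lemma lcomb_carrier [simp]: "lcomb n bs c \<in> carrier_vec n"
  by (simp add: lcomb_def)

lemma lcomb_scalar_prod:
  assumes "set bs \<subseteq> carrier_vec n" "y \<in> carrier_vec n"
  shows "lcomb n bs c \<bullet> y = (\<Sum>i<length bs. c i * (bs ! i \<bullet> y))"
proof -
  have "lcomb n bs c \<bullet> y = (\<Sum>k<n. (\<Sum>i<length bs. c i * bs ! i $ k) * y $ k)"
    unfolding scalar_prod_sum_lessThan[OF assms(2)] by (intro sum.cong) (auto simp: lcomb_def)
  also have "\<dots> = (\<Sum>i<length bs. \<Sum>k<n. c i * (bs ! i $ k * y $ k))"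
    by (subst sum.swap) (simp add: sum_distrib_right mult.assoc)
  finally show ?thesis
    by (simp add: scalar_prod_sum_lessThan[OF assms(2)] sum_distrib_left)
qed

lemma scalar_prod_lcomb:
  assumes "set bs \<subseteq> carrier_vec n" "y \<in> carrier_vec n"
  shows "y \<bullet> lcomb n bs c = (\<Sum>i<length bs. c i * (y \<bullet> bs ! i))"
proof -
  have "y \<bullet> lcomb n bs c = lcomb n bs c \<bullet> y"
    by (rule comm_scalar_prod) (use assms in auto)
  moreover have "bs ! i \<bullet> y = y \<bullet> bs ! i" if "i < length bs" for i
    by (rule comm_scalar_prod) (use assms that nth_mem in auto)
  ultimately show ?thesis using lcomb_scalar_prod[OF assms] by simp
qed

lemma lcomb_single:
  assumes "set bs \<subseteq> carrier_vec n" "j < length bs"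
  shows "lcomb n bs (\<lambda>i. of_int (if i = j then z else 0)) = of_int z \<cdot>\<^sub>v bs ! j"
proof -
  have "bs ! j \<in> carrier_vec n" using assms by auto
  moreover have "of_int (if i = j then z else 0) * r = (if i = j then of_int z * r else 0 :: real)" for i r
    by simp
  ultimately show ?thesis using assms by (intro eq_vecI) (auto simp: lcomb_def)
qed

lemma zspan_lcomb:
  assumes bs: "set bs \<subseteq> carrier_vec n"
  shows "zspan n (set bs) = {lcomb n bs (\<lambda>i. of_int (c i)) | c :: nat \<Rightarrow> int. True}" (is "?L = ?R")
proof
  have mem: "lcomb n bs (\<lambda>i. of_int (c i)) \<in> ?R" for c :: "nat \<Rightarrow> int" by blast
  show "?L \<subseteq> ?R"
  proof
    fix x assume "x \<in> ?L"
    then show "x \<in> ?R" unfolding zspan_def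
    proof (induction rule: generate.induct)
      case one
      show ?case by (auto simp: monoid_vec_simps lcomb_def intro!: exI[of _ "\<lambda>_. 0"])
    next
      case (incl h)
      then obtain j where j: "j < length bs" "h = bs ! j" by (auto simp: in_set_conv_nth)
      then have "h = lcomb n bs (\<lambda>i. of_int (if i = j then 1 else 0))"
        using lcomb_single[OF bs j(1), of 1] by simp
      then show ?case using mem[of "\<lambda>i. if i = j then 1 else 0"] by simp
    next
      case (inv h)
      then obtain j where j: "j < length bs" "h = bs ! j" by (auto simp: in_set_conv_nth)
      have h: "h \<in> carrier_vec n" using inv bs by auto
      have "- h = lcomb n bs (\<lambda>i. of_int (if i = j then -1 else 0))"
        using lcomb_single[OF bs j(1), of "-1"] j by auto
      then show ?case using inv_monoid_vec[OF h] mem[of "\<lambda>i. if i = j then - 1 else 0"] by simp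
    next
      case (eng h1 h2)
      then obtain c1 c2 :: "nat \<Rightarrow> int" where "h1 = lcomb n bs (\<lambda>i. of_int (c1 i))" "h2 = lcomb n bs (\<lambda>i. of_int (c2 i))"
        by auto
      then have "h1 + h2 = lcomb n bs (\<lambda>i. of_int (c1 i + c2 i))"
        by (auto simp: lcomb_def sum.distrib distrib_right)
      then show ?case using mem[of "\<lambda>i. c1 i + c2 i"] by (simp add: monoid_vec_simps)
    qed
  qed
  have "vec n (\<lambda>k. \<Sum>i<m. of_int (c i) * bs ! i $ k) \<in> ?L" if "m \<le> length bs" for c :: "nat \<Rightarrow> int" and m
    using that
  proof (induction m)
    case 0
    have "vec n (\<lambda>k. 0::real) = 0\<^sub>v n" by auto
    then show ?case using zspan_zero by simp
  next
    case (Suc m)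
    then have "bs ! m \<in> carrier_vec n" using bs by auto
    then have "vec n (\<lambda>k. \<Sum>i<Suc m. of_int (c i) * bs ! i $ k)
        = vec n (\<lambda>k. \<Sum>i<m. of_int (c i) * bs ! i $ k) + of_int (c m) \<cdot>\<^sub>v bs ! m"
      by auto
    moreover have "of_int (c m) \<cdot>\<^sub>v bs ! m \<in> ?L"
      using Suc.prems bs by (intro zspan_smult zspan_incl) auto
    ultimately show ?case using Suc by (auto intro!: zspan_add)
  qed
  then show "?R \<subseteq> ?L" by (auto simp: lcomb_def)
qed

text \<open>Bridge from \<open>lin_dep\<close>, whose coefficients are functions on a set of
  vectors, to coefficients indexed by position; on a distinct list the two kinds correspond.\<close>

lemma lin_indpt_iff_lcomb:
  assumes bs: "set bs \<subseteq> carrier_vec n" and dist: "distinct bs"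
  shows "\<not> module.lin_dep class_ring (module_vec TYPE(real) n) (set bs) \<longleftrightarrow>
    (\<forall>c. lcomb n bs c = 0\<^sub>v n \<longrightarrow> (\<forall>i<length bs. c i = 0))"
proof -
  interpret vec_space "TYPE(real)" n .
  have L: "lincomb f (set bs) = lcomb n bs (\<lambda>i. f (bs ! i))" for f
  proof (rule eq_vecI)
    show "dim_vec (lincomb f (set bs)) = dim_vec (lcomb n bs (\<lambda>i. f (bs ! i)))"
      using lincomb_dim[of "set bs" f] bs by (simp add: lcomb_def)
  next
    fix k assume "k < dim_vec (lcomb n bs (\<lambda>i. f (bs ! i)))"
    then have k: "k < n" by (simp add: lcomb_def)
    have "lincomb f (set bs) $ k = (\<Sum>x\<in>set bs. f x * x $ k)"
      using lincomb_index[OF k bs] .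
    also have "\<dots> = (\<Sum>i<length bs. f (bs ! i) * bs ! i $ k)"
      by (rule sum.reindex_bij_betw[symmetric, OF bij_betw_nth[OF dist]]) auto
    finally show "lincomb f (set bs) $ k = lcomb n bs (\<lambda>i. f (bs ! i)) $ k"
      using k by (simp add: lcomb_def)
  qed
  show ?thesis
  proof
    assume ind: "\<not> lin_dep (set bs)"
    show "\<forall>c. lcomb n bs c = 0\<^sub>v n \<longrightarrow> (\<forall>i<length bs. c i = 0)"
    proof (intro allI impI)
      fix c i assume c: "lcomb n bs c = 0\<^sub>v n" and i: "i < length bs"
      \<comment> \<open>The position of a vector is unambiguous because the list is
        distinct.\<close>
      define f where "f x = c (THE j. j < length bs \<and> bs ! j = x)" for x
      have f: "f (bs ! j) = c j" if "j < length bs" for j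
      proof -
        have "(THE k. k < length bs \<and> bs ! k = bs ! j) = j"
          using that dist by (auto simp: nth_eq_iff_index_eq)
        then show ?thesis by (simp add: f_def)
      qed
      have "lincomb f (set bs) = 0\<^sub>v n"
        unfolding L c[symmetric] by (auto simp: lcomb_def f)
      then have "f (bs ! i) = 0"
        using not_lindepD[OF ind, of "set bs" f] i bs by auto
      then show "c i = 0" using f[OF i] by simp
    qed
  next
    assume A: "\<forall>c. lcomb n bs c = 0\<^sub>v n \<longrightarrow> (\<forall>i<length bs. c i = 0)"
    have "f v = 0" if "lincomb f (set bs) = 0\<^sub>v n" "v \<in> set bs" for f v
    proof -
      have "lcomb n bs (\<lambda>i. f (bs ! i)) = 0\<^sub>v n" using that(1) unfolding L .
      with A have "\<forall>i<length bs. f (bs ! i) = 0" by blast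
      then show ?thesis using that(2) by (auto simp: in_set_conv_nth)
    qed
    then show "\<not> lin_dep (set bs)"
      by (intro finite_lin_indpt2) (use bs in auto)
  qed
qed

text \<open>Independence by positions already excludes repetitions: two equal entries would give a
  relation with coefficients 1 and -1.\<close>

lemma lattice_basisI:
  assumes bs: "set bs \<subseteq> carrier_vec n"
    and ind: "\<And>c. lcomb n bs c = 0\<^sub>v n \<Longrightarrow> \<forall>i<length bs. c i = 0"
  shows "lattice_basis n (zspan n (set bs)) bs"
proof -
  have "distinct bs"
  proof (rule ccontr)
    assume "\<not> distinct bs"
    then obtain i j where ij: "i < length bs" "j < length bs" "i \<noteq> j" "bs ! i = bs ! j"
      by (auto simp: distinct_conv_nth)
    let ?c = "\<lambda>k. (if k = i then 1 else 0) - (if k = j then 1 else 0) :: real"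
    have "lcomb n bs ?c = 0\<^sub>v n"
      using ij by (auto simp: lcomb_def left_diff_distrib sum_subtractf if_distrib[of "\<lambda>x. x * _"] sum.delta cong: if_cong)
    from ind[OF this] ij(1) have "?c i = 0" by blast
    then show False using ij(3) by simp
  qed
  then show ?thesis
    unfolding lattice_basis_def using lin_indpt_iff_lcomb[OF bs] bs ind by blast
qed

lemma lattice_basis_indep:
  assumes "lattice_basis n L bs" "lcomb n bs c = 0\<^sub>v n" "i < length bs"
  shows "c i = 0"
  using assms lin_indpt_iff_lcomb[of bs n] unfolding lattice_basis_def by blast

lemma lcomb_eq_imp_coeff_eq:
  assumes "lattice_basis n L bs" "lcomb n bs c = lcomb n bs d" "i < length bs"
  shows "c i = d i"
proof -
  have "lcomb n bs (\<lambda>i. c i - d i) = lcomb n bs c - lcomb n bs d"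
    by (auto simp: lcomb_def left_diff_distrib sum_subtractf)
  also have "\<dots> = 0\<^sub>v n" unfolding assms(2) by simp
  finally show ?thesis using lattice_basis_indep[OF assms(1) _ assms(3)] by fastforce
qed

section \<open>Change of basis; rank and Gram determinant are invariants\<close>

lemma lattice_basis_transition:
  assumes L: "lattice_basis n L bs" and L': "lattice_basis n L bs'"
  obtains U :: "nat \<Rightarrow> nat \<Rightarrow> int"
  where "\<And>i. i < length bs' \<Longrightarrow> bs' ! i = lcomb n bs (\<lambda>j. of_int (U i j))"
proof -
  have "\<exists>c :: nat \<Rightarrow> int. bs' ! i = lcomb n bs (\<lambda>j. of_int (c j))" if "i < length bs'" for i
  proof -
    have "bs' ! i \<in> L" using that L' zspan_incl[of "bs' ! i" "set bs'"] by (auto simp: lattice_basis_def)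
    then show ?thesis using zspan_lcomb[of bs n] L by (auto simp: lattice_basis_def)
  qed
  then show ?thesis using that by metis
qed

text \<open>Substituting one expansion into the other writes a basis vector in terms of its own
  basis, where coefficients are unique.\<close>

lemma transition_inverse:
  assumes L: "lattice_basis n L bs" and L': "lattice_basis n L bs'"
    and U: "\<And>i. i < length bs' \<Longrightarrow> bs' ! i = lcomb n bs (\<lambda>j. of_int (U i j))"
    and V: "\<And>i. i < length bs \<Longrightarrow> bs ! i = lcomb n bs' (\<lambda>j. of_int (V i j))"
    and i: "i < length bs" and j: "j < length bs"
  shows "(\<Sum>k<length bs'. V i k * U k j) = (if i = j then 1 else 0 :: int)"
proof -
  have bs: "set bs \<subseteq> carrier_vec n" using L by (simp add: lattice_basis_def)
  then have carr: "bs ! i \<in> carrier_vec n" using i by auto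
  have "lcomb n bs (\<lambda>j. of_int (if j = i then 1 else 0)) = bs ! i"
    using lcomb_single[OF bs i, of 1] by simp
  also have "\<dots> = lcomb n bs (\<lambda>j. of_int (\<Sum>k<length bs'. V i k * U k j))"
  proof (rule eq_vecI)
    fix m assume "m < dim_vec (lcomb n bs (\<lambda>j. of_int (\<Sum>k<length bs'. V i k * U k j)))"
    then have m: "m < n" by (simp add: lcomb_def)
    have "bs ! i $ m = (\<Sum>k<length bs'. of_int (V i k) * bs' ! k $ m)"
      using arg_cong[OF V[OF i], of "\<lambda>v. v $ m"] m by (simp add: lcomb_def)
    also have "\<dots> = (\<Sum>k<length bs'. of_int (V i k) * (\<Sum>j<length bs. of_int (U k j) * bs ! j $ m))"
      using U m by (intro sum.cong) (auto simp: lcomb_def)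
    also have "\<dots> = (\<Sum>j<length bs. of_int (\<Sum>k<length bs'. V i k * U k j) * bs ! j $ m)"
      by (simp add: sum_distrib_left sum_distrib_right mult.assoc) (rule sum.swap)
    finally show "bs ! i $ m = lcomb n bs (\<lambda>j. of_int (\<Sum>k<length bs'. V i k * U k j)) $ m"
      using m by (simp add: lcomb_def)
  qed (use carr in \<open>auto simp: lcomb_def\<close>)
  finally have "real_of_int (if j = i then 1 else 0) = of_int (\<Sum>k<length bs'. V i k * U k j)"
    by (rule lcomb_eq_imp_coeff_eq[OF L _ j])
  then show ?thesis by (subst (asm) of_int_eq_iff) auto
qed

lemma lattice_basis_length_unique:
  assumes L: "lattice_basis n L bs" and L': "lattice_basis n L bs'"
  shows "length bs = length bs'"
proof -
  obtain U where U: "\<And>i. i < length bs' \<Longrightarrow> bs' ! i = lcomb n bs (\<lambda>j. of_int (U i j))"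
    using lattice_basis_transition[OF L L'] by metis
  obtain V where V: "\<And>i. i < length bs \<Longrightarrow> bs ! i = lcomb n bs' (\<lambda>j. of_int (V i j))"
    using lattice_basis_transition[OF L' L] by metis
  \<comment> \<open>the two transition matrices \<open>U\<close>, \<open>V\<close> satisfy \<open>tr (V U) = tr (U V)\<close>\<close>
  have "int (length bs) = (\<Sum>i<length bs. \<Sum>k<length bs'. V i k * U k i)"
    using transition_inverse[OF L L' U V] by simp
  also have "\<dots> = (\<Sum>k<length bs'. \<Sum>i<length bs. U k i * V i k)"
    by (subst sum.swap) (simp add: mult.commute)
  also have "\<dots> = int (length bs')"
    using transition_inverse[OF L' L V U] by simp
  finally show ?thesis by simp
qed

lemma gram_det_unique:
  assumes L: "lattice_basis n L bs" and L': "lattice_basis n L bs'"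
  shows "det (gram_matrix bs) = det (gram_matrix bs')"
proof -
  define l where "l = length bs"
  have l': "length bs' = l" using lattice_basis_length_unique[OF L L'] by (simp add: l_def)
  have bs: "set bs \<subseteq> carrier_vec n" "set bs' \<subseteq> carrier_vec n"
    using L L' by (auto simp: lattice_basis_def)
  obtain U where U: "\<And>i. i < length bs' \<Longrightarrow> bs' ! i = lcomb n bs (\<lambda>j. of_int (U i j))"
    using lattice_basis_transition[OF L L'] by metis
  obtain V where V: "\<And>i. i < length bs \<Longrightarrow> bs ! i = lcomb n bs' (\<lambda>j. of_int (V i j))"
    using lattice_basis_transition[OF L' L] by metis
  let ?U = "mat l l (\<lambda>(i, j). U i j)" and ?V = "mat l l (\<lambda>(i, j). V i j)"
  have "?V * ?U = 1\<^sub>m l"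
  proof (rule eq_matI)
    fix i j assume "i < dim_row (1\<^sub>m l)" "j < dim_col (1\<^sub>m l)"
    then show "(?V * ?U) $$ (i, j) = 1\<^sub>m l $$ (i, j)"
      using transition_inverse[OF L L' U V, of i j]
      by (auto simp: scalar_prod_def l' l_def[symmetric] atLeast0LessThan)
  qed auto
  then have "det ?V * det ?U = 1"
    using det_mult[of ?V l ?U] by simp
  \<comment> \<open>An integer unit is 1 or -1, and its sign cancels below because the Gram matrix
    is multiplied by \<open>?R\<close> on one side and by its transpose on the other.\<close>
  then have sq: "det ?U * det ?U = 1"
    by (auto simp: zmult_eq_1_iff)
  let ?R = "map_mat real_of_int ?U"
  have G: "gram_matrix bs \<in> carrier_mat l l" by (simp add: gram_matrix_def l_def)
  have "gram_matrix bs' = ?R * gram_matrix bs * ?R\<^sup>T"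
  proof (rule eq_matI)
    fix i j assume "i < dim_row (?R * gram_matrix bs * ?R\<^sup>T)" "j < dim_col (?R * gram_matrix bs * ?R\<^sup>T)"
    then have ij: "i < l" "j < l" by auto
    have "gram_matrix bs' $$ (i, j) = lcomb n bs (\<lambda>j. of_int (U i j)) \<bullet> lcomb n bs (\<lambda>k. of_int (U j k))"
      using ij U l' by (simp add: gram_matrix_def)
    also have "\<dots> = (\<Sum>p<l. of_int (U i p) * (\<Sum>q<l. of_int (U j q) * (bs ! p \<bullet> bs ! q)))"
      using bs by (subst lcomb_scalar_prod) (auto simp: l_def subset_iff intro!: sum.cong scalar_prod_lcomb arg_cong2[of _ _ _ _ "(*)"])
    also have "\<dots> = (\<Sum>q<l. (\<Sum>p<l. of_int (U i p) * (bs ! p \<bullet> bs ! q)) * of_int (U j q))"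
      by (simp add: sum_distrib_left sum_distrib_right mult_ac) (rule sum.swap)
    also have "\<dots> = (?R * gram_matrix bs * ?R\<^sup>T) $$ (i, j)"
      using ij by (auto simp: scalar_prod_def gram_matrix_def l_def[symmetric] atLeast0LessThan)
    finally show "gram_matrix bs' $$ (i, j) = (?R * gram_matrix bs * ?R\<^sup>T) $$ (i, j)" .
  qed (auto simp: gram_matrix_def l')
  moreover have "det (?R * gram_matrix bs * ?R\<^sup>T) = det ?R * det (gram_matrix bs) * det ?R"
  proof -
    have R: "?R \<in> carrier_mat l l" by simp
    have "det (?R * gram_matrix bs * ?R\<^sup>T) = det (?R * gram_matrix bs) * det (?R\<^sup>T)"
      by (rule det_mult) (use R G in auto)
    then show ?thesis using det_mult[OF R G] det_transpose[OF R] by metis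
  qed
  ultimately have "det (gram_matrix bs') = det ?R * det (gram_matrix bs) * det ?R" by (rule trans[OF arg_cong])
  also have "det ?R = of_int (det ?U)" by (rule of_int_hom.hom_det)
  also have "of_int (det ?U) * det (gram_matrix bs) * of_int (det ?U) = of_int (det ?U * det ?U) * det (gram_matrix bs)"
    by simp
  finally show ?thesis unfolding sq by simp
qed

lemma lattice_rank_eq:
  assumes "lattice_basis n L bs"
  shows "lattice_rank n L = length bs"
  unfolding lattice_rank_def
  using someI[of "lattice_basis n L", OF assms] lattice_basis_length_unique assms by blast

lemma lattice_det_eq:
  assumes "lattice_basis n L bs"
  shows "lattice_det n L = det (gram_matrix bs)"
  unfolding lattice_det_def
  using someI[of "lattice_basis n L", OF assms] gram_det_unique assms by blast

section \<open>Short vectors of the lattice\<close>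

lemma zspan_subset:
  assumes "S \<subseteq> carrier_vec n" "S \<subseteq> H" "0\<^sub>v n \<in> H"
    and "\<And>x y. x \<in> H \<Longrightarrow> y \<in> H \<Longrightarrow> x + y \<in> H" "\<And>x. x \<in> H \<Longrightarrow> - x \<in> H"
  shows "zspan n S \<subseteq> H"
proof
  fix x assume "x \<in> zspan n S"
  then show "x \<in> H" unfolding zspan_def
  proof (induction rule: generate.induct)
    case (inv h)
    then have "h \<in> carrier_vec n" "h \<in> H" using assms(1,2) by auto
    then show ?case using inv_monoid_vec[of h n] assms(5) by simp
  qed (use assms in \<open>auto simp: monoid_vec_simps\<close>)
qed

text \<open>Coordinates in \<open>A15_plus\<close> are quarters of integers, so lists scaled by 4
  represent vectors exactly and finite checks become evaluation over \<open>int\<close>. Inner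
  products are then scaled by 16.\<close>

definition qvec :: "int list \<Rightarrow> real vec" where
  "qvec xs = vec (length xs) (\<lambda>i. of_int (xs ! i) / 4)"

definition idot :: "int list \<Rightarrow> int list \<Rightarrow> int" where
  "idot xs ys = sum_list (map2 (*) xs ys)"

lemma qvec_alt: "(1/4) \<cdot>\<^sub>v vec_of_list (map real_of_int xs) = qvec xs"
  by (rule eq_vecI) (auto simp: qvec_def vec_of_list_index)

lemma qvec_scalar_prod:
  assumes "length xs = length ys"
  shows "qvec xs \<bullet> qvec ys = of_int (idot xs ys) / 16"
proof -
  have "real_of_int (idot xs ys) = (\<Sum>i<length ys. of_int (xs ! i) * of_int (ys ! i))"
    unfolding idot_def sum_list_sum_nth using assms by (simp add: atLeast0LessThan)
  then show ?thesis
    using assms by (simp add: qvec_def scalar_prod_def atLeast0LessThan sum_divide_distrib)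
qed

text \<open>Since -3/4 and 1/4 differ by 1, the glue vector is congruent to 1/4 modulo 1 in every
  coordinate. Conversely, a vector of class k/4 with coordinate sum 0 returns to the root lattice
  after subtracting k glue vectors.\<close>

lemma A15_plus_iff:
  "x \<in> A15_plus \<longleftrightarrow> x \<in> carrier_vec 16 \<and> (\<Sum>i<16. x $ i) = 0 \<and>
     (\<exists>(k::int) (z::nat \<Rightarrow> int). \<forall>i<16. x $ i = of_int k / 4 + of_int (z i))"
proof -
  define g :: "real vec" where "g = (1/4) \<cdot>\<^sub>v vec_of_list [1,1,1,1,1,1,1,1,1,1,1,1,-3,-3,-3,-3]"
  let ?S = "A_lattice 15 \<union> {g}"
  define H where "H = {x :: real vec. x \<in> carrier_vec 16 \<and> (\<Sum>i<16. x $ i) = 0 \<and>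
     (\<exists>(k::int) (z::nat \<Rightarrow> int). \<forall>i<16. x $ i = of_int k / 4 + of_int (z i))}"
  have gr: "[1,1,1,1,1,1,1,1,1,1,1,1,-3,-3,-3,-3] = replicate 12 (1::real) @ replicate 4 (-3)"
    by (simp add: eval_nat_numeral)
  have gc: "g \<in> carrier_vec 16" unfolding g_def by (rule carrier_vecI) simp
  have gi: "g $ i = 1/4 + of_int (if i < 12 then 0 else - 1)" if "i < 16" for i
    using that unfolding g_def gr by (simp add: vec_of_list_index nth_append)
  have "(\<Sum>i<16. g $ i) = (\<Sum>i<16. 1/4 - of_bool (i \<in> {12..<16::nat}))"
    by (rule sum.cong) (auto simp: gi)
  also have "\<dots> = 4 - real (card ({..<16} \<inter> {12..<16::nat}))"
    by (simp add: sum_subtractf del: of_bool_conj atLeastLessThan_iff)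
  also have "{..<16} \<inter> {12..<16} = {12..<16::nat}" by auto
  finally have gs: "(\<Sum>i<16. g $ i) = 0" by simp
  have HI: "x \<in> H" if "x \<in> carrier_vec 16" "(\<Sum>i<16. x $ i) = 0"
    "\<And>i. i < 16 \<Longrightarrow> x $ i = of_int k / 4 + of_int (z i)" for x k and z :: "nat \<Rightarrow> int"
    unfolding H_def mem_Collect_eq by (intro conjI exI[of _ k] exI[of _ z] allI impI that)
  have HE: thesis if "x \<in> H" "\<And>k z. x \<in> carrier_vec 16 \<Longrightarrow> (\<Sum>i<16. x $ i) = 0 \<Longrightarrow>
    (\<And>i. i < 16 \<Longrightarrow> x $ i = of_int k / 4 + of_int (z i)) \<Longrightarrow> thesis" for x thesis
    using that(1) unfolding H_def mem_Collect_eq by (elim conjE exE) (rule that(2), simp_all)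
  have S: "?S \<subseteq> carrier_vec 16"
    using gc by (auto simp: A_lattice_def Z_lattice_def)
  have "zspan 16 ?S \<subseteq> H"
  proof (rule zspan_subset[OF S])
    have "g \<in> H"
      using gc gs gi by (intro HI[of g 1 "\<lambda>i. if i < 12 then 0 else - 1"]) simp_all
    moreover have "y \<in> H" if y: "y \<in> A_lattice 15" for y
    proof -
      have y': "y \<in> carrier_vec 16" "\<forall>i<16. y $ i \<in> \<int>" "(\<Sum>i<16. y $ i) = 0"
        using y by (auto simp: A_lattice_def Z_lattice_def)
      then show ?thesis by (intro HI[of y 0 "\<lambda>i. \<lfloor>y $ i\<rfloor>"]) simp_all
    qed
    ultimately show "?S \<subseteq> H" by blast
  next
    show "0\<^sub>v 16 \<in> H" by (intro HI[of _ 0 "\<lambda>_. 0"]) simp_all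
  next
    fix x y assume xy: "x \<in> H" "y \<in> H"
    obtain k z where x: "x \<in> carrier_vec 16" "(\<Sum>i<16. x $ i) = 0"
      "\<And>i. i < 16 \<Longrightarrow> x $ i = of_int k / 4 + of_int (z i)" by (rule HE[OF xy(1)]) (rule that)
    obtain l w where y: "y \<in> carrier_vec 16" "(\<Sum>i<16. y $ i) = 0"
      "\<And>i. i < 16 \<Longrightarrow> y $ i = of_int l / 4 + of_int (w i)" by (rule HE[OF xy(2)]) (rule that)
    have "(x + y) $ i = of_int (k + l) / 4 + of_int (z i + w i)" if "i < 16" for i
      using x y that by (simp add: add_divide_distrib)
    moreover have "(\<Sum>i<16. (x + y) $ i) = (\<Sum>i<16. x $ i) + (\<Sum>i<16. y $ i)"
      using x(1) y(1) by (simp add: sum.distrib)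
    ultimately show "x + y \<in> H" using x y by (intro HI[of "x + y" "k + l" "\<lambda>i. z i + w i"]) simp_all
  next
    fix x assume "x \<in> H"
    then obtain k z where x: "x \<in> carrier_vec 16" "(\<Sum>i<16. x $ i) = 0"
      "\<And>i. i < 16 \<Longrightarrow> x $ i = of_int k / 4 + of_int (z i)" by (rule HE) (rule that)
    have "(- x) $ i = of_int (- k) / 4 + of_int (- z i)" if "i < 16" for i using x that by simp
    moreover have "(\<Sum>i<16. (- x) $ i) = - (\<Sum>i<16. x $ i)"
      using x(1) by (simp add: sum_negf)
    ultimately show "- x \<in> H" using x by (intro HI[of "- x" "- k" "\<lambda>i. - z i"]) simp_all
  qed
  moreover have "H \<subseteq> zspan 16 ?S"
  proof
    fix x assume "x \<in> H"
    then obtain k z where x: "x \<in> carrier_vec 16" "(\<Sum>i<16. x $ i) = 0"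
      "\<And>i. i < 16 \<Longrightarrow> x $ i = of_int k / 4 + of_int (z i)" by (rule HE) (rule that)
    let ?y = "x - of_int k \<cdot>\<^sub>v g"
    have "?y $ i \<in> \<int>" if "i < 16" for i
    proof -
      have "?y $ i = of_int (z i - k * (if i < 12 then 0 else - 1))"
        using that x gc gi[OF that] by (auto simp: algebra_simps)
      then show ?thesis by simp
    qed
    moreover have "(\<Sum>i<16. ?y $ i) = (\<Sum>i<16. x $ i) - of_int k * (\<Sum>i<16. g $ i)"
      using x gc by (simp add: sum_subtractf sum_distrib_left)
    ultimately have "?y \<in> A_lattice 15"
      using x gs gc by (simp add: A_lattice_def Z_lattice_def)
    then have "?y \<in> zspan 16 ?S" by (intro zspan_incl UnI1)
    moreover have "of_int k \<cdot>\<^sub>v g \<in> zspan 16 ?S" by (intro zspan_smult[OF S] zspan_incl UnI2 singletonI)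
    ultimately have "?y + of_int k \<cdot>\<^sub>v g \<in> zspan 16 ?S" by (rule zspan_add)
    moreover have "?y + of_int k \<cdot>\<^sub>v g = x" using x gc by auto
    ultimately show "x \<in> zspan 16 ?S" by simp
  qed
  ultimately have "A15_plus = H" unfolding A15_plus_def g_def[symmetric] by (rule equalityI)
  then show ?thesis by (rule ssubst) (simp only: H_def mem_Collect_eq)
qed

lemma A15_plusI:
  fixes z :: "nat \<Rightarrow> int"
  assumes "x \<in> carrier_vec 16" "(\<Sum>i<16. x $ i) = 0" "\<And>i. i < 16 \<Longrightarrow> x $ i = of_int k / 4 + of_int (z i)"
  shows "x \<in> A15_plus"
  unfolding A15_plus_iff by (intro conjI exI[of _ k] exI[of _ z] allI impI assms)

lemma A15_plusE:
  assumes "x \<in> A15_plus"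
  obtains k :: int and z :: "nat \<Rightarrow> int" where "x \<in> carrier_vec 16" "(\<Sum>i<16. x $ i) = 0"
    "\<And>i. i < 16 \<Longrightarrow> x $ i = of_int k / 4 + of_int (z i)"
  using assms unfolding A15_plus_iff by (elim conjE exE) (rule that, simp_all)

lemma A15_plus_carrier: "A15_plus \<subseteq> carrier_vec 16"
  by (auto simp: A15_plus_iff)

lemma A15_plusD [dest, simp]: "x \<in> A15_plus \<Longrightarrow> x \<in> carrier_vec 16"
  by (simp add: A15_plus_iff)

lemma A15_plus_eq_zspan: "\<exists>S \<subseteq> carrier_vec 16. A15_plus = zspan 16 S"
  unfolding A15_plus_def
  by (rule exI, rule conjI[rotated], rule refl) (auto simp: A_lattice_def Z_lattice_def intro!: carrier_vecI)

lemma
  shows A15_plus_zero: "0\<^sub>v 16 \<in> A15_plus"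
    and A15_plus_add: "x \<in> A15_plus \<Longrightarrow> y \<in> A15_plus \<Longrightarrow> x + y \<in> A15_plus"
    and A15_plus_uminus: "x \<in> A15_plus \<Longrightarrow> - x \<in> A15_plus"
    and A15_plus_smult: "x \<in> A15_plus \<Longrightarrow> of_int k \<cdot>\<^sub>v x \<in> A15_plus"
proof -
  obtain S where S: "S \<subseteq> carrier_vec 16" "A15_plus = zspan 16 S" using A15_plus_eq_zspan by blast
  show "0\<^sub>v 16 \<in> A15_plus" unfolding S(2) by (rule zspan_zero)
  show "x \<in> A15_plus \<Longrightarrow> y \<in> A15_plus \<Longrightarrow> x + y \<in> A15_plus" unfolding S(2) by (rule zspan_add)
  show "x \<in> A15_plus \<Longrightarrow> - x \<in> A15_plus" unfolding S(2) by (rule zspan_uminus[OF S(1)])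
  show "x \<in> A15_plus \<Longrightarrow> of_int k \<cdot>\<^sub>v x \<in> A15_plus" unfolding S(2) by (rule zspan_smult[OF S(1)])
qed

text \<open>The constant part l/4 of \<open>y\<close> is invisible to \<open>x\<close>, whose
  coordinates sum to 0. The integral parts of \<open>y\<close> sum to -4l, and this factor 4 absorbs
  the denominator in the constant part of \<open>x\<close>.\<close>

lemma A15_plus_integral:
  assumes "x \<in> A15_plus" "y \<in> A15_plus"
  shows "x \<bullet> y \<in> \<int>"
proof -
  obtain k z where x: "x \<in> carrier_vec 16" "(\<Sum>i<16. x $ i) = 0" "\<And>i. i < 16 \<Longrightarrow> x $ i = of_int k / 4 + of_int (z i)"
    by (rule A15_plusE[OF assms(1)]) (rule that)
  obtain l w where y: "y \<in> carrier_vec 16" "(\<Sum>i<16. y $ i) = 0" "\<And>i. i < 16 \<Longrightarrow> y $ i = of_int l / 4 + of_int (w i)"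
    by (rule A15_plusE[OF assms(2)]) (rule that)
  have w: "(\<Sum>i<16. real_of_int (w i)) = - 4 * of_int l"
    using y(2) by (simp add: y(3) sum.distrib)
  have "x \<bullet> y = (\<Sum>i<16. x $ i * (of_int l / 4) + x $ i * of_int (w i))"
    unfolding scalar_prod_sum_lessThan[OF y(1)] by (intro sum.cong) (auto simp: y(3) distrib_left)
  also have "\<dots> = (\<Sum>i<16. x $ i * of_int (w i))"
    using x(2) by (simp add: sum.distrib sum_divide_distrib[symmetric] sum_distrib_right[symmetric])
  also have "\<dots> = (\<Sum>i<16. of_int k / 4 * of_int (w i) + of_int (z i) * of_int (w i))"
    by (intro sum.cong) (auto simp: x(3) distrib_right)
  also have "\<dots> = of_int k / 4 * (\<Sum>i<16. of_int (w i)) + of_int (\<Sum>i<16. z i * w i)"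
    by (simp add: sum.distrib sum_distrib_left)
  also have "\<dots> = of_int (- k * l + (\<Sum>i<16. z i * w i))"
    unfolding w by simp
  finally show ?thesis using Ints_of_int[of "- k * l + (\<Sum>i<16. z i * w i)"] by (simp only:)
qed

text \<open>Executable membership test for lists scaled by 4: congruence of all coordinates modulo 1
  becomes congruence to the first entry modulo 4.\<close>

definition A15_list :: "int list \<Rightarrow> bool" where
  "A15_list xs \<longleftrightarrow> length xs = 16 \<and> sum_list xs = 0 \<and> list_all (\<lambda>x. (x - hd xs) mod 4 = 0) xs"

lemma qvec_in_A15_plus:
  assumes "A15_list xs"
  shows "qvec xs \<in> A15_plus"
proof -
  have l: "length xs = 16" using assms by (simp add: A15_list_def)
  have "(\<Sum>i<16. qvec xs $ i) = (\<Sum>i<16. real_of_int (xs ! i)) / 4"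
    using l by (simp add: qvec_def sum_divide_distrib)
  also have "(\<Sum>i<16. real_of_int (xs ! i)) = of_int (sum_list xs)"
    using l by (simp add: sum_list_sum_nth atLeast0LessThan)
  finally have "(\<Sum>i<16. qvec xs $ i) = 0" using assms by (simp add: A15_list_def)
  moreover have "qvec xs $ i = of_int (hd xs) / 4 + of_int ((xs ! i - hd xs) div 4)" if i: "i < 16" for i
  proof -
    have "(xs ! i - hd xs) mod 4 = 0" using assms l i by (auto simp: A15_list_def list_all_length)
    then have "xs ! i = hd xs + 4 * ((xs ! i - hd xs) div 4)" by presburger
    then have "real_of_int (xs ! i) = of_int (hd xs + 4 * ((xs ! i - hd xs) div 4))" by (rule arg_cong)
    then show ?thesis
      using i l by (simp add: qvec_def)
  qed
  moreover have "qvec xs \<in> carrier_vec 16" using l by (simp add: qvec_def)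
  ultimately show ?thesis
    using A15_plusI[of "qvec xs" "hd xs" "\<lambda>i. (xs ! i - hd xs) div 4"] by simp
qed

section \<open>Roots, foursets and the minimal vectors of the cosets of the root lattice\<close>

definition A_root :: "nat \<Rightarrow> nat \<Rightarrow> real vec" where
  "A_root p q = unit_vec 16 p - unit_vec 16 q"

definition fourset_vec :: "nat set \<Rightarrow> real vec" where
  "fourset_vec S = vec 16 (\<lambda>i. 1/4 - of_bool (i \<in> S))"

lemma scalar_prod_root:
  assumes "x \<in> carrier_vec 16" "p < 16" "q < 16"
  shows "x \<bullet> A_root p q = x $ p - x $ q"
  unfolding A_root_def using assms by (simp add: scalar_prod_minus_distrib[of _ 16])

lemma A_root_norm:
  assumes "p < 16" "q < 16" "p \<noteq> q"
  shows "A_root p q \<bullet> A_root p q = 2"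
  using assms by (subst scalar_prod_root) (auto simp: A_root_def)

lemma A_root_in_A15_plus:
  assumes "p < 16" "q < 16"
  shows "A_root p q \<in> A15_plus"
proof -
  have "(\<Sum>i<16. A_root p q $ i) = (\<Sum>i<16. of_bool (i = p)) - (\<Sum>i<16. of_bool (i = q))"
    unfolding sum_subtractf[symmetric] using assms by (intro sum.cong) (auto simp: A_root_def)
  also have "\<dots> = 0" using assms by simp
  finally have "(\<Sum>i<16. A_root p q $ i) = 0" .
  then show ?thesis
    by (rule A15_plusI[where k = 0 and z = "\<lambda>i. of_bool (i = p) - of_bool (i = q)", rotated])
       (use assms in \<open>auto simp: A_root_def\<close>)
qed

lemma sum_zero_imp_pos_neg:
  fixes z :: "nat \<Rightarrow> int"
  assumes "(\<Sum>i<n. z i) = 0" "k < n" "z k \<noteq> 0"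
  obtains p q where "p < n" "q < n" "z p \<ge> 1" "z q \<le> -1"
proof -
  have "\<exists>p<n. z p \<ge> 1"
  proof (rule ccontr)
    assume "\<not> ?thesis"
    then have "\<forall>i<n. z i \<le> 0" by force
    then have "(\<Sum>i<n. - z i) > 0" using assms by (intro sum_pos2[of _ k]) auto
    then show False using assms(1) by (simp add: sum_negf)
  qed
  moreover have "\<exists>q<n. z q \<le> -1"
  proof (rule ccontr)
    assume "\<not> ?thesis"
    then have "\<forall>i<n. z i \<ge> 0" by force
    then have "(\<Sum>i<n. z i) > 0" using assms by (intro sum_pos2[of _ k]) auto
    then show False using assms(1) by simp
  qed
  ultimately show ?thesis using that by blast
qed

lemma sum_squares_shift:
  fixes z :: "nat \<Rightarrow> int"
  assumes "p < n" "q < n" "p \<noteq> q"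
  shows "(\<Sum>i<n. (z i - of_bool (i = p) + of_bool (i = q))\<^sup>2) = (\<Sum>i<n. (z i)\<^sup>2) - 2 * z p + 2 * z q + 2"
proof -
  have "(\<Sum>i<n. (z i - of_bool (i = p) + of_bool (i = q))\<^sup>2)
      = (\<Sum>i<n. (z i)\<^sup>2 + of_bool (i = p) * (1 - 2 * z p) + of_bool (i = q) * (1 + 2 * z q))"
    using assms by (intro sum.cong) (auto simp: power2_eq_square algebra_simps)
  also have "\<dots> = (\<Sum>i<n. (z i)\<^sup>2) + (1 - 2 * z p) + (1 + 2 * z q)"
    using assms by (simp add: sum.distrib sum_distrib_right[symmetric])
  finally show ?thesis by simp
qed

text \<open>Subtracting a root \<open>e\<^sub>p - e\<^sub>q\<close> with \<open>z p \<ge> 1\<close> and \<open>z q \<le> -1\<close> lowers the norm by at least 2.\<close>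

lemma short_sum_zero_vector:
  fixes z :: "nat \<Rightarrow> int"
  assumes s: "(\<Sum>i<n. z i) = 0" and l: "(\<Sum>i<n. (z i)\<^sup>2) < 4"
  shows "(\<forall>i<n. z i = 0) \<or> (\<exists>p q. p < n \<and> q < n \<and> p \<noteq> q \<and> (\<forall>i<n. z i = of_bool (i = p) - of_bool (i = q)))"
proof (cases "\<forall>i<n. z i = 0")
  case False
  then obtain k where k: "k < n" "z k \<noteq> 0" by blast
  obtain p q where pq: "p < n" "q < n" "z p \<ge> 1" "z q \<le> -1" using sum_zero_imp_pos_neg[OF s k] .
  then have ne: "p \<noteq> q" by auto
  define w where "w i = z i - of_bool (i = p) + of_bool (i = q)" for i
  have w1: "(\<Sum>i<n. w i) = 0"
    unfolding w_def using s pq by (simp add: sum.distrib sum_subtractf)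
  have w2: "(\<Sum>i<n. (w i)\<^sup>2) < 2"
    unfolding w_def sum_squares_shift[OF pq(1,2) ne] using l pq by linarith
  have w0: "w i = 0" if i: "i < n" for i
  proof (rule ccontr)
    assume "w i \<noteq> 0"
    obtain p' q' where pq': "p' < n" "q' < n" "w p' \<ge> 1" "w q' \<le> -1"
      using sum_zero_imp_pos_neg[OF w1 i \<open>w i \<noteq> 0\<close>] .
    then have "p' \<noteq> q'" by auto
    have "0 \<le> (\<Sum>i<n. (w i - of_bool (i = p') + of_bool (i = q'))\<^sup>2)" by (simp add: sum_nonneg)
    then show False
      unfolding sum_squares_shift[OF pq'(1,2) \<open>p' \<noteq> q'\<close>] using w2 pq' by linarith
  qed
  have "z i = of_bool (i = p) - of_bool (i = q)" if "i < n" for i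
    using w0[OF that] by (simp add: w_def)
  then show ?thesis using pq ne by blast
qed auto

text \<open>The quotient of \<open>A15_plus\<close> by the root lattice is cyclic of order 4.
  Negation exchanges the classes 1 and 3, so the sign \<open>s\<close> merges them.\<close>

lemma A15_plus_cases:
  assumes "y \<in> A15_plus"
  obtains (int) z :: "nat \<Rightarrow> int" where "\<forall>i<16. y $ i = of_int (z i)"
  | (quarter) s z where "s = 1 \<or> s = (-1::real)" "\<forall>i<16. s * y $ i = 1/4 + of_int (z i :: int)"
  | (half) z :: "nat \<Rightarrow> int" where "\<forall>i<16. y $ i = 1/2 + of_int (z i)"
proof -
  obtain k :: int and z :: "nat \<Rightarrow> int" where z: "\<And>i. i < 16 \<Longrightarrow> y $ i = of_int k / 4 + of_int (z i)"
    using A15_plusE[OF assms] by metis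
  define m where "m = k div 4"
  have "k mod 4 = 0 \<or> k mod 4 = 1 \<or> k mod 4 = 2 \<or> k mod 4 = 3" by presburger
  moreover have "k = 4 * m + k mod 4" by (simp add: m_def)
  ultimately consider "k = 4 * m" | "k = 4 * m + 1" | "k = 4 * m + 2" | "k = 4 * m + 3" by (elim disjE) simp_all
  then show ?thesis
  proof cases
    case 1
    then show ?thesis using z by (intro int[of "\<lambda>i. m + z i"]) auto
  next
    case 2
    then show ?thesis using z by (intro quarter[of 1 "\<lambda>i. m + z i"]) (auto simp: add_divide_distrib)
  next
    case 3
    then show ?thesis using z by (intro half[of "\<lambda>i. m + z i"]) (auto simp: add_divide_distrib)
  next
    case 4
    \<comment> \<open>Negation sends 3/4 to -3/4 = 1/4 - 1, whence the extra -1 in the integral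
      part.\<close>
    then show ?thesis using z by (intro quarter[of "-1" "\<lambda>i. - m - z i - 1"]) (auto simp: add_divide_distrib)
  qed
qed

lemma int_mult_Suc_nonneg: "(z::int) * (z + 1) \<ge> 0"
  by (cases "z \<ge> 0") (auto intro: mult_nonpos_nonpos)

lemma sum_int_mult_Suc_nonneg: "0 \<le> real_of_int (\<Sum>i\<in>I. z i * (z i + 1))"
  by (subst of_int_0_le_iff) (intro sum_nonneg int_mult_Suc_nonneg)

text \<open>Each squared coordinate is 3/16 minus half of the signed coordinate plus z(z+1), and the
  middle terms sum to 0. As z(z+1) is nonnegative on integers and vanishes only at 0 and -1, the
  formula shows both the minimum 3 and the vectors attaining it.\<close>

lemma quarter_norm:
  assumes y: "y \<in> A15_plus" and s: "s = 1 \<or> s = (-1::real)" and z: "\<forall>i<16. s * y $ i = 1/4 + of_int (z i :: int)"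
  shows "y \<bullet> y = 3 + of_int (\<Sum>i<16. z i * (z i + 1))"
proof -
  have c: "y \<in> carrier_vec 16" and y0: "(\<Sum>i<16. y $ i) = 0" using y by (auto simp: A15_plus_iff)
  have "y \<bullet> y = (\<Sum>i<16. 3/16 - (s * y $ i) / 2 + of_int (z i * (z i + 1)))"
    unfolding scalar_prod_sum_lessThan[OF c]
  proof (intro sum.cong refl)
    fix i :: nat assume "i \<in> {..<16}"
    then have "s * y $ i = 1/4 + of_int (z i)" using z by auto
    moreover have "y $ i * y $ i = (s * y $ i) * (s * y $ i)" using s by auto
    ultimately have "y $ i * y $ i = (1/4 + of_int (z i)) * (1/4 + of_int (z i))" "s * y $ i = 1/4 + of_int (z i)"
      by simp_all
    then show "y $ i * y $ i = 3/16 - (s * y $ i) / 2 + of_int (z i * (z i + 1))"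
      by (simp only:) (simp add: field_simps)
  qed
  also have "\<dots> = 3 - s * (\<Sum>i<16. y $ i) / 2 + of_int (\<Sum>i<16. z i * (z i + 1))"
    by (simp add: sum.distrib sum_subtractf sum_distrib_left sum_divide_distrib)
  finally show ?thesis using y0 by simp
qed

lemma half_norm:
  assumes y: "y \<in> A15_plus" and z: "\<forall>i<16. y $ i = 1/2 + of_int (z i :: int)"
  shows "y \<bullet> y = 4 + of_int (\<Sum>i<16. z i * (z i + 1))"
proof -
  have c: "y \<in> carrier_vec 16" using y by auto
  have "(1/2 + real_of_int w) * (1/2 + of_int w) = 1/4 + of_int (w * (w + 1))" for w
    by (simp add: field_simps)
  then have "y \<bullet> y = (\<Sum>i<16. 1/4 + of_int (z i * (z i + 1)))"
    unfolding scalar_prod_sum_lessThan[OF c] using z by (intro sum.cong) auto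
  then show ?thesis by (simp add: sum.distrib)
qed

lemma A15_plus_int_short:
  assumes y: "y \<in> A15_plus" and z: "\<forall>i<16. y $ i = of_int (z i :: int)" and l: "y \<bullet> y < 4"
  shows "y = 0\<^sub>v 16 \<or> (\<exists>p q. p < 16 \<and> q < 16 \<and> p \<noteq> q \<and> y = A_root p q)"
proof -
  have c: "y \<in> carrier_vec 16" and y0: "(\<Sum>i<16. y $ i) = 0" using y by (auto simp: A15_plus_iff)
  have "real_of_int (\<Sum>i<16. z i) = 0" using y0 z by simp
  then have s: "(\<Sum>i<16. z i) = 0" by linarith
  have "y \<bullet> y = of_int (\<Sum>i<16. (z i)\<^sup>2)"
    using z by (simp add: scalar_prod_sum_lessThan[OF c] power2_eq_square)
  then have "(\<Sum>i<16. (z i)\<^sup>2) < 4" using l by linarith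
  from short_sum_zero_vector[OF s this] show ?thesis
  proof
    assume "\<forall>i<16. z i = 0"
    then have "y = 0\<^sub>v 16" using z c by auto
    then show ?thesis ..
  next
    assume "\<exists>p q. p < 16 \<and> q < 16 \<and> p \<noteq> q \<and> (\<forall>i<16. z i = of_bool (i = p) - of_bool (i = q))"
    then obtain p q where pq: "p < 16" "q < 16" "p \<noteq> q" "\<forall>i<16. z i = of_bool (i = p) - of_bool (i = q)" by blast
    then have "y = A_root p q" using z c by (intro eq_vecI) (auto simp: A_root_def)
    then show ?thesis using pq by blast
  qed
qed

text \<open>The bound is sharp for this conclusion: the quarter classes start at norm 3 and the half
  class at norm 4, so below 3 only integral vectors remain.\<close>

lemma A15_plus_norm_less_3:
  assumes y: "y \<in> A15_plus" and l: "y \<bullet> y < 3"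
  shows "y = 0\<^sub>v 16 \<or> (\<exists>p q. p < 16 \<and> q < 16 \<and> p \<noteq> q \<and> y = A_root p q)"
  using y
proof (cases rule: A15_plus_cases)
  case (int z)
  then show ?thesis using A15_plus_int_short[OF y] l by auto
next
  case (quarter s z)
  then show ?thesis using quarter_norm[OF y quarter] l sum_int_mult_Suc_nonneg[of z "{..<16}"] by linarith
next
  case (half z)
  then show ?thesis using half_norm[OF y half] l sum_int_mult_Suc_nonneg[of z "{..<16}"] by linarith
qed

lemma A15_plus_norm_less_2:
  assumes "y \<in> A15_plus" "y \<bullet> y < 2"
  shows "y = 0\<^sub>v 16"
proof (rule ccontr)
  assume "y \<noteq> 0\<^sub>v 16"
  then obtain p q where "p < 16" "q < 16" "p \<noteq> q" "y = A_root p q" using A15_plus_norm_less_3[of y] assms by auto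
  then have "y \<bullet> y = 2" using A_root_norm by simp
  then show False using assms by simp
qed

lemma A15_plus_norm_3:
  assumes y: "y \<in> A15_plus" and l: "y \<bullet> y = 3"
  obtains s S where "s = 1 \<or> s = (-1::real)" "S \<subseteq> {..<16}" "card S = 4" "y = s \<cdot>\<^sub>v fourset_vec S"
  using y
proof (cases rule: A15_plus_cases)
  case (int z)
  then have "y = 0\<^sub>v 16 \<or> (\<exists>p q. p < 16 \<and> q < 16 \<and> p \<noteq> q \<and> y = A_root p q)"
    using A15_plus_int_short[OF y] l by auto
  then have "y \<bullet> y = 0 \<or> y \<bullet> y = 2" using A_root_norm by auto
  then show ?thesis using l by simp
next
  case (half z)
  then have False using half_norm[OF y half] l sum_int_mult_Suc_nonneg[of z "{..<16}"] by linarith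
  then show ?thesis ..
next
  case (quarter s z)
  have c: "y \<in> carrier_vec 16" and y0: "(\<Sum>i<16. y $ i) = 0" using y by (auto simp: A15_plus_iff)
  have "real_of_int (\<Sum>i<16. z i * (z i + 1)) = 0" using quarter_norm[OF y quarter] l by linarith
  then have "(\<Sum>i<16. z i * (z i + 1)) = 0" by (simp only: of_int_eq_0_iff)
  then have "\<forall>i\<in>{..<16}. z i * (z i + 1) = 0"
    by (subst (asm) sum_nonneg_eq_0_iff) (use int_mult_Suc_nonneg in auto)
  then have z: "z i = 0 \<or> z i = -1" if "i < 16" for i using that by auto
  define S where "S = {i\<in>{..<16}. z i = -1}"
  have zS: "real_of_int (z i) = - of_bool (i \<in> S)" if "i < 16" for i
    using z[OF that] that by (auto simp: S_def)
  have yS: "y = s \<cdot>\<^sub>v fourset_vec S"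
  proof (rule eq_vecI)
    fix i assume "i < dim_vec (s \<cdot>\<^sub>v fourset_vec S)"
    then have i: "i < 16" by (simp add: fourset_vec_def)
    have "s * y $ i = 1/4 - of_bool (i \<in> S)" using quarter(2) i zS by auto
    moreover have "y $ i = s * (s * y $ i)" using quarter(1) by auto
    ultimately show "y $ i = (s \<cdot>\<^sub>v fourset_vec S) $ i" using i by (simp add: fourset_vec_def)
  qed (use c in \<open>simp add: fourset_vec_def\<close>)
  \<comment> \<open>The coordinate sum 0 determines the size of \<open>S\<close>: sixteen quarters
    cancel against four units.\<close>
  have "0 = (\<Sum>i<16. s * y $ i)" using y0 by (simp add: sum_distrib_left[symmetric])
  also have "\<dots> = (\<Sum>i<16. 1/4 - of_bool (i \<in> S))"
    using quarter(2) zS by (intro sum.cong) auto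
  also have "\<dots> = 4 - real (card ({..<16} \<inter> S))"
    by (simp add: sum_subtractf)
  finally have "card ({..<16} \<inter> S) = 4" by simp
  moreover have "{..<16} \<inter> S = S" by (auto simp: S_def)
  ultimately show ?thesis using that[OF quarter(1) _ _ yS] by (auto simp: S_def)
qed

lemma sum_of_bool_mem:
  fixes n :: nat
  assumes "S \<subseteq> {..<n}"
  shows "(\<Sum>i<n. of_bool (i \<in> S)) = real (card S)"
proof -
  have "(\<Sum>i<n. of_bool (i \<in> S)) = real (card ({..<n} \<inter> {i. i \<in> S}))"
    by (rule sum_of_bool_eq) simp_all
  also have "{..<n} \<inter> {i. i \<in> S} = S" using assms by blast
  finally show ?thesis .
qed

lemma fourset_vec_scalar_prod:
  assumes "S \<subseteq> {..<16}" "T \<subseteq> {..<16}" "card S = 4" "card T = 4"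
  shows "fourset_vec S \<bullet> fourset_vec T = real (card (S \<inter> T)) - 1"
proof -
  have "fourset_vec S \<bullet> fourset_vec T = (\<Sum>i<16. 1/16 - of_bool (i \<in> S) / 4 - of_bool (i \<in> T) / 4 + of_bool (i \<in> S \<inter> T))"
  proof (subst scalar_prod_sum_lessThan[of _ 16])
    show "(\<Sum>i<16. fourset_vec S $ i * fourset_vec T $ i)
      = (\<Sum>i<16. 1/16 - of_bool (i \<in> S) / 4 - of_bool (i \<in> T) / 4 + of_bool (i \<in> S \<inter> T))"
      by (intro sum.cong refl) (auto simp: fourset_vec_def of_bool_def)
  qed (simp add: fourset_vec_def)
  also have "\<dots> = 1 - (\<Sum>i<16. of_bool (i \<in> S)) / 4 - (\<Sum>i<16. of_bool (i \<in> T)) / 4 + (\<Sum>i<16. of_bool (i \<in> S \<inter> T))"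
    unfolding sum.distrib sum_subtractf sum_divide_distrib[symmetric] by simp
  also have "\<dots> = 1 - real (card S) / 4 - real (card T) / 4 + real (card (S \<inter> T))"
    using assms(1,2) sum_of_bool_mem[of S 16] sum_of_bool_mem[of T 16] sum_of_bool_mem[of "S \<inter> T" 16]
    by (simp only: le_infI1)
  finally show ?thesis using assms by simp
qed

section \<open>Orthogonal complements of triples\<close>

lemma scalar_prod_self_nonneg: "(x :: real vec) \<bullet> x \<ge> 0"
  by (auto simp: scalar_prod_def intro: sum_nonneg)

lemma scalar_prod_self_eq_0:
  assumes "(x :: real vec) \<in> carrier_vec n" "x \<bullet> x = 0"
  shows "x = 0\<^sub>v n"
proof -
  have "\<forall>i\<in>{..<n}. x $ i * x $ i = 0"
    using assms(2) unfolding scalar_prod_sum_lessThan[OF assms(1)]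
    by (subst (asm) sum_nonneg_eq_0_iff) auto
  then show ?thesis using assms(1) by (intro eq_vecI) auto
qed

lemma scalar_prod_comb4:
  fixes x a b c z :: "real vec"
  assumes "x \<in> carrier_vec n" "a \<in> carrier_vec n" "b \<in> carrier_vec n" "c \<in> carrier_vec n" "z \<in> carrier_vec n"
  shows "(x + k \<cdot>\<^sub>v a + l \<cdot>\<^sub>v b + m \<cdot>\<^sub>v c) \<bullet> z = x \<bullet> z + k * (a \<bullet> z) + l * (b \<bullet> z) + m * (c \<bullet> z)"
  using assms by (simp add: add_scalar_prod_distrib[of _ n])

section \<open>The complement of a triple, described by checkable integer data\<close>

definition al :: "int list" where "al = [-3,-3,-3,-3,1,1,1,1,1,1,1,1,1,1,1,1]"
definition bl :: "int list" where "bl = [-3,-3,-3,1,-3,1,1,1,1,1,1,1,1,1,1,1]"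

definition orth_abc :: "int list \<Rightarrow> real vec set" where
  "orth_abc cl = {u \<in> A15_plus. u \<bullet> qvec al = 0 \<and> u \<bullet> qvec bl = 0 \<and> u \<bullet> qvec cl = 0}"

text \<open>The form is 15 times the norm of the component along a, b, c of a vector with inner
  products \<alpha>, \<beta>, \<gamma>; the substitution is the effect of adding k a + l b + m c.
  The pairs (3,2) and (2,3) generate the pairs with sum divisible by 5, so only \<alpha> + \<beta>
  modulo 5 and \<gamma> modulo 3 matter. The two parts of the form can be made at most 9 and
  5.\<close>

lemma reduce_mod_abc:
  fixes \<alpha> \<beta> \<gamma> :: int
  obtains k l m :: int where
    "9 * (\<alpha> + 3 * k + 2 * l)\<^sup>2 - 12 * (\<alpha> + 3 * k + 2 * l) * (\<beta> + 2 * k + 3 * l)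
       + 9 * (\<beta> + 2 * k + 3 * l)\<^sup>2 + 5 * (\<gamma> + 3 * m)\<^sup>2 \<le> 14"
proof -
  have 1: "\<exists>m. 5 * (\<gamma> + 3 * m)\<^sup>2 \<le> 5"
  proof -
    define t where "t = \<gamma> div 3"
    have "\<gamma> = 3 * t + \<gamma> mod 3" by (simp add: t_def)
    moreover have "\<gamma> mod 3 = 0 \<or> \<gamma> mod 3 = 1 \<or> \<gamma> mod 3 = 2" by presburger
    ultimately consider "\<gamma> + 3 * (- t) = 0" | "\<gamma> + 3 * (- t) = 1" | "\<gamma> + 3 * (- t - 1) = - 1" by (elim disjE) simp_all
    then show ?thesis
    proof cases
      case 1 then show ?thesis by (intro exI[of _ "- t"]) (simp only:, simp)
    next
      case 2 then show ?thesis by (intro exI[of _ "- t"]) (simp only:, simp)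
    next
      case 3 then show ?thesis by (intro exI[of _ "- t - 1"]) (simp only:, simp)
    qed
  qed
  \<comment> \<open>Cramer's rule for the matrix with rows (3,2) and (2,3); its determinant 5
    cancels against the term 5t.\<close>
  have solve: "\<exists>k l. \<alpha> + 3 * k + 2 * l = x \<and> \<beta> + 2 * k + 3 * l = y"
    if "\<alpha> + \<beta> = x + y + 5 * t" for x y t
    by (rule exI[of _ "- 3 * t - (y - \<beta>)"], rule exI[of _ "2 * t + (y - \<beta>)"]) (use that in auto)
  have 2: "\<exists>k l. 9 * (\<alpha> + 3 * k + 2 * l)\<^sup>2 - 12 * (\<alpha> + 3 * k + 2 * l) * (\<beta> + 2 * k + 3 * l)
       + 9 * (\<beta> + 2 * k + 3 * l)\<^sup>2 \<le> 9"
  proof -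
    have R: ?thesis if "\<alpha> + \<beta> = x + y + 5 * t" "9 * x\<^sup>2 - 12 * x * y + 9 * y\<^sup>2 \<le> 9" for x y t
    proof -
      from solve[OF that(1)] obtain k l where "\<alpha> + 3 * k + 2 * l = x" "\<beta> + 2 * k + 3 * l = y" by blast
      then show ?thesis using that(2) by (intro exI[of _ k] exI[of _ l]) simp
    qed
    define t where "t = (\<alpha> + \<beta>) div 5"
    have "\<alpha> + \<beta> = 5 * t + (\<alpha> + \<beta>) mod 5" by (simp add: t_def)
    moreover have "(\<alpha> + \<beta>) mod 5 = 0 \<or> (\<alpha> + \<beta>) mod 5 = 1 \<or> (\<alpha> + \<beta>) mod 5 = 2 \<or> (\<alpha> + \<beta>) mod 5 = 3 \<or> (\<alpha> + \<beta>) mod 5 = 4"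
      by presburger
    \<comment> \<open>The representatives (0,0), (1,0), (1,1), (-1,-1), (-1,0) have values 0, 9, 6,
      6, 9.\<close>
    ultimately consider "\<alpha> + \<beta> = 0 + 0 + 5 * t" | "\<alpha> + \<beta> = 1 + 0 + 5 * t" | "\<alpha> + \<beta> = 1 + 1 + 5 * t"
      | "\<alpha> + \<beta> = - 1 + - 1 + 5 * (t + 1)" | "\<alpha> + \<beta> = - 1 + 0 + 5 * (t + 1)" by (elim disjE) simp_all
    then show ?thesis by cases (rule R, assumption, simp)+
  qed
  from 1 2 that show ?thesis by (smt (verit))
qed

definition columns :: "int list list \<Rightarrow> int list list" where
  "columns xs = map (\<lambda>j. map (\<lambda>x. x ! j) xs) [0..<16]"

text \<open>The entry 16 stands for 1, as both factors of each inner product are scaled by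
  4.\<close>

definition scalar_table :: "nat \<Rightarrow> int list list" where
  "scalar_table n = map (\<lambda>i. map (\<lambda>j. if i = j then 16 else 0) [0..<n]) [0..<n]"

text \<open>For \<open>p \<noteq> q\<close> this is the sum of \<open>(f (4 (e\<^sub>i - e\<^sub>j)))\<^sup>2\<close> over all ordered pairs \<open>(i, j)\<close>
  from \<open>X\<close>, where \<open>f\<close> is the functional \<open>v \<mapsto> v\<^sub>p - v\<^sub>q\<close>.\<close>

definition pair_weight :: "nat list \<Rightarrow> nat \<Rightarrow> nat \<Rightarrow> int" where
  "pair_weight X p q = 32 * (if p \<in> set X then if q \<in> set X then 2 * int (length X) else int (length X) - 1
     else if q \<in> set X then int (length X) - 1 else 0)"

text \<open>Integer lists represent vectors multiplied by 4. The rows of \<open>ns\<close> form a basis of the complement and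
  those of \<open>nd\<close> lift the dual basis to \<open>A15_plus\<close>; \<open>W\<close> expresses the complementary projection through
  \<open>a, b, c\<close> and the all-ones vector. The weights in \<open>cert\<close> and \<open>blocks\<close> are a linear programming
  certificate: the weighted sum of squares is nonnegative on every root outside the block \<open>{lo..<16}\<close>,
  although its value on the Gram form is negative.\<close>

locale A15_complement =
  fixes cl :: "int list" and ns nd :: "int list list" and W :: "(int \<times> int \<times> int) list"
    and lo :: nat and cert :: "(int \<times> int list) list" and blocks :: "(int \<times> nat list) list"
  assumes cl: "A15_list cl" "idot cl cl = 48" "idot al cl = 0" "idot bl cl = 0"
    and len: "length ns = 12" "length nd = 12" "length W = 16"
    and ns_ok: "list_all (\<lambda>x. A15_list x \<and> idot x al = 0 \<and> idot x bl = 0 \<and> idot x cl = 0 \<and>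
      (idot x x = 32 \<or> idot x x = 48)) ns"
    and nd_ok: "list_all A15_list nd"
    and dual_ok: "map (\<lambda>x. map (idot x) ns) nd = scalar_table 12"
    and compl_ok: "map2 (\<lambda>r (w, w', w''). map2 (\<lambda>s (x, y, z). idot r s + 1 + w * x + w' * y + w'' * z)
      (columns nd) (zip al (zip bl cl))) (columns ns) W = scalar_table 16"
    and conn_ok: "list_all (\<lambda>i. list_ex (\<lambda>j. idot (ns ! i) (ns ! j) \<noteq> 0) [0..<i]) [1..<12]"
    and lo: "lo \<le> 8" "list_all (\<lambda>j. al ! j = 1 \<and> bl ! j = 1 \<and> cl ! j = 1) [lo..<16]"
    and certA: "list_all (\<lambda>(w, u). A15_list u \<and> idot u al = 0 \<and> idot u bl = 0 \<and> idot u cl = 0) cert"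
    and blocksA: "list_all (\<lambda>(w, X). distinct X \<and>
      list_all (\<lambda>p. p < 16 \<and> al ! p = al ! hd X \<and> bl ! p = bl ! hd X \<and> cl ! p = cl ! hd X) X) blocks"
    and cert_nonneg: "list_all (\<lambda>p. list_all (\<lambda>q. p \<noteq> q \<and> (p < lo \<or> q < lo) \<longrightarrow>
      0 \<le> (\<Sum>(w, u)\<leftarrow>cert. w * (u ! p - u ! q)\<^sup>2) + (\<Sum>(w, X)\<leftarrow>blocks. w * pair_weight X p q)) [0..<16]) [0..<16]"
    and cert_neg: "(\<Sum>(w, u)\<leftarrow>cert. w * idot u u) + (\<Sum>(w, X)\<leftarrow>blocks. w * (32 * int (length X) * (int (length X) - 1))) < 0"
begin

abbreviation "a \<equiv> qvec al"
abbreviation "b \<equiv> qvec bl"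
abbreviation "c \<equiv> qvec cl"
abbreviation "N \<equiv> orth_abc cl"
abbreviation "nv \<equiv> map qvec ns"

lemma nsA: "i < 12 \<Longrightarrow> A15_list (ns ! i)"
  and ndA: "i < 12 \<Longrightarrow> A15_list (nd ! i)"
  and nsO: "i < 12 \<Longrightarrow> idot (ns ! i) al = 0 \<and> idot (ns ! i) bl = 0 \<and> idot (ns ! i) cl = 0"
  and norms: "i < 12 \<Longrightarrow> idot (ns ! i) (ns ! i) = 32 \<or> idot (ns ! i) (ns ! i) = 48"
  using ns_ok nd_ok len by (simp_all add: list_all_length)

lemma dual:
  assumes "i < 12" "j < 12"
  shows "idot (nd ! i) (ns ! j) = (if i = j then 16 else 0)"
  using arg_cong[OF dual_ok, of "\<lambda>m. m ! i ! j"] assms len by (simp add: scalar_table_def)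

text \<open>The coefficient 1 of the all-ones vector is forced: summing over \<open>k\<close>
  annihilates every other term on the left, because those rows have sum 0, while the right side sums
  to 16.\<close>

lemma compl:
  assumes "j < 16" "k < 16"
  shows "idot (map (\<lambda>x. x ! j) ns) (map (\<lambda>x. x ! k) nd)
      + 1 + fst (W ! j) * al ! k + fst (snd (W ! j)) * bl ! k + snd (snd (W ! j)) * cl ! k = (if j = k then 16 else 0)"
proof -
  have "length al = 16" "length bl = 16" "length cl = 16" using cl(1) by (auto simp: al_def bl_def A15_list_def)
  then show ?thesis
    using arg_cong[OF compl_ok, of "\<lambda>m. m ! j ! k"] assms len
    by (simp add: scalar_table_def columns_def case_prod_unfold)
qed

lemma conn:
  assumes "i < 12" "0 < i"
  obtains j where "j < i" "idot (ns ! i) (ns ! j) \<noteq> 0"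
proof -
  have "i \<in> set [1..<12]" using assms by simp
  then have "list_ex (\<lambda>j. idot (ns ! i) (ns ! j) \<noteq> 0) [0..<i]" using conn_ok by (simp only: list_all_iff)
  then show ?thesis using that by (auto simp: list_ex_iff)
qed

lemma abc_mem: "a \<in> A15_plus" "b \<in> A15_plus" "c \<in> A15_plus"
proof -
  have "A15_list al" "A15_list bl" by (code_simp, code_simp)
  then show "a \<in> A15_plus" "b \<in> A15_plus" "c \<in> A15_plus" using cl(1) by (auto intro: qvec_in_A15_plus)
qed

lemma lengths: "length al = 16" "length bl = 16" "length cl = 16"
  "i < 12 \<Longrightarrow> length (ns ! i) = 16" "i < 12 \<Longrightarrow> length (nd ! i) = 16"
  using cl nsA ndA by (auto simp: al_def bl_def A15_list_def)

lemma abc_gram: "a \<bullet> a = 3" "a \<bullet> b = 2" "b \<bullet> b = 3" "a \<bullet> c = 0" "b \<bullet> c = 0" "c \<bullet> c = 3"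
    "b \<bullet> a = 2" "c \<bullet> a = 0" "c \<bullet> b = 0"
proof -
  have "idot al al = 48" "idot al bl = 32" "idot bl bl = 48" by (code_simp, code_simp, code_simp)
  then show g: "a \<bullet> a = 3" "a \<bullet> b = 2" "b \<bullet> b = 3" "a \<bullet> c = 0" "b \<bullet> c = 0" "c \<bullet> c = 3"
    using cl by (simp_all add: qvec_scalar_prod lengths)
  show "b \<bullet> a = 2" "c \<bullet> a = 0" "c \<bullet> b = 0"
    using g(2,4,5) abc_mem comm_scalar_prod[of a 16 b] comm_scalar_prod[of a 16 c] comm_scalar_prod[of b 16 c] by auto
qed

lemma N_mem: "u \<in> N \<Longrightarrow> u \<in> A15_plus" "u \<in> N \<Longrightarrow> u \<in> carrier_vec 16"
  by (auto simp: orth_abc_def)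

lemma qvec_in_N:
  assumes "A15_list u" "idot u al = 0" "idot u bl = 0" "idot u cl = 0"
  shows "qvec u \<in> N"
proof -
  have "length u = 16" using assms by (simp add: A15_list_def)
  then show ?thesis using assms qvec_in_A15_plus[OF assms(1)]
    by (simp add: orth_abc_def qvec_scalar_prod lengths)
qed

lemma nv_N: "i < 12 \<Longrightarrow> qvec (ns ! i) \<in> N"
  using nsA nsO by (intro qvec_in_N) auto

lemma nv_carrier: "set nv \<subseteq> carrier_vec 16"
  using nv_N N_mem len by (auto simp: in_set_conv_nth)

lemma N_zero: "0\<^sub>v 16 \<in> N"
  using abc_mem by (auto simp: orth_abc_def A15_plus_zero)

lemma N_add: "u \<in> N \<Longrightarrow> v \<in> N \<Longrightarrow> u + v \<in> N"
  using abc_mem by (auto simp: orth_abc_def A15_plus_add add_scalar_prod_distrib[of _ 16])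

lemma N_uminus: "u \<in> N \<Longrightarrow> - u \<in> N"
  using abc_mem by (auto simp: orth_abc_def A15_plus_uminus)

text \<open>By \<open>compl\<close>, the matrix of the map on the right differs from the identity by
  rows that are combinations of the all-ones vector, a, b and c, and all four are orthogonal to
  \<open>x\<close>.\<close>

lemma N_expand:
  assumes x: "x \<in> N"
  shows "x = lcomb 16 nv (\<lambda>i. qvec (nd ! i) \<bullet> x)"
proof (rule eq_vecI)
  have xc: "x \<in> carrier_vec 16" and x0: "(\<Sum>i<16. x $ i) = 0" using x by (auto simp: orth_abc_def A15_plus_iff)
  then show "dim_vec x = dim_vec (lcomb 16 nv (\<lambda>i. qvec (nd ! i) \<bullet> x))" by (simp add: lcomb_def)
  have q: "qvec xs \<bullet> x = (\<Sum>k<16. of_int (xs ! k) * x $ k) / 4" if "length xs = 16" for xs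
    unfolding scalar_prod_sum_lessThan[OF xc] using that by (simp add: qvec_def sum_divide_distrib)
  have z: "(\<Sum>k<16. real_of_int (al ! k) * x $ k) = 0" "(\<Sum>k<16. real_of_int (bl ! k) * x $ k) = 0"
      "(\<Sum>k<16. real_of_int (cl ! k) * x $ k) = 0"
    using x q[of al] q[of bl] q[of cl] lengths comm_scalar_prod[OF xc, of a] comm_scalar_prod[OF xc, of b]
      comm_scalar_prod[OF xc, of c] abc_mem by (auto simp: orth_abc_def)
  fix j assume "j < dim_vec (lcomb 16 nv (\<lambda>i. qvec (nd ! i) \<bullet> x))"
  then have j: "j < 16" by (simp add: lcomb_def)
  have "lcomb 16 nv (\<lambda>i. qvec (nd ! i) \<bullet> x) $ j = (\<Sum>i<12. (qvec (nd ! i) \<bullet> x) * qvec (ns ! i) $ j)"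
    using j len by (simp add: lcomb_def)
  also have "\<dots> = (\<Sum>i<12. \<Sum>k<16. of_int (ns ! i ! j * nd ! i ! k) * x $ k / 16)"
  proof (rule sum.cong[OF refl])
    fix i :: nat assume "i \<in> {..<12}"
    then have i: "i < 12" by simp
    have "(qvec (nd ! i) \<bullet> x) * qvec (ns ! i) $ j = (\<Sum>k<16. of_int (nd ! i ! k) * x $ k) * (of_int (ns ! i ! j) / 16)"
      using i j q[of "nd ! i"] lengths by (simp add: qvec_def)
    also have "\<dots> = (\<Sum>k<16. of_int (ns ! i ! j * nd ! i ! k) * x $ k / 16)"
      unfolding sum_distrib_right by (rule sum.cong) simp_all
    finally show "(qvec (nd ! i) \<bullet> x) * qvec (ns ! i) $ j = (\<Sum>k<16. of_int (ns ! i ! j * nd ! i ! k) * x $ k / 16)" .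
  qed
  also have "\<dots> = (\<Sum>k<16. of_int (\<Sum>i<12. ns ! i ! j * nd ! i ! k) * x $ k / 16)"
    by (subst sum.swap) (simp add: sum_distrib_right sum_divide_distrib)
  also have "\<dots> = (\<Sum>k<16. (if k = j then x $ k else 0) - 1 / 16 * x $ k
      - of_int (fst (W ! j)) / 16 * (of_int (al ! k) * x $ k) - of_int (fst (snd (W ! j))) / 16 * (of_int (bl ! k) * x $ k)
      - of_int (snd (snd (W ! j))) / 16 * (of_int (cl ! k) * x $ k))"
  proof (rule sum.cong[OF refl])
    fix k :: nat assume "k \<in> {..<16}"
    then have "idot (map (\<lambda>x. x ! j) ns) (map (\<lambda>x. x ! k) nd) = (if j = k then 16 else 0)
      - 1 - fst (W ! j) * al ! k - fst (snd (W ! j)) * bl ! k - snd (snd (W ! j)) * cl ! k"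
      using compl[OF j, of k] by (auto simp: algebra_simps)
    moreover have "idot (map (\<lambda>x. x ! j) ns) (map (\<lambda>x. x ! k) nd) = (\<Sum>i<12. ns ! i ! j * nd ! i ! k)"
      unfolding idot_def sum_list_sum_nth using len by (simp add: atLeast0LessThan)
    ultimately have "(\<Sum>i<12. ns ! i ! j * nd ! i ! k) = (if j = k then 16 else 0)
      - 1 - fst (W ! j) * al ! k - fst (snd (W ! j)) * bl ! k - snd (snd (W ! j)) * cl ! k" by simp
    then show "of_int (\<Sum>i<12. ns ! i ! j * nd ! i ! k) * x $ k / 16 = (if k = j then x $ k else 0) - 1 / 16 * x $ k
      - of_int (fst (W ! j)) / 16 * (of_int (al ! k) * x $ k) - of_int (fst (snd (W ! j))) / 16 * (of_int (bl ! k) * x $ k)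
      - of_int (snd (snd (W ! j))) / 16 * (of_int (cl ! k) * x $ k)"
      by (simp only:) (simp add: field_simps)
  qed
  also have "\<dots> = x $ j"
    unfolding sum_subtractf sum_distrib_left[symmetric] x0 z using j by simp
  finally show "x $ j = lcomb 16 nv (\<lambda>i. qvec (nd ! i) \<bullet> x) $ j" by simp
qed

text \<open>The coefficients in \<open>N_expand\<close> are inner products of vectors of
  \<open>A15_plus\<close>, hence integers; so the twelve vectors generate all of \<open>N\<close>,
  not just a sublattice of finite index.\<close>

lemma N_zspan: "N = zspan 16 (set nv)"
proof
  show "zspan 16 (set nv) \<subseteq> N"
    using nv_carrier nv_N N_zero N_add N_uminus len by (intro zspan_subset) (auto simp: in_set_conv_nth)
  show "N \<subseteq> zspan 16 (set nv)"
  proof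
    fix x assume x: "x \<in> N"
    define f where "f i = \<lfloor>qvec (nd ! i) \<bullet> x\<rfloor>" for i
    have "lcomb 16 nv (\<lambda>i. qvec (nd ! i) \<bullet> x) = lcomb 16 nv (\<lambda>i. of_int (f i))"
    proof -
      have "qvec (nd ! i) \<bullet> x = of_int (f i)" if "i < 12" for i
        using A15_plus_integral[OF qvec_in_A15_plus N_mem(1)[OF x]] ndA that by (auto simp: f_def)
      then show ?thesis using len by (simp add: lcomb_def)
    qed
    then have "x = lcomb 16 nv (\<lambda>i. of_int (f i))" using N_expand[OF x] by simp
    then show "x \<in> zspan 16 (set nv)" unfolding zspan_lcomb[OF nv_carrier] by blast
  qed
qed

lemma N_basis: "lattice_basis 16 N nv"
  unfolding N_zspan
proof (rule lattice_basisI[OF nv_carrier], intro allI impI)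
  fix f i assume f: "lcomb 16 nv f = 0\<^sub>v 16" and "i < length nv"
  then have i: "i < 12" using len by simp
  have qc: "qvec (nd ! i) \<in> carrier_vec 16" using ndA i qvec_in_A15_plus by auto
  have "0 = qvec (nd ! i) \<bullet> lcomb 16 nv f" using f qc by simp
  also have "\<dots> = (\<Sum>j<12. f j * (qvec (nd ! i) \<bullet> qvec (ns ! j)))"
    using scalar_prod_lcomb[OF nv_carrier qc] len by simp
  also have "\<dots> = (\<Sum>j<12. if j = i then f j else 0)"
    using i dual lengths by (intro sum.cong) (auto simp: qvec_scalar_prod)
  also have "\<dots> = f i" using i by simp
  finally show "f i = 0" by simp
qed

lemma N_int_lattice: "int_lattice 16 N"
  unfolding int_lattice_def using N_basis A15_plus_integral N_mem(1) by blast

lemma N_rank: "lattice_rank 16 N = 12"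
  using lattice_rank_eq[OF N_basis] len by simp

lemma N_det: "lattice_det 16 N = of_int (det (mat 12 12 (\<lambda>(i, j). idot (ns ! i) (ns ! j) div 16)))"
proof -
  let ?G = "mat 12 12 (\<lambda>(i, j). idot (ns ! i) (ns ! j) div 16)"
  have "gram_matrix nv = map_mat real_of_int ?G"
  proof (rule eq_matI)
    fix i j assume "i < dim_row (map_mat real_of_int ?G)" "j < dim_col (map_mat real_of_int ?G)"
    then have ij: "i < 12" "j < 12" by auto
    then have e: "qvec (ns ! i) \<bullet> qvec (ns ! j) = of_int (idot (ns ! i) (ns ! j)) / 16"
      using lengths by (simp add: qvec_scalar_prod)
    \<comment> \<open>Integrality of \<open>N\<close> makes the division by 16 exact, so the
      determinant may be computed over \<open>int\<close>.\<close>
    then have "of_int (idot (ns ! i) (ns ! j)) / (16::real) \<in> \<int>"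
      using A15_plus_integral N_mem(1) nv_N ij by metis
    then obtain z where "real_of_int (idot (ns ! i) (ns ! j)) = of_int (16 * z)"
      by (auto elim!: Ints_cases simp: field_simps)
    then have "idot (ns ! i) (ns ! j) = 16 * z" by (simp only: of_int_eq_iff)
    then show "gram_matrix nv $$ (i, j) = map_mat real_of_int ?G $$ (i, j)"
      using ij e len by (simp add: gram_matrix_def)
  qed (auto simp: gram_matrix_def len)
  then show ?thesis using lattice_det_eq[OF N_basis] by simp
qed

section \<open>Lifting functionals on the complement to short vectors\<close>

lemma additive_on_N:
  assumes add: "\<And>u v. u \<in> N \<Longrightarrow> v \<in> N \<Longrightarrow> g (u + v) = g u + (g v :: real)"
    and eq: "\<And>i. i < 12 \<Longrightarrow> g (qvec (ns ! i)) = y \<bullet> qvec (ns ! i)"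
    and y: "y \<in> carrier_vec 16" and u: "u \<in> N"
  shows "g u = y \<bullet> u"
proof -
  have g0: "g (0\<^sub>v 16) = 0" using add[OF N_zero N_zero] by simp
  have "zspan 16 (set nv) \<subseteq> {u \<in> N. g u = y \<bullet> u}"
  proof (rule zspan_subset[OF nv_carrier])
    show "set nv \<subseteq> {u \<in> N. g u = y \<bullet> u}" using nv_N eq len by (auto simp: in_set_conv_nth)
    show "0\<^sub>v 16 \<in> {u \<in> N. g u = y \<bullet> u}" using N_zero g0 y by simp
  next
    fix u v assume "u \<in> {u \<in> N. g u = y \<bullet> u}" "v \<in> {u \<in> N. g u = y \<bullet> u}"
    then show "u + v \<in> {u \<in> N. g u = y \<bullet> u}"
      using add N_add N_mem y by (auto simp: scalar_prod_add_distrib[of _ 16])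
  next
    fix u assume u: "u \<in> {u \<in> N. g u = y \<bullet> u}"
    then have c: "u \<in> carrier_vec 16" using N_mem by auto
    have "g (u + - u) = g u + g (- u)" using u N_uminus by (intro add) auto
    moreover have "u + - u = 0\<^sub>v 16" using c by auto
    ultimately have "g (- u) = - g u" using g0 by simp
    then show "- u \<in> {u \<in> N. g u = y \<bullet> u}" using u N_uminus c y by auto
  qed
  then show ?thesis using u N_zspan by auto
qed

text \<open>\<open>A15_plus\<close> is unimodular, so a functional on \<open>N\<close> is given by some \<open>y \<in> A15_plus\<close>; modulo
  \<open>a, b, c\<close> the component of \<open>y\<close> orthogonal to \<open>N\<close> can be given norm at most 14/15.\<close>

lemma functional_representation:
  assumes add: "\<And>u v. u \<in> N \<Longrightarrow> v \<in> N \<Longrightarrow> g (u + v) = g u + g v"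
    and int: "\<And>u. u \<in> N \<Longrightarrow> g u \<in> \<int>"
    and bound: "\<And>u. u \<in> N \<Longrightarrow> (g u)\<^sup>2 \<le> real t * (u \<bullet> u)"
  obtains y where "y \<in> A15_plus" "y \<bullet> y < real t + 1" "\<And>u. u \<in> N \<Longrightarrow> g u = y \<bullet> u"
proof -
  have carr: "a \<in> carrier_vec 16" "b \<in> carrier_vec 16" "c \<in> carrier_vec 16" using abc_mem by auto
  have ndc: "set (map qvec nd) \<subseteq> carrier_vec 16" "set (map qvec nd) \<subseteq> A15_plus"
    using ndA len qvec_in_A15_plus by (auto simp: in_set_conv_nth)
  define f where "f i = \<lfloor>g (qvec (ns ! i))\<rfloor>" for i
  have f: "of_int (f i) = g (qvec (ns ! i))" if "i < 12" for i
    using int[OF nv_N[OF that]] by (simp add: f_def)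
  \<comment> \<open>The rows of \<open>nd\<close> are dual to the basis, so this combination takes
    the prescribed values on it.\<close>
  define y0 where "y0 = lcomb 16 (map qvec nd) (\<lambda>i. of_int (f i))"
  have "y0 \<in> zspan 16 (set (map qvec nd))" unfolding zspan_lcomb[OF ndc(1)] y0_def by blast
  moreover have "zspan 16 (set (map qvec nd)) \<subseteq> A15_plus"
    by (rule zspan_subset[OF ndc A15_plus_zero A15_plus_add A15_plus_uminus])
  ultimately have y0: "y0 \<in> A15_plus" by auto
  have "g (qvec (ns ! i)) = y0 \<bullet> qvec (ns ! i)" if i: "i < 12" for i
  proof -
    have "y0 \<bullet> qvec (ns ! i) = (\<Sum>j<12. of_int (f j) * (qvec (nd ! j) \<bullet> qvec (ns ! i)))"
      unfolding y0_def using lcomb_scalar_prod[OF ndc(1), of "qvec (ns ! i)"] nv_N[OF i] N_mem len by simp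
    also have "\<dots> = (\<Sum>j<12. if j = i then of_int (f j) else 0)"
      using i dual lengths by (intro sum.cong) (auto simp: qvec_scalar_prod)
    also have "\<dots> = of_int (f i)" using i by simp
    finally show ?thesis using f[OF i] by simp
  qed
  then have g0: "g u = y0 \<bullet> u" if "u \<in> N" for u
    using additive_on_N[of g y0 u] add y0 that by auto
  have "y0 \<bullet> a \<in> \<int>" "y0 \<bullet> b \<in> \<int>" "y0 \<bullet> c \<in> \<int>" using A15_plus_integral y0 abc_mem by auto
  then obtain \<alpha> \<beta> \<gamma> where abg: "y0 \<bullet> a = of_int \<alpha>" "y0 \<bullet> b = of_int \<beta>" "y0 \<bullet> c = of_int \<gamma>"
    by (auto elim!: Ints_cases)
  obtain k l m where "9 * (\<alpha> + 3 * k + 2 * l)\<^sup>2 - 12 * (\<alpha> + 3 * k + 2 * l) * (\<beta> + 2 * k + 3 * l)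
       + 9 * (\<beta> + 2 * k + 3 * l)\<^sup>2 + 5 * (\<gamma> + 3 * m)\<^sup>2 \<le> 14"
    using reduce_mod_abc[of \<alpha> \<beta> \<gamma>] by blast
  then have red: "real_of_int (9 * (\<alpha> + 3 * k + 2 * l)\<^sup>2 - 12 * (\<alpha> + 3 * k + 2 * l) * (\<beta> + 2 * k + 3 * l)
       + 9 * (\<beta> + 2 * k + 3 * l)\<^sup>2 + 5 * (\<gamma> + 3 * m)\<^sup>2) \<le> 14"
    by (simp only: of_int_le_numeral_iff)
  \<comment> \<open>Multiples of a, b, c do not change the functional on \<open>N\<close>; they are
    chosen to shorten the component outside \<open>N\<close>.\<close>
  define y where "y = y0 + of_int k \<cdot>\<^sub>v a + of_int l \<cdot>\<^sub>v b + of_int m \<cdot>\<^sub>v c"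
  define A where "A = \<alpha> + 3 * k + 2 * l"
  define B where "B = \<beta> + 2 * k + 3 * l"
  define C where "C = \<gamma> + 3 * m"
  have y: "y \<in> A15_plus" unfolding y_def using y0 abc_mem by (intro A15_plus_add A15_plus_smult)
  have yz: "y \<bullet> z = y0 \<bullet> z + of_int k * (a \<bullet> z) + of_int l * (b \<bullet> z) + of_int m * (c \<bullet> z)"
    if "z \<in> carrier_vec 16" for z
    unfolding y_def using scalar_prod_comb4[OF _ carr that] y0 by auto
  have gy: "g u = y \<bullet> u" if u: "u \<in> N" for u
  proof -
    have uc: "u \<in> carrier_vec 16" using u N_mem by auto
    have "a \<bullet> u = 0" "b \<bullet> u = 0" "c \<bullet> u = 0"
      using u comm_scalar_prod[OF carr(1) uc] comm_scalar_prod[OF carr(2) uc] comm_scalar_prod[OF carr(3) uc]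
      by (auto simp: orth_abc_def)
    then show ?thesis using g0[OF u] yz[OF uc] by simp
  qed
  have yabc: "y \<bullet> a = of_int A" "y \<bullet> b = of_int B" "y \<bullet> c = of_int C"
    using yz carr abc_gram abg by (simp_all add: A_def B_def C_def)
  \<comment> \<open>15 times the projection of \<open>y\<close> orthogonal to a, b, c. The inverse
    Gram matrix has entries 3/5, -2/5 and 1/3, and 15 clears the denominators, so that
    \<open>u\<close> lies in \<open>N\<close>.\<close>
  define u where "u = 15 \<cdot>\<^sub>v y + of_int (- 3 * (3 * A - 2 * B)) \<cdot>\<^sub>v a + of_int (- 3 * (3 * B - 2 * A)) \<cdot>\<^sub>v b + of_int (- 5 * C) \<cdot>\<^sub>v c"
  have uA: "u \<in> A15_plus" unfolding u_def
    using y abc_mem A15_plus_smult[of y 15] by (intro A15_plus_add A15_plus_smult) auto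
  have uz: "u \<bullet> z = 15 * (y \<bullet> z) + of_int (- 3 * (3 * A - 2 * B)) * (a \<bullet> z) + of_int (- 3 * (3 * B - 2 * A)) * (b \<bullet> z) + of_int (- 5 * C) * (c \<bullet> z)"
    if "z \<in> carrier_vec 16" for z
    unfolding u_def using scalar_prod_comb4[OF _ carr that, of "15 \<cdot>\<^sub>v y"] y that by auto
  have uabc: "u \<bullet> a = 0" "u \<bullet> b = 0" "u \<bullet> c = 0"
    unfolding uz[OF carr(1)] uz[OF carr(2)] uz[OF carr(3)] abc_gram yabc by (simp_all add: algebra_simps)
  then have uN: "u \<in> N" using uA by (simp add: orth_abc_def)
  have uc: "u \<in> carrier_vec 16" and yc: "y \<in> carrier_vec 16" using uA y by auto
  have "a \<bullet> u = 0" "b \<bullet> u = 0" "c \<bullet> u = 0"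
    using uabc comm_scalar_prod[OF carr(1) uc] comm_scalar_prod[OF carr(2) uc] comm_scalar_prod[OF carr(3) uc] by auto
  then have uu: "u \<bullet> u = 15 * (y \<bullet> u)" using uz[OF uc] by simp
  have "a \<bullet> y = of_int A" "b \<bullet> y = of_int B" "c \<bullet> y = of_int C"
    using yabc comm_scalar_prod[OF carr(1) yc] comm_scalar_prod[OF carr(2) yc] comm_scalar_prod[OF carr(3) yc] by auto
  then have "u \<bullet> y = 15 * (y \<bullet> y) - of_int (9 * A\<^sup>2 - 12 * A * B + 9 * B\<^sup>2 + 5 * C\<^sup>2)"
    using uz[OF yc] by (simp add: power2_eq_square algebra_simps)
  then have yu: "y \<bullet> u = 15 * (y \<bullet> y) - of_int (9 * A\<^sup>2 - 12 * A * B + 9 * B\<^sup>2 + 5 * C\<^sup>2)"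
    using comm_scalar_prod[OF uc yc] by simp
  \<comment> \<open>The bound is applied in the direction of the functional itself. The norm of the
    projection of \<open>y\<close> is \<open>y \<bullet> u\<close> divided by 15, so the outcome is
    that this norm is at most \<open>t\<close>.\<close>
  have "(y \<bullet> u)\<^sup>2 \<le> real t * (15 * (y \<bullet> u))" using bound[OF uN] gy[OF uN] uu by simp
  then have "(y \<bullet> u) * (y \<bullet> u) \<le> (15 * real t) * (y \<bullet> u)" by (simp add: power2_eq_square mult_ac)
  moreover have "y \<bullet> u \<ge> 0" using uu scalar_prod_self_nonneg[of u] by simp
  ultimately have "y \<bullet> u \<le> 15 * real t"
    by (cases "y \<bullet> u = 0") (auto simp: mult_le_cancel_right)
  then have "15 * (y \<bullet> y) \<le> 15 * real t + 14"
    using yu red unfolding A_def B_def C_def by linarith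
  then have "y \<bullet> y < real t + 1" by simp
  then show ?thesis using that[OF y _ gy] by blast
qed

text \<open>If \<open>\<phi> u\<close> were a unit vector, then \<open>v \<mapsto> \<phi> u \<bullet> \<phi> v\<close> would be a functional of norm at most 1
  on \<open>N\<close>, represented by a vector of norm less than 2 in \<open>A15_plus\<close>, hence by 0.\<close>

lemma no_unit_vector:
  assumes car: "\<And>u. u \<in> N \<Longrightarrow> \<phi> u \<in> carrier_vec k"
    and add: "\<And>u v. u \<in> N \<Longrightarrow> v \<in> N \<Longrightarrow> \<phi> (u + v) = \<phi> u + \<phi> v"
    and int: "\<And>u v. u \<in> N \<Longrightarrow> v \<in> N \<Longrightarrow> \<phi> u \<bullet> \<phi> v \<in> \<int>"
    and bound: "\<And>u. u \<in> N \<Longrightarrow> \<phi> u \<bullet> \<phi> u \<le> u \<bullet> u"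
    and u: "u \<in> N"
  shows "\<phi> u \<bullet> \<phi> u \<noteq> (1::real)"
proof
  assume 1: "\<phi> u \<bullet> \<phi> u = 1"
  define g where "g v = \<phi> u \<bullet> \<phi> v" for v
  have "(g v)\<^sup>2 \<le> real 1 * (v \<bullet> v)" if v: "v \<in> N" for v
  proof -
    \<comment> \<open>Cauchy-Schwarz against the unit vector: \<open>?w\<close> is the part of
      \<open>\<phi> v\<close> orthogonal to \<open>\<phi> u\<close>.\<close>
    let ?w = "\<phi> v - g v \<cdot>\<^sub>v \<phi> u"
    have c: "\<phi> u \<in> carrier_vec k" "\<phi> v \<in> carrier_vec k" using car u v by auto
    have "?w \<bullet> ?w = \<phi> v \<bullet> \<phi> v - g v * (\<phi> u \<bullet> \<phi> v) - g v * (\<phi> v \<bullet> \<phi> u) + g v * g v * (\<phi> u \<bullet> \<phi> u)"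
      using c by (simp add: minus_scalar_prod_distrib[of _ k] scalar_prod_minus_distrib[of _ k] algebra_simps)
    also have "\<dots> = \<phi> v \<bullet> \<phi> v - (g v)\<^sup>2"
      using 1 comm_scalar_prod[OF c] by (simp add: g_def power2_eq_square)
    finally have "(g v)\<^sup>2 \<le> \<phi> v \<bullet> \<phi> v" using scalar_prod_self_nonneg[of ?w] by simp
    then show ?thesis using bound[OF v] by simp
  qed
  moreover have "g (v + w) = g v + g w" if "v \<in> N" "w \<in> N" for v w
    using car u that by (simp add: g_def add scalar_prod_add_distrib[of _ k])
  moreover have "g v \<in> \<int>" if "v \<in> N" for v using int u that by (simp add: g_def)
  ultimately obtain y where "y \<in> A15_plus" "y \<bullet> y < real 1 + 1" "\<And>u. u \<in> N \<Longrightarrow> g u = y \<bullet> u"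
    using functional_representation[of g 1] by blast
  then have "g u = 0" using A15_plus_norm_less_2[of y] u N_mem by auto
  then show False using 1 by (simp add: g_def)
qed

end

section \<open>Coordinate systems and splittings of the form\<close>

context A15_complement
begin

lemma N_rootI:
  assumes "p < 16" "q < 16" "al ! p = al ! q" "bl ! p = bl ! q" "cl ! p = cl ! q"
  shows "A_root p q \<in> N"
proof -
  have "A_root p q \<bullet> qvec xs = 0" if "length xs = 16" "xs ! p = xs ! q" for xs
  proof -
    have c: "qvec xs \<in> carrier_vec 16" using that by (simp add: qvec_def)
    have "A_root p q \<bullet> qvec xs = qvec xs \<bullet> A_root p q"
      by (rule comm_scalar_prod[of _ 16]) (use c in \<open>auto simp: A_root_def\<close>)
    then show ?thesis using scalar_prod_root[OF c assms(1,2)] that assms by (simp add: qvec_def)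
  qed
  then show ?thesis
    using A_root_in_A15_plus[OF assms(1,2)] assms lengths by (simp add: orth_abc_def)
qed

lemma N_root:
  assumes "p < 16" "q < 16" "lo \<le> p" "lo \<le> q"
  shows "A_root p q \<in> N"
proof -
  have "al ! j = 1 \<and> bl ! j = 1 \<and> cl ! j = 1" if "lo \<le> j" "j < 16" for j
    using lo(2) that unfolding list_all_iff by simp
  then show ?thesis using assms by (intro N_rootI) auto
qed

text \<open>A Farkas argument. The hypothesis turns a weighted sum of squares of the functionals
  \<open>v $ p i - v $ q i\<close> into a multiple of the same weighted sum of norms, which
  \<open>cert_neg\<close> makes negative. \<open>cert_nonneg\<close> gives the opposite sign
  functional by functional, except for roots inside the block from \<open>lo\<close> on, which
  \<open>outside\<close> removes.\<close>

lemma no_coordinate_system: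
  fixes m :: nat and p q :: "nat \<Rightarrow> nat"
  assumes pq: "\<And>i. i < m \<Longrightarrow> p i < 16 \<and> q i < 16"
    and eq: "\<And>u. u \<in> N \<Longrightarrow> (\<Sum>i<m. (u $ p i - u $ q i)\<^sup>2) = 2 * (u \<bullet> u)"
  shows False
proof -
  have roots: "(\<Sum>i<m. (A_root x y $ p i - A_root x y $ q i)\<^sup>2) = 4"
    if "x < 16" "y < 16" "lo \<le> x" "lo \<le> y" "x \<noteq> y" for x y
    using eq[OF N_root[OF that(1-4)]] A_root_norm[of x y] that by simp
  have rt: "A_root x y $ z = of_bool (z = x) - of_bool (z = y)" if "x < 16" "y < 16" "z < 16" for x y z
    using that by (auto simp: A_root_def)
  have outside: "p i = q i \<or> p i < lo \<or> q i < lo" if i: "i < m" for i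
  proof (rule ccontr)
    assume "\<not> ?thesis"
    then have D: "p i \<noteq> q i" "lo \<le> p i" "lo \<le> q i" by auto
    define x where "x = p i"
    define y where "y = q i"
    have xy: "x < 16" "y < 16" "lo \<le> x" "lo \<le> y" "x \<noteq> y" using D pq[OF i] by (auto simp: x_def y_def)
    have "finite ({lo..<16} - {x, y})" "card ({lo..<16} - {x, y}) \<ge> 2"
      using card_Diff_subset[of "{x, y}" "{lo..<16}"] xy lo(1) by auto
    then obtain T where "T \<subseteq> {lo..<16} - {x, y}" "card T = 2" by (meson obtain_subset_with_card_n)
    then obtain r s where rs: "r \<in> {lo..<16} - {x, y}" "s \<in> {lo..<16} - {x, y}" "r \<noteq> s"
      by (auto simp: card_2_iff)
    let ?f = "\<lambda>x y j. (A_root x y $ p j - A_root x y $ q j)\<^sup>2"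
    have split: "(\<Sum>j\<in>{..<m} - {i}. ?f x' y' j) = 4 - ?f x' y' i" if "x' \<in> {lo..<16}" "y' \<in> {lo..<16}" "x' \<noteq> y'" for x' y'
      using roots[of x' y'] that i by (simp add: sum_diff1)
    have fi: "?f x y i = 4" "?f x r i = 1" "?f x s i = 1" "?f r s i = 0"
      using xy rs pq[OF i] by (auto simp: rt x_def[symmetric] y_def[symmetric])
    \<comment> \<open>On its own root the functional \<open>i\<close> has value 2, whose square uses
      up the whole total 4.\<close>
    have "(\<Sum>j\<in>{..<m} - {i}. ?f x y j) = 0" using split[of x y] fi xy by simp
    then have z: "\<forall>j\<in>{..<m} - {i}. ?f x y j = 0"
      by (subst (asm) sum_nonneg_eq_0_iff) auto
    \<comment> \<open>A functional vanishing on the root of \<open>x\<close> and \<open>y\<close>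
      has equal coefficients there, hence coefficient 0 at \<open>x\<close>. Its coefficients at
      \<open>r\<close> and \<open>s\<close> have product at most 0, so the square of their
      difference is at least the sum of their squares.\<close>
    have le: "?f x r j + ?f x s j \<le> ?f r s j" if j: "j \<in> {..<m} - {i}" for j
    proof -
      have "A_root x y $ p j - A_root x y $ q j = 0" using z j by simp
      then have "of_bool (p j = x) - of_bool (p j = y) - (of_bool (q j = x) - of_bool (q j = y)) = (0::real)"
        using rt xy pq j by auto
      then have xj: "p j = q j \<or> p j \<noteq> x \<and> q j \<noteq> x"
        using xy(5) by (auto split: if_splits simp: of_bool_def)
      have e: "A_root x' y' $ p j - A_root x' y' $ q j
          = of_bool (p j = x') - of_bool (p j = y') - (of_bool (q j = x') - of_bool (q j = y'))"
        if "x' < 16" "y' < 16" for x' y' using rt pq j that by auto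
      show ?thesis
        unfolding e[OF xy(1), of r] using xj rs xy by (auto simp: e of_bool_def)
    qed
    \<comment> \<open>The three roots have total 4 each, and the functional \<open>i\<close>
      contributes 1, 1 and 0; the others would need 3 + 3 at most 4.\<close>
    have "6 = (\<Sum>j\<in>{..<m} - {i}. ?f x r j) + (\<Sum>j\<in>{..<m} - {i}. ?f x s j)"
      using split[of x r] split[of x s] fi xy rs by auto
    also have "\<dots> \<le> (\<Sum>j\<in>{..<m} - {i}. ?f r s j)"
      unfolding sum.distrib[symmetric] by (rule sum_mono) (rule le)
    also have "\<dots> = 4" using split[of r s] fi rs by auto
    finally show False by simp
  qed
  have certq: "qvec u $ k = of_int (u ! k) / 4" if "(w, u) \<in> set cert" "k < 16" for w u k
    using certA that by (auto simp: qvec_def A15_list_def list_all_iff)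
  let ?c = "\<lambda>i. \<Sum>(w, u)\<leftarrow>cert. w * (u ! p i - u ! q i)\<^sup>2"
  \<comment> \<open>\<open>pair_weight\<close> is meant for distinct indices; the functional with
    \<open>p i = q i\<close> is 0 and gets the value 0 separately.\<close>
  let ?b = "\<lambda>i. \<Sum>(w, X)\<leftarrow>blocks. w * (if p i = q i then 0 else pair_weight X (p i) (q i))"
  have "0 \<le> ?c i + ?b i" if i: "i < m" for i
  proof (cases "p i = q i")
    case True
    then have "(\<Sum>(w, u)\<leftarrow>xs. w * (u ! p i - u ! q i)\<^sup>2) = 0" for xs :: "(int \<times> int list) list"
      by (induction xs) auto
    moreover have "(\<Sum>(w, X)\<leftarrow>xs. w * (if p i = q i then 0 else pair_weight X (p i) (q i))) = 0" for xs
      using True by (induction xs) auto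
    ultimately show ?thesis by simp
  next
    case False
    then show ?thesis using outside[OF i] cert_nonneg pq[OF i] unfolding list_all_iff by (simp add: False)
  qed
  then have "0 \<le> (\<Sum>i<m. ?c i + ?b i)" by (intro sum_nonneg) auto
  also have "\<dots> = (\<Sum>i<m. ?c i) + (\<Sum>i<m. ?b i)" by (rule sum.distrib)
  also have "(\<Sum>i<m. ?c i) = (\<Sum>(w, u)\<leftarrow>cert. w * (2 * idot u u))"
  proof -
    have "(\<Sum>i<m. \<Sum>(w, u)\<leftarrow>xs. w * (u ! p i - u ! q i)\<^sup>2)
        = (\<Sum>(w, u)\<leftarrow>xs. w * (\<Sum>i<m. (u ! p i - u ! q i)\<^sup>2))" for xs :: "(int \<times> int list) list"
      by (induction xs) (auto simp: sum.distrib sum_distrib_left)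
    moreover have "(\<Sum>i<m. (u ! p i - u ! q i)\<^sup>2) = 2 * idot u u" if u: "(w, u) \<in> set cert" for w u
    proof -
      have uA: "A15_list u" "idot u al = 0" "idot u bl = 0" "idot u cl = 0" using certA u by (auto simp: list_all_iff)
      have "real_of_int (\<Sum>i<m. (u ! p i - u ! q i)\<^sup>2) = (\<Sum>i<m. 16 * (qvec u $ p i - qvec u $ q i)\<^sup>2)"
        unfolding of_int_sum
        using pq by (intro sum.cong refl) (simp add: certq[OF u] power_divide diff_divide_distrib[symmetric])
      also have "\<dots> = 16 * (2 * (qvec u \<bullet> qvec u))"
        using eq[OF qvec_in_N[OF uA]] by (simp add: sum_distrib_left[symmetric])
      also have "\<dots> = of_int (2 * idot u u)" by (simp add: qvec_scalar_prod)
      finally show ?thesis by (simp only: of_int_eq_iff)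
    qed
    ultimately show ?thesis by (auto intro!: arg_cong[of _ _ sum_list] map_cong)
  qed
  also have "(\<Sum>i<m. ?b i) = (\<Sum>(w, X)\<leftarrow>blocks. w * (64 * int (length X) * (int (length X) - 1)))"
  proof -
    have "(\<Sum>i<m. \<Sum>(w, X)\<leftarrow>xs. w * (if p i = q i then 0 else pair_weight X (p i) (q i)))
        = (\<Sum>(w, X)\<leftarrow>xs. w * (\<Sum>i<m. if p i = q i then 0 else pair_weight X (p i) (q i)))" for xs
      by (induction xs) (auto simp: sum.distrib sum_distrib_left)
    moreover have "(\<Sum>i<m. if p i = q i then 0 else pair_weight X (p i) (q i)) = 64 * int (length X) * (int (length X) - 1)"
      if X: "(w, X) \<in> set blocks" for w X
    proof -
      have Xd: "distinct X" and XN: "\<And>x y. x \<in> set X \<Longrightarrow> y \<in> set X \<Longrightarrow> x < 16 \<and> A_root x y \<in> N"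
        using blocksA X by (auto simp: list_all_iff intro!: N_rootI)
      have "real_of_int (\<Sum>i<m. if p i = q i then 0 else pair_weight X (p i) (q i))
          = (\<Sum>i<m. 16 * (\<Sum>x\<in>set X. \<Sum>y\<in>set X. (A_root x y $ p i - A_root x y $ q i)\<^sup>2))"
        unfolding of_int_sum
      proof (rule sum.cong[OF refl])
        fix i assume "i \<in> {..<m}"
        then have i: "p i < 16" "q i < 16" using pq by auto
        define e where "e x = of_bool (p i = x) - (of_bool (q i = x) :: real)" for x
        have "(\<Sum>x\<in>set X. \<Sum>y\<in>set X. (A_root x y $ p i - A_root x y $ q i)\<^sup>2) = (\<Sum>x\<in>set X. \<Sum>y\<in>set X. (e x - e y)\<^sup>2)"
          using XN i by (intro sum.cong refl) (auto simp: rt e_def)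
        \<comment> \<open>Variance identity: the double sum of squared differences depends only on
          the sum and the sum of squares, which are read off from how many of \<open>p i\<close>,
          \<open>q i\<close> lie in \<open>X\<close>.\<close>
        also have "\<dots> = 2 * real (length X) * (\<Sum>x\<in>set X. (e x)\<^sup>2) - 2 * (\<Sum>x\<in>set X. e x)\<^sup>2"
          unfolding power2_diff sum.distrib sum_subtractf using distinct_card[OF Xd]
          by (simp add: sum_distrib_left[symmetric] sum_distrib_right[symmetric] mult.assoc power2_eq_square[of "sum e (set X)"])
        also have "(\<Sum>x\<in>set X. e x) = of_bool (p i \<in> set X) - of_bool (q i \<in> set X)"
          unfolding e_def sum_subtractf by (simp add: of_bool_def)
        also have "(\<Sum>x\<in>set X. (e x)\<^sup>2) = (if p i = q i then 0 else of_bool (p i \<in> set X) + of_bool (q i \<in> set X))"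
        proof (cases "p i = q i")
          case False
          then have "(e x)\<^sup>2 = of_bool (p i = x) + of_bool (q i = x)" for x by (auto simp: e_def)
          then show ?thesis using False by (simp add: sum.distrib of_bool_def)
        qed (simp add: e_def)
        finally show "real_of_int (if p i = q i then 0 else pair_weight X (p i) (q i))
            = 16 * (\<Sum>x\<in>set X. \<Sum>y\<in>set X. (A_root x y $ p i - A_root x y $ q i)\<^sup>2)"
          by (auto simp: pair_weight_def)
      qed
      also have "\<dots> = 16 * (\<Sum>x\<in>set X. \<Sum>y\<in>set X. \<Sum>i<m. (A_root x y $ p i - A_root x y $ q i)\<^sup>2)"
        by (simp add: sum_distrib_left[symmetric] sum.swap[of _ "{..<m}"])
      also have "\<dots> = 16 * (\<Sum>x\<in>set X. \<Sum>y\<in>set X. 4 - 4 * of_bool (x = y))"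
      proof -
        have "(\<Sum>i<m. (A_root x y $ p i - A_root x y $ q i)\<^sup>2) = 4 - 4 * of_bool (x = y)"
          if "x \<in> set X" "y \<in> set X" for x y
        proof (cases "x = y")
          case True
          then show ?thesis using XN that rt pq by simp
        next
          case False
          then show ?thesis using eq[of "A_root x y"] XN that A_root_norm[of x y] by simp
        qed
        then show ?thesis by simp
      qed
      also have "\<dots> = of_int (64 * int (length X) * (int (length X) - 1))"
        using distinct_card[OF Xd] by (simp add: sum_subtractf sum_distrib_left[symmetric] algebra_simps)
      finally show ?thesis by (simp only: of_int_eq_iff)
    qed
    ultimately show ?thesis by (auto intro!: arg_cong[of _ _ sum_list] map_cong)
  qed
  also have "(\<Sum>(w, u)\<leftarrow>cert. w * (2 * idot u u)) + (\<Sum>(w, X)\<leftarrow>blocks. w * (64 * int (length X) * (int (length X) - 1)))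
      = 2 * ((\<Sum>(w, u)\<leftarrow>cert. w * idot u u) + (\<Sum>(w, X)\<leftarrow>blocks. w * (32 * int (length X) * (int (length X) - 1))))"
  proof -
    have "(\<Sum>(w, u)\<leftarrow>xs. w * (2 * idot u u)) = 2 * (\<Sum>(w, u)\<leftarrow>xs. w * idot u u)" for xs
      by (induction xs) auto
    moreover have "(\<Sum>(w, X)\<leftarrow>xs. w * (64 * int (length X) * (int (length X) - 1)))
        = 2 * (\<Sum>(w, X)\<leftarrow>xs. w * (32 * int (length X) * (int (length X) - 1)))" for xs :: "(int \<times> nat list) list"
      by (induction xs) auto
    ultimately show ?thesis by simp
  qed
  finally show False using cert_neg by simp
qed

lemma map_zero_on_N:
  assumes car: "\<And>u. u \<in> N \<Longrightarrow> \<phi> u \<in> carrier_vec k"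
    and add: "\<And>u v. u \<in> N \<Longrightarrow> v \<in> N \<Longrightarrow> \<phi> (u + v) = \<phi> u + (\<phi> v :: real vec)"
    and 0: "\<And>i. i < 12 \<Longrightarrow> \<phi> (qvec (ns ! i)) = 0\<^sub>v k" and u: "u \<in> N"
  shows "\<phi> u = 0\<^sub>v k"
proof (rule eq_vecI)
  fix j assume "j < dim_vec (0\<^sub>v k)"
  then have j: "j < k" by simp
  have "\<phi> u $ j = 0\<^sub>v 16 \<bullet> u"
  proof (rule additive_on_N[of "\<lambda>u. \<phi> u $ j", OF _ _ _ u])
    show "\<phi> (u + v) $ j = \<phi> u $ j + \<phi> v $ j" if "u \<in> N" "v \<in> N" for u v
      using add[OF that] car[OF that(1)] car[OF that(2)] j by simp
    show "\<phi> (qvec (ns ! i)) $ j = 0\<^sub>v 16 \<bullet> qvec (ns ! i)" if "i < 12" for i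
      using 0[OF that] j N_mem(2)[OF nv_N[OF that]] by simp
  qed simp
  then show "\<phi> u $ j = 0\<^sub>v k $ j" using j u N_mem by simp
qed (use car u in auto)

lemma basis_norms:
  assumes "i < 12"
  shows "qvec (ns ! i) \<bullet> qvec (ns ! i) = 2 \<or> qvec (ns ! i) \<bullet> qvec (ns ! i) = 3"
  using norms assms lengths by (auto simp: qvec_scalar_prod)

text \<open>The Gram form of \<open>N\<close> is additively indecomposable: on a connected basis of vectors of norm 2 or 3
  both summands are integral and avoid the value 1, so one of them vanishes on each basis vector.\<close>

lemma no_splitting:
  assumes hc: "\<And>u. u \<in> N \<Longrightarrow> h u \<in> carrier_vec k" and Fc: "\<And>u. u \<in> N \<Longrightarrow> F u \<in> carrier_vec m"
    and hadd: "\<And>u v. u \<in> N \<Longrightarrow> v \<in> N \<Longrightarrow> h (u + v) = h u + (h v :: real vec)"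
    and Fadd: "\<And>u v. u \<in> N \<Longrightarrow> v \<in> N \<Longrightarrow> F (u + v) = F u + F v"
    and hint: "\<And>u v. u \<in> N \<Longrightarrow> v \<in> N \<Longrightarrow> h u \<bullet> h v \<in> \<int>"
    and Fint: "\<And>u i. u \<in> N \<Longrightarrow> i < m \<Longrightarrow> F u $ i \<in> \<int>"
    and eq: "\<And>u v. u \<in> N \<Longrightarrow> v \<in> N \<Longrightarrow> u \<bullet> v = h u \<bullet> h v + (F u \<bullet> F v) / 2"
    and u: "u \<in> N"
  shows "F u = 0\<^sub>v m"
proof -
  have h1: "h v \<bullet> h v \<noteq> 1" if v: "v \<in> N" for v
  proof (rule no_unit_vector[OF hc hadd hint _ v])
    show "h w \<bullet> h w \<le> w \<bullet> w" if "w \<in> N" for w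
      using eq[OF that that] scalar_prod_self_nonneg[of "F w"] by simp
  qed
  \<comment> \<open>The scaling by 1/sqrt 2 turns the second summand into a form on the same footing
    as the first, so that \<open>no_unit_vector\<close> applies to both.\<close>
  define \<phi> where "\<phi> v = (1 / sqrt 2) \<cdot>\<^sub>v F v" for v
  have \<phi>: "\<phi> v \<bullet> \<phi> w = (F v \<bullet> F w) / 2" if "v \<in> N" "w \<in> N" for v w
    using Fc[OF that(1)] Fc[OF that(2)] by (simp add: \<phi>_def)
  have \<phi>1: "\<phi> v \<bullet> \<phi> v \<noteq> 1" if v: "v \<in> N" for v
  proof (rule no_unit_vector[of \<phi> m, OF _ _ _ _ v])
    show "\<phi> w \<in> carrier_vec m" if "w \<in> N" for w using Fc[OF that] by (simp add: \<phi>_def)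
    show "\<phi> (w + x) = \<phi> w + \<phi> x" if "w \<in> N" "x \<in> N" for w x
      unfolding \<phi>_def Fadd[OF that] using Fc[OF that(1)] Fc[OF that(2)] by (rule smult_add_distrib_vec)
    show "\<phi> w \<bullet> \<phi> x \<in> \<int>" if "w \<in> N" "x \<in> N" for w x
    proof -
      \<comment> \<open>Half of an inner product of integer vectors need not be integral; here it
        is, as the difference of two integral forms.\<close>
      have "\<phi> w \<bullet> \<phi> x = w \<bullet> x - h w \<bullet> h x" using eq[OF that] \<phi>[OF that] by simp
      then show ?thesis using hint[OF that] A15_plus_integral[OF N_mem(1) N_mem(1)] that by simp
    qed
    show "\<phi> w \<bullet> \<phi> w \<le> w \<bullet> w" if "w \<in> N" for w
      using eq[OF that that] \<phi>[OF that that] scalar_prod_self_nonneg[of "h w"] by simp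
  qed
  have F1: "F v \<bullet> F v \<noteq> 2" if "v \<in> N" for v
  proof
    assume "F v \<bullet> F v = 2"
    then have "\<phi> v \<bullet> \<phi> v = 1" using \<phi>[OF that that] by simp
    then show False using \<phi>1[OF that] by simp
  qed
  have dich: "h (qvec (ns ! i)) = 0\<^sub>v k \<or> F (qvec (ns ! i)) = 0\<^sub>v m" if i: "i < 12" for i
  proof -
    let ?n = "qvec (ns ! i)"
    have n: "?n \<in> N" using nv_N i .
    obtain z where z: "h ?n \<bullet> h ?n = of_int z" using hint[OF n n] by (auto elim: Ints_cases)
    have e: "?n \<bullet> ?n = of_int z + (F ?n \<bullet> F ?n) / 2" using eq[OF n n] z by simp
    have "0 \<le> z" using z scalar_prod_self_nonneg[of "h ?n"] by simp
    moreover have "z \<noteq> 1" using z h1[OF n] by auto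
    moreover have Fz: "F ?n \<bullet> F ?n = 2 * (?n \<bullet> ?n - of_int z)" using e by simp
    ultimately consider "z = 0" | "F ?n \<bullet> F ?n = 0"
    proof -
      from basis_norms[OF i] show ?thesis
      proof
        assume a: "?n \<bullet> ?n = 2"
        then have "z \<le> 2" using Fz scalar_prod_self_nonneg[of "F ?n"] by simp
        then have "z = 0 \<or> z = 2" using \<open>0 \<le> z\<close> \<open>z \<noteq> 1\<close> by linarith
        then show ?thesis using that Fz a by auto
      next
        assume a: "?n \<bullet> ?n = 3"
        then have "z \<le> 3" using Fz scalar_prod_self_nonneg[of "F ?n"] by simp
        moreover have "z \<noteq> 2" using Fz a F1[OF n] by auto
        ultimately have "z = 0 \<or> z = 3" using \<open>0 \<le> z\<close> \<open>z \<noteq> 1\<close> by linarith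
        then show ?thesis using that Fz a by auto
      qed
    qed
    then show ?thesis
    proof cases
      case 1
      then show ?thesis using scalar_prod_self_eq_0[OF hc[OF n]] z by simp
    next
      case 2
      then show ?thesis using scalar_prod_self_eq_0[OF Fc[OF n]] by simp
    qed
  qed
  \<comment> \<open>Vectors carried by different summands are orthogonal, so nonorthogonal basis
    vectors are carried by the same one.\<close>
  have link: "(h (qvec (ns ! i)) = 0\<^sub>v k \<longrightarrow> h (qvec (ns ! j)) = 0\<^sub>v k) \<and>
      (F (qvec (ns ! i)) = 0\<^sub>v m \<longrightarrow> F (qvec (ns ! j)) = 0\<^sub>v m)"
    if ij: "i < 12" "j < 12" "idot (ns ! j) (ns ! i) \<noteq> 0" for i j
  proof -
    let ?x = "qvec (ns ! i)" and ?y = "qvec (ns ! j)"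
    have xy: "?x \<in> N" "?y \<in> N" using nv_N ij by auto
    have "?y \<bullet> ?x \<noteq> 0" using ij lengths by (simp add: qvec_scalar_prod)
    then have ne: "h ?y \<bullet> h ?x + (F ?y \<bullet> F ?x) / 2 \<noteq> 0" using eq[OF xy(2,1)] by simp
    have "\<not> (h ?x = 0\<^sub>v k \<and> F ?y = 0\<^sub>v m)" "\<not> (F ?x = 0\<^sub>v m \<and> h ?y = 0\<^sub>v k)"
      using ne hc[OF xy(1)] hc[OF xy(2)] Fc[OF xy(1)] Fc[OF xy(2)] by auto
    then show ?thesis using dich[OF ij(2)] by blast
  qed
  have all: "(h (qvec (ns ! 0)) = 0\<^sub>v k \<longrightarrow> h (qvec (ns ! i)) = 0\<^sub>v k) \<and>
      (F (qvec (ns ! 0)) = 0\<^sub>v m \<longrightarrow> F (qvec (ns ! i)) = 0\<^sub>v m)" if "i < 12" for i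
    using that
  proof (induction i rule: less_induct)
    case (less i)
    show ?case
    proof (cases "i = 0")
      case False
      then obtain j where j: "j < i" "idot (ns ! i) (ns ! j) \<noteq> 0" using conn[OF less.prems] by auto
      then have "j < 12" using less.prems by simp
      then show ?thesis using link[OF \<open>j < 12\<close> less.prems j(2)] less.IH[OF j(1)] by blast
    qed simp
  qed
  from dich[of 0] have "h (qvec (ns ! 0)) = 0\<^sub>v k \<or> F (qvec (ns ! 0)) = 0\<^sub>v m" by simp
  then show ?thesis
  proof
    assume "F (qvec (ns ! 0)) = 0\<^sub>v m"
    then have F0: "F (qvec (ns ! i)) = 0\<^sub>v m" if "i < 12" for i using all[OF that] by blast
    show ?thesis by (rule map_zero_on_N[OF Fc Fadd F0 u])
  next
    assume "h (qvec (ns ! 0)) = 0\<^sub>v k"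
    then have hn: "h (qvec (ns ! i)) = 0\<^sub>v k" if "i < 12" for i using all[OF that] by blast
    have h0: "h v = 0\<^sub>v k" if "v \<in> N" for v by (rule map_zero_on_N[OF hc hadd hn that])
    have FF: "F v \<bullet> F v = 2 * (v \<bullet> v)" if "v \<in> N" for v
      using eq[OF that that] h0[OF that] by simp
    have "\<exists>p q. p < 16 \<and> q < 16 \<and> (\<forall>v\<in>N. F v $ i = v $ p - v $ q)" if i: "i < m" for i
    proof -
      \<comment> \<open>A single coordinate is bounded by all of \<open>F v\<close>, which has norm
        twice that of \<open>v\<close>; hence the parameter 2 in the lifting lemma.\<close>
      have bd: "(F v $ i)\<^sup>2 \<le> real 2 * (v \<bullet> v)" if v: "v \<in> N" for v
      proof -
        have "(F v $ i)\<^sup>2 \<le> (\<Sum>j<m. F v $ j * F v $ j)"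
          unfolding power2_eq_square using i by (intro member_le_sum) auto
        also have "\<dots> = F v \<bullet> F v" using scalar_prod_sum_lessThan[OF Fc[OF v]] by simp
        finally show ?thesis using FF[OF v] by simp
      qed
      have ad: "F (v + w) $ i = F v $ i + F w $ i" if "v \<in> N" "w \<in> N" for v w
        using Fadd[OF that] Fc[OF that(1)] Fc[OF that(2)] i by simp
      obtain y where y: "y \<in> A15_plus" "y \<bullet> y < real 2 + 1" "\<And>v. v \<in> N \<Longrightarrow> F v $ i = y \<bullet> v"
        using functional_representation[of "\<lambda>v. F v $ i" 2] bd ad Fint i by blast
      have "y = 0\<^sub>v 16 \<or> (\<exists>p q. p < 16 \<and> q < 16 \<and> p \<noteq> q \<and> y = A_root p q)"
        using A15_plus_norm_less_3[OF y(1)] y(2) by simp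
      then show ?thesis
      proof
        assume "y = 0\<^sub>v 16"
        \<comment> \<open>The zero functional is written with two equal indices, which
          \<open>no_coordinate_system\<close> permits.\<close>
        then show ?thesis using y(3) N_mem by (intro exI[of _ 0]) auto
      next
        assume "\<exists>p q. p < 16 \<and> q < 16 \<and> p \<noteq> q \<and> y = A_root p q"
        then obtain p q where pq: "p < 16" "q < 16" "y = A_root p q" by blast
        have "F v $ i = v $ p - v $ q" if "v \<in> N" for v
        proof -
          have "v \<in> carrier_vec 16" using N_mem that by auto
          then show ?thesis
            using y(3)[OF that] pq scalar_prod_root[of v p q] comm_scalar_prod[of y 16 v] by (simp add: A_root_def)
        qed
        then show ?thesis using pq by blast
      qed
    qed
    then obtain p q where pq: "\<And>i. i < m \<Longrightarrow> p i < (16::nat) \<and> q i < (16::nat)"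
      and F: "\<And>i v. i < m \<Longrightarrow> v \<in> N \<Longrightarrow> F v $ i = v $ p i - v $ q i" by metis
    have "(\<Sum>i<m. (v $ p i - v $ q i)\<^sup>2) = 2 * (v \<bullet> v)" if v: "v \<in> N" for v
    proof -
      have "(\<Sum>i<m. (v $ p i - v $ q i)\<^sup>2) = (\<Sum>i<m. F v $ i * F v $ i)"
        using F v by (intro sum.cong) (auto simp: power2_eq_square)
      then show ?thesis using scalar_prod_sum_lessThan[OF Fc[OF v], of "F v"] FF[OF v] by simp
    qed
    from no_coordinate_system[OF pq this] show ?thesis ..
  qed
qed

section \<open>Minimality and non-integrability\<close>

lemma scale_N_add:
  assumes "u \<in> N" "v \<in> N"
  shows "r \<cdot>\<^sub>v (u + v) = r \<cdot>\<^sub>v u + r \<cdot>\<^sub>v (v :: real vec)"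
  using assms N_mem by (intro smult_add_distrib_vec[of _ 16]) auto

text \<open>An embedding sends sqrt 2 times \<open>u\<close> to sqrt 2 times \<open>h u\<close>
  followed by \<open>F u\<close>. Dividing inner products by 2 gives exactly the splitting excluded
  by \<open>no_splitting\<close> unless \<open>F\<close> is 0.\<close>

lemma N_minimal: "s_minimal 2 N"
  unfolding s_minimal_def
proof
  assume "non_s_minimal 2 N"
  then obtain k M m K where M: "int_lattice k M" and K: "sublattice (k + m) K
        (orthogonal_sum (scale_lattice (sqrt (real 2)) M) (Z_lattice m))"
    and iso: "isometric (scale_lattice (sqrt (real 2)) N) K"
    and ncon: "\<not> K \<subseteq> orthogonal_sum (scale_lattice (sqrt (real 2)) M) {0\<^sub>v m}"
    unfolding non_s_minimal_def by blast
  have Mc: "M \<subseteq> carrier_vec k"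
    using M zspan_carrier unfolding int_lattice_def lattice_basis_def by blast
  let ?s = "sqrt 2 :: real"
  obtain f where bij: "bij_betw f (scale_lattice ?s N) K"
    and fadd: "\<And>x y. x \<in> scale_lattice ?s N \<Longrightarrow> y \<in> scale_lattice ?s N \<Longrightarrow> f (x + y) = f x + f y"
    and fprod: "\<And>x y. x \<in> scale_lattice ?s N \<Longrightarrow> y \<in> scale_lattice ?s N \<Longrightarrow> f x \<bullet> f y = x \<bullet> y"
    using iso unfolding isometric_def by auto
  have sN: "?s \<cdot>\<^sub>v u \<in> scale_lattice ?s N" if "u \<in> N" for u using that by (auto simp: scale_lattice_def)
  have "\<exists>\<mu> y. \<mu> \<in> M \<and> y \<in> Z_lattice m \<and> f (?s \<cdot>\<^sub>v u) = (?s \<cdot>\<^sub>v \<mu>) @\<^sub>v y" if "u \<in> N" for u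
  proof -
    have "f (?s \<cdot>\<^sub>v u) \<in> K" using bij_betw_apply[OF bij sN[OF that]] .
    then have "f (?s \<cdot>\<^sub>v u) \<in> orthogonal_sum (scale_lattice ?s M) (Z_lattice m)"
      using K by (auto simp: sublattice_def)
    then show ?thesis unfolding orthogonal_sum_def scale_lattice_def by blast
  qed
  then obtain h F where hM: "\<And>u. u \<in> N \<Longrightarrow> h u \<in> M" and FZ: "\<And>u. u \<in> N \<Longrightarrow> F u \<in> Z_lattice m"
    and f: "\<And>u. u \<in> N \<Longrightarrow> f (?s \<cdot>\<^sub>v u) = (?s \<cdot>\<^sub>v h u) @\<^sub>v F u" by metis
  have hc: "h u \<in> carrier_vec k" if "u \<in> N" for u using hM[OF that] Mc by auto
  have Fc: "F u \<in> carrier_vec m" if "u \<in> N" for u using FZ[OF that] by (auto simp: Z_lattice_def)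
  \<comment> \<open>\<open>h\<close> and \<open>F\<close> were chosen vector by vector; additivity
    holds because an appended vector splits uniquely.\<close>
  have both: "h (u + v) = h u + h v \<and> F (u + v) = F u + F v" if uv: "u \<in> N" "v \<in> N" for u v
  proof -
    note c = hc[OF uv(1)] hc[OF uv(2)] hc[OF N_add[OF uv]] Fc[OF uv(1)] Fc[OF uv(2)] Fc[OF N_add[OF uv]]
    have "(?s \<cdot>\<^sub>v h (u + v)) @\<^sub>v F (u + v) = f (?s \<cdot>\<^sub>v u + ?s \<cdot>\<^sub>v v)"
      using f[OF N_add[OF uv]] scale_N_add[OF uv] by simp
    also have "\<dots> = ((?s \<cdot>\<^sub>v h u) @\<^sub>v F u) + ((?s \<cdot>\<^sub>v h v) @\<^sub>v F v)"
      using fadd[OF sN sN] f uv by simp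
    also have "\<dots> = (?s \<cdot>\<^sub>v h u + ?s \<cdot>\<^sub>v h v) @\<^sub>v (F u + F v)"
      using c by (intro append_vec_add[of _ k _ _ m]) auto
    also have "?s \<cdot>\<^sub>v h u + ?s \<cdot>\<^sub>v h v = ?s \<cdot>\<^sub>v (h u + h v)"
      using c by (intro smult_add_distrib_vec[symmetric]) auto
    finally have "?s \<cdot>\<^sub>v h (u + v) = ?s \<cdot>\<^sub>v (h u + h v) \<and> F (u + v) = F u + F v"
      using c by (subst (asm) append_vec_eq[of _ k]) auto
    moreover have "h (u + v) = h u + h v" if e: "?s \<cdot>\<^sub>v h (u + v) = ?s \<cdot>\<^sub>v (h u + h v)"
    proof (rule eq_vecI)
      fix i assume "i < dim_vec (h u + h v)"
      then show "h (u + v) $ i = (h u + h v) $ i"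
        using arg_cong[OF e, of "\<lambda>w. w $ i"] c by auto
    qed (use c in auto)
    ultimately show ?thesis by blast
  qed
  have eq: "u \<bullet> v = h u \<bullet> h v + (F u \<bullet> F v) / 2" if uv: "u \<in> N" "v \<in> N" for u v
  proof -
    note c = hc[OF uv(1)] hc[OF uv(2)] Fc[OF uv(1)] Fc[OF uv(2)]
    have uc: "u \<in> carrier_vec 16" "v \<in> carrier_vec 16" using uv N_mem by auto
    have "2 * (u \<bullet> v) = (?s \<cdot>\<^sub>v u) \<bullet> (?s \<cdot>\<^sub>v v)" using uc by simp
    also have "\<dots> = ((?s \<cdot>\<^sub>v h u) @\<^sub>v F u) \<bullet> ((?s \<cdot>\<^sub>v h v) @\<^sub>v F v)"
      using fprod[OF sN sN] f uv by simp
    also have "\<dots> = (?s \<cdot>\<^sub>v h u) \<bullet> (?s \<cdot>\<^sub>v h v) + F u \<bullet> F v"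
      using c by (intro scalar_prod_append[of _ k _ m]) auto
    also have "\<dots> = 2 * (h u \<bullet> h v) + F u \<bullet> F v" using c by simp
    finally show ?thesis by simp
  qed
  have hint: "h u \<bullet> h v \<in> \<int>" if "u \<in> N" "v \<in> N" for u v
    using M hM that unfolding int_lattice_def by blast
  have "F u = 0\<^sub>v m" if "u \<in> N" for u
  proof (rule no_splitting[OF hc Fc _ _ hint _ eq that])
    show "F u $ i \<in> \<int>" if "u \<in> N" "i < m" for u i using FZ[OF that(1)] that by (auto simp: Z_lattice_def)
  qed (use both in auto)
  then have "K \<subseteq> orthogonal_sum (scale_lattice ?s M) {0\<^sub>v m}"
    using bij_betw_imp_surj_on[OF bij] f hM unfolding orthogonal_sum_def scale_lattice_def by fastforce
  then show False using ncon by simp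
qed

text \<open>The same splitting argument with a first summand of dimension 0: \<open>F\<close> would
  vanish on a basis vector, whose norm is 2 or 3.\<close>

lemma N_not_integrable: "\<not> s_integrable 2 N"
proof
  assume "s_integrable 2 N"
  then obtain n K where K: "sublattice n K (Z_lattice n)" and iso: "isometric (scale_lattice (sqrt (real 2)) N) K"
    unfolding s_integrable_def by blast
  let ?s = "sqrt 2 :: real"
  obtain f where bij: "bij_betw f (scale_lattice ?s N) K"
    and fadd: "\<And>x y. x \<in> scale_lattice ?s N \<Longrightarrow> y \<in> scale_lattice ?s N \<Longrightarrow> f (x + y) = f x + f y"
    and fprod: "\<And>x y. x \<in> scale_lattice ?s N \<Longrightarrow> y \<in> scale_lattice ?s N \<Longrightarrow> f x \<bullet> f y = x \<bullet> y"
    using iso unfolding isometric_def by auto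
  have sN: "?s \<cdot>\<^sub>v u \<in> scale_lattice ?s N" if "u \<in> N" for u using that by (auto simp: scale_lattice_def)
  define F where "F u = f (?s \<cdot>\<^sub>v u)" for u
  have FZ: "F u \<in> Z_lattice n" if "u \<in> N" for u
    using bij_betw_apply[OF bij sN[OF that]] K by (auto simp: sublattice_def F_def)
  have Fc: "F u \<in> carrier_vec n" if "u \<in> N" for u using FZ[OF that] by (auto simp: Z_lattice_def)
  have eq: "u \<bullet> v = 0\<^sub>v 0 \<bullet> 0\<^sub>v 0 + (F u \<bullet> F v) / 2" if uv: "u \<in> N" "v \<in> N" for u v
  proof -
    have "u \<in> carrier_vec 16" "v \<in> carrier_vec 16" using uv N_mem by auto
    then show ?thesis using fprod[OF sN[OF uv(1)] sN[OF uv(2)]] by (simp add: F_def)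
  qed
  have n0: "qvec (ns ! 0) \<in> N" using nv_N by simp
  have "F (qvec (ns ! 0)) = 0\<^sub>v n"
  proof (rule no_splitting[of "\<lambda>_. 0\<^sub>v 0" 0, OF _ Fc _ _ _ _ eq n0])
    show "F (u + v) = F u + F v" if "u \<in> N" "v \<in> N" for u v
      using fadd[OF sN[OF that(1)] sN[OF that(2)]] scale_N_add[OF that] by (simp add: F_def)
    show "F u $ i \<in> \<int>" if "u \<in> N" "i < n" for u i using FZ[OF that(1)] that by (auto simp: Z_lattice_def)
  qed auto
  then have "qvec (ns ! 0) \<bullet> qvec (ns ! 0) = 0" using eq[OF n0 n0] by simp
  then show False using basis_norms[of 0] by simp
qed

lemma N_minimal_non_integrable: "minimal_non_s_integrable 16 2 N"
  using N_int_lattice N_not_integrable N_minimal by (simp add: minimal_non_s_integrable_def)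

lemma orth_zspan: "lattice_orth A15_plus (zspan 16 {a, b, c}) = N"
proof
  have S: "{a, b, c} \<subseteq> carrier_vec 16" using abc_mem by auto
  show "lattice_orth A15_plus (zspan 16 {a, b, c}) \<subseteq> N"
    using zspan_incl[of _ "{a, b, c}" 16] by (auto simp: lattice_orth_def orth_abc_def)
  show "N \<subseteq> lattice_orth A15_plus (zspan 16 {a, b, c})"
  proof
    fix u assume u: "u \<in> N"
    then have uc: "u \<in> carrier_vec 16" using N_mem by auto
    have "zspan 16 {a, b, c} \<subseteq> {v \<in> carrier_vec 16. u \<bullet> v = 0}"
      using S u uc by (intro zspan_subset) (auto simp: orth_abc_def scalar_prod_add_distrib[of _ 16])
    then show "u \<in> lattice_orth A15_plus (zspan 16 {a, b, c})"
      using N_mem(1)[OF u] by (auto simp: lattice_orth_def)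
  qed
qed

end

section \<open>The two complements\<close>

text \<open>\<open>L\<close> and \<open>T\<close> record a Gaussian elimination over the integers.
  Comparing diagonal products certifies the determinant without expanding it.\<close>

lemma det_by_elimination:
  fixes L T :: "int list list" and g :: "nat \<Rightarrow> nat \<Rightarrow> int"
  assumes LG: "\<forall>i<n. \<forall>j<n. (\<Sum>k<n. L ! i ! k * g k j) = T ! i ! j"
    and low: "\<forall>j<n. \<forall>i<j. L ! i ! j = 0" and up: "\<forall>i<n. \<forall>j<i. T ! i ! j = 0"
    and diag: "(\<Prod>i<n. L ! i ! i) \<noteq> 0" "(\<Prod>i<n. T ! i ! i) = (\<Prod>i<n. L ! i ! i) * d"
  shows "det (mat n n (\<lambda>(i, j). g i j)) = d"
proof -
  let ?L = "mat n n (\<lambda>(i, j). L ! i ! j)" and ?T = "mat n n (\<lambda>(i, j). T ! i ! j)" and ?G = "mat n n (\<lambda>(i, j). g i j)"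
  have "?L * ?G = ?T"
    using LG by (intro eq_matI) (auto simp: scalar_prod_def atLeast0LessThan)
  then have "det ?L * det ?G = det ?T" using det_mult[of ?L n ?G] by simp
  moreover have "det ?L = (\<Prod>i<n. L ! i ! i)"
    using low by (subst det_lower_triangular[of n]) (auto simp: prod_list_diag_prod atLeast0LessThan)
  moreover have "det ?T = (\<Prod>i<n. T ! i ! i)"
    using up by (subst det_upper_triangular[of _ n]) (auto simp: prod_list_diag_prod atLeast0LessThan upper_triangular_def)
  ultimately show ?thesis using diag by simp
qed

definition cl_one :: "int list" where "cl_one = [-3,1,1,1,1,-3,-3,-3,1,1,1,1,1,1,1,1]"
definition cl_two :: "int list" where "cl_two = [1,1,1,-3,-3,-3,-3,1,1,1,1,1,1,1,1,1]"

text \<open>A certificate may be averaged over permutations inside the cells cut out by a, b, c, so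
  only vectors constant on cells and whole cells are needed. Here the cells are {0}, {1,2}, {3},
  {4}, {5,6,7}, {8..15}, and the two vectors span the plane of cell-constant vectors in the
  complement.\<close>

definition cert_one :: "(int \<times> int list) list" where
  "cert_one = [(36, [24,-8,-8,-8,-8,-8,-8,-8,4,4,4,4,4,4,4,4]), (2, [-24,-24,-24,72,72,8,8,8,-12,-12,-12,-12,-12,-12,-12,-12])]"

definition blocks_one :: "(int \<times> nat list) list" where
  "blocks_one = [(284, [1,2]), (134, [5,6,7]), (- 65, [8,9,10,11,12,13,14,15])]"

text \<open>The cells are now {0,1,2}, {3}, {4}, {5,6}, {7..15}, and cell-constant vectors in the
  complement form a line, spanned by this one.\<close>

definition cert_two :: "(int \<times> int list) list" where
  "cert_two = [(2, [-12,-12,-12,36,36,-36,-36,4,4,4,4,4,4,4,4,4])]"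

definition blocks_two :: "(int \<times> nat list) list" where
  "blocks_two = [(24, [0,1,2]), (- 8, [7,8,9,10,11,12,13,14,15])]"

text \<open>Roots inside cells give rank 10; the norm 3 vectors of the foursets {0,8,9,10} and
  {1,5,8,9} supply the rest and connect the cells.\<close>

definition basis_one :: "int list list" where
  "basis_one = [[0, 0, 0, 0, 0, 0, 0, 0, 4, -4, 0, 0, 0, 0, 0, 0],
   [0, 0, 0, 0, 0, 0, 0, 0, 0, 4, -4, 0, 0, 0, 0, 0],
   [0, 0, 0, 0, 0, 0, 0, 0, 0, 0, 4, -4, 0, 0, 0, 0],
   [0, 0, 0, 0, 0, 0, 0, 0, 0, 0, 0, 4, -4, 0, 0, 0],
   [0, 0, 0, 0, 0, 0, 0, 0, 0, 0, 0, 0, 4, -4, 0, 0],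
   [0, 0, 0, 0, 0, 0, 0, 0, 0, 0, 0, 0, 0, 4, -4, 0],
   [0, 0, 0, 0, 0, 0, 0, 0, 0, 0, 0, 0, 0, 0, 4, -4],
   [-3, 1, 1, 1, 1, 1, 1, 1, -3, -3, -3, 1, 1, 1, 1, 1],
   [1, -3, 1, 1, 1, -3, 1, 1, -3, -3, 1, 1, 1, 1, 1, 1],
   [0, 4, -4, 0, 0, 0, 0, 0, 0, 0, 0, 0, 0, 0, 0, 0],
   [0, 0, 0, 0, 0, 4, -4, 0, 0, 0, 0, 0, 0, 0, 0, 0],
   [0, 0, 0, 0, 0, 0, 4, -4, 0, 0, 0, 0, 0, 0, 0, 0]]"

definition dual_one :: "int list list" where
  "dual_one = [[-1, -1, -1, 3, 7, -1, -1, -1, 3, -1, -1, -1, -1, -1, -1, -1],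
   [1, -3, -3, 9, 9, 1, 1, 1, 1, 1, -3, -3, -3, -3, -3, -3],
   [-3, -3, -3, 9, 9, 1, 1, 1, 1, 1, 1, -3, -3, -3, -3, -3],
   [-3, -3, -3, 5, 9, 1, 1, 1, 1, 1, 1, 1, -3, -3, -3, -3],
   [-3, -3, -3, 5, 5, 1, 1, 1, 1, 1, 1, 1, 1, -3, -3, -3],
   [0, 0, 0, 4, 4, 0, 0, 0, 0, 0, 0, 0, 0, 0, -4, -4],
   [0, 0, 0, 0, 4, 0, 0, 0, 0, 0, 0, 0, 0, 0, 0, -4],
   [-4, 0, 0, 0, 4, 0, 0, 0, 0, 0, 0, 0, 0, 0, 0, 0],
   [0, -4, -4, 4, 4, 0, 0, 0, 0, 0, 0, 0, 0, 0, 0, 0],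
   [0, 0, -4, 0, 4, 0, 0, 0, 0, 0, 0, 0, 0, 0, 0, 0],
   [3, -1, -1, 3, 3, 3, -1, -1, -1, -1, -1, -1, -1, -1, -1, -1],
   [0, 0, 0, 0, 4, 0, 0, -4, 0, 0, 0, 0, 0, 0, 0, 0]]"

definition corr_one :: "(int \<times> int \<times> int) list" where
  "corr_one = [(1, -2, 0),
   (-3, 2, 0),
   (1, -2, 0),
   (-3, 2, 0),
   (1, -2, 0),
   (1, 2, 0),
   (-3, 2, -4),
   (1, -2, 0),
   (1, 2, 0),
   (5, -2, 4),
   (1, -2, 0),
   (-3, 2, 0),
   (1, -2, 0),
   (1, 2, 0),
   (-3, 2, 0),
   (1, -2, 0)]"

text \<open>\<open>elim\<close> times the Gram matrix of \<open>basis\<close> is \<open>triang\<close>.\<close>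

definition elim_one :: "int list list" where
  "elim_one = [[1, 0, 0, 0, 0, 0, 0, 0, 0, 0, 0, 0],
   [1, 2, 0, 0, 0, 0, 0, 0, 0, 0, 0, 0],
   [1, 2, 3, 0, 0, 0, 0, 0, 0, 0, 0, 0],
   [1, 2, 3, 4, 0, 0, 0, 0, 0, 0, 0, 0],
   [1, 2, 3, 4, 5, 0, 0, 0, 0, 0, 0, 0],
   [1, 2, 3, 4, 5, 6, 0, 0, 0, 0, 0, 0],
   [1, 2, 3, 4, 5, 6, 7, 0, 0, 0, 0, 0],
   [5, 10, 15, 12, 9, 6, 3, 8, 0, 0, 0, 0],
   [8, 16, 15, 12, 9, 6, 3, 2, 9, 0, 0, 0],
   [8, 16, 15, 12, 9, 6, 3, 2, 9, 13, 0, 0],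
   [16, 32, 30, 24, 18, 12, 6, 4, 18, 9, 17, 0],
   [16, 32, 30, 24, 18, 12, 6, 4, 18, 9, 17, 16]]"

definition triang_one :: "int list list" where
  "triang_one = [[2, -1, 0, 0, 0, 0, 0, 0, 0, 0, 0, 0],
   [0, 3, -2, 0, 0, 0, 0, 0, -2, 0, 0, 0],
   [0, 0, 4, -3, 0, 0, 0, -3, -2, 0, 0, 0],
   [0, 0, 0, 5, -4, 0, 0, -3, -2, 0, 0, 0],
   [0, 0, 0, 0, 6, -5, 0, -3, -2, 0, 0, 0],
   [0, 0, 0, 0, 0, 7, -6, -3, -2, 0, 0, 0],
   [0, 0, 0, 0, 0, 0, 8, -3, -2, 0, 0, 0],
   [0, 0, 0, 0, 0, 0, 0, 9, -2, 0, 0, 0],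
   [0, 0, 0, 0, 0, 0, 0, 0, 13, -9, -9, 0],
   [0, 0, 0, 0, 0, 0, 0, 0, 0, 17, -9, 0],
   [0, 0, 0, 0, 0, 0, 0, 0, 0, 0, 16, -17],
   [0, 0, 0, 0, 0, 0, 0, 0, 0, 0, 0, 15]]"

text \<open>Roots inside cells give rank 11, so one norm 3 vector, of the fourset {0,5,7,8},
  suffices.\<close>

definition basis_two :: "int list list" where
  "basis_two = [[0, 0, 0, 0, 0, 0, 0, 4, -4, 0, 0, 0, 0, 0, 0, 0],
   [0, 0, 0, 0, 0, 0, 0, 0, 4, -4, 0, 0, 0, 0, 0, 0],
   [0, 0, 0, 0, 0, 0, 0, 0, 0, 4, -4, 0, 0, 0, 0, 0],
   [0, 0, 0, 0, 0, 0, 0, 0, 0, 0, 4, -4, 0, 0, 0, 0],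
   [0, 0, 0, 0, 0, 0, 0, 0, 0, 0, 0, 4, -4, 0, 0, 0],
   [0, 0, 0, 0, 0, 0, 0, 0, 0, 0, 0, 0, 4, -4, 0, 0],
   [0, 0, 0, 0, 0, 0, 0, 0, 0, 0, 0, 0, 0, 4, -4, 0],
   [0, 0, 0, 0, 0, 0, 0, 0, 0, 0, 0, 0, 0, 0, 4, -4],
   [-3, 1, 1, 1, 1, -3, 1, -3, -3, 1, 1, 1, 1, 1, 1, 1],
   [4, -4, 0, 0, 0, 0, 0, 0, 0, 0, 0, 0, 0, 0, 0, 0],
   [0, 4, -4, 0, 0, 0, 0, 0, 0, 0, 0, 0, 0, 0, 0, 0],
   [0, 0, 0, 0, 0, 4, -4, 0, 0, 0, 0, 0, 0, 0, 0, 0]]"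

definition dual_two :: "int list list" where
  "dual_two = [[0, 0, 0, 0, 4, -4, -4, 4, 0, 0, 0, 0, 0, 0, 0, 0],
   [-7, -7, -7, 9, 21, 5, 5, 1, 1, -3, -3, -3, -3, -3, -3, -3],
   [-2, -2, -2, 6, 10, -2, -2, 2, 2, 2, -2, -2, -2, -2, -2, -2],
   [-3, -3, -3, 9, 9, 1, 1, 1, 1, 1, 1, -3, -3, -3, -3, -3],
   [-2, -2, -2, 2, 6, -2, -2, 2, 2, 2, 2, 2, -2, -2, -2, -2],
   [-3, -3, -3, 5, 5, 1, 1, 1, 1, 1, 1, 1, 1, -3, -3, -3],
   [1, 1, 1, 1, 1, -3, -3, 1, 1, 1, 1, 1, 1, 1, -3, -3],
   [0, 0, 0, 0, 4, 0, 0, 0, 0, 0, 0, 0, 0, 0, 0, -4],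
   [0, 0, 0, 4, 4, -4, -4, 0, 0, 0, 0, 0, 0, 0, 0, 0],
   [1, -3, -3, 1, 1, -3, -3, 1, 1, 1, 1, 1, 1, 1, 1, 1],
   [0, 0, -4, 0, 4, 0, 0, 0, 0, 0, 0, 0, 0, 0, 0, 0],
   [0, 0, 0, 0, 4, 0, -4, 0, 0, 0, 0, 0, 0, 0, 0, 0]]"

definition corr_two :: "(int \<times> int \<times> int) list" where
  "corr_two = [(-2, -2, -1),
   (-2, 2, 3),
   (2, -2, -1),
   (-2, 2, -1),
   (2, -2, -1),
   (-2, 2, -1),
   (2, -2, -1),
   (-2, 2, -1),
   (-6, 2, 15),
   (6, -2, -9),
   (2, -2, 3),
   (-2, 2, -5),
   (2, -2, 3),
   (2, 2, -5),
   (-2, 2, 3),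
   (2, -2, -1)]"

definition elim_two :: "int list list" where
  "elim_two = [[1, 0, 0, 0, 0, 0, 0, 0, 0, 0, 0, 0],
   [1, 2, 0, 0, 0, 0, 0, 0, 0, 0, 0, 0],
   [1, 2, 3, 0, 0, 0, 0, 0, 0, 0, 0, 0],
   [1, 2, 3, 4, 0, 0, 0, 0, 0, 0, 0, 0],
   [1, 2, 3, 4, 5, 0, 0, 0, 0, 0, 0, 0],
   [1, 2, 3, 4, 5, 6, 0, 0, 0, 0, 0, 0],
   [1, 2, 3, 4, 5, 6, 7, 0, 0, 0, 0, 0],
   [1, 2, 3, 4, 5, 6, 7, 8, 0, 0, 0, 0],
   [7, 14, 12, 10, 8, 6, 4, 2, 9, 0, 0, 0],
   [7, 14, 12, 10, 8, 6, 4, 2, 9, 13, 0, 0],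
   [7, 14, 12, 10, 8, 6, 4, 2, 9, 13, 17, 0],
   [7, 14, 12, 10, 8, 6, 4, 2, 9, 6, 3, 7]]"

definition triang_two :: "int list list" where
  "triang_two = [[2, -1, 0, 0, 0, 0, 0, 0, 0, 0, 0, 0],
   [0, 3, -2, 0, 0, 0, 0, 0, -2, 0, 0, 0],
   [0, 0, 4, -3, 0, 0, 0, 0, -2, 0, 0, 0],
   [0, 0, 0, 5, -4, 0, 0, 0, -2, 0, 0, 0],
   [0, 0, 0, 0, 6, -5, 0, 0, -2, 0, 0, 0],
   [0, 0, 0, 0, 0, 7, -6, 0, -2, 0, 0, 0],
   [0, 0, 0, 0, 0, 0, 8, -7, -2, 0, 0, 0],
   [0, 0, 0, 0, 0, 0, 0, 9, -2, 0, 0, 0],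
   [0, 0, 0, 0, 0, 0, 0, 0, 13, -9, 0, -9],
   [0, 0, 0, 0, 0, 0, 0, 0, 0, 17, -13, -9],
   [0, 0, 0, 0, 0, 0, 0, 0, 0, 0, 21, -9],
   [0, 0, 0, 0, 0, 0, 0, 0, 0, 0, 0, 5]]"


lemma A15_complement_one: "A15_complement cl_one basis_one dual_one corr_one 8 cert_one blocks_one"
  by (unfold_locales; code_simp)

lemma A15_complement_two: "A15_complement cl_two basis_two dual_two corr_two 7 cert_two blocks_two"
  by (unfold_locales; code_simp)

lemma det_one: "det (mat 12 12 (\<lambda>(i, j). idot (basis_one ! i) (basis_one ! j) div 16)) = 15"
  by (rule det_by_elimination[where L = elim_one and T = triang_one]; code_simp)

lemma det_two: "det (mat 12 12 (\<lambda>(i, j). idot (basis_two ! i) (basis_two ! j) div 16)) = 15"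
  by (rule det_by_elimination[where L = elim_two and T = triang_two]; code_simp)

section \<open>Orbits of sublattices\<close>

definition norm2_pairs :: "int list \<Rightarrow> (nat \<times> nat) list" where
  "norm2_pairs cl = filter (\<lambda>(p, q). p \<noteq> q \<and> al ! p = al ! q \<and> bl ! p = bl ! q \<and> cl ! p = cl ! q)
     (List.product [0..<16] [0..<16])"

context A15_complement
begin

text \<open>The norm 2 vectors of \<open>A15_plus\<close> are the roots, and a root is orthogonal to
  a, b, c exactly when its two indices lie in one cell.\<close>

lemma card_norm_2: "card {u \<in> N. u \<bullet> u = 2} = length (norm2_pairs cl)"
proof -
  let ?S = "set (norm2_pairs cl)"
  have S: "(p, q) \<in> ?S \<longleftrightarrow> p < 16 \<and> q < 16 \<and> p \<noteq> q \<and> al ! p = al ! q \<and> bl ! p = bl ! q \<and> cl ! p = cl ! q" for p q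
    by (auto simp: norm2_pairs_def)
  have rt: "A_root p q $ i = of_bool (i = p) - of_bool (i = q)" if "p < 16" "q < 16" "i < 16" for p q i
    using that by (auto simp: A_root_def)
  have "{u \<in> N. u \<bullet> u = 2} = (\<lambda>(p, q). A_root p q) ` ?S"
  proof (intro subset_antisym subsetI)
    fix u assume u: "u \<in> {u \<in> N. u \<bullet> u = 2}"
    then have uN: "u \<in> N" and u2: "u \<bullet> u = 2" by auto
    then have uA: "u \<in> A15_plus" using N_mem by simp
    have "u \<noteq> 0\<^sub>v 16" using u2 by auto
    then obtain p q where pq: "p < 16" "q < 16" "p \<noteq> q" "u = A_root p q"
      using A15_plus_norm_less_3[OF uA] u2 by auto
    have "qvec xs $ p = qvec xs $ q" if "length xs = 16" "u \<bullet> qvec xs = 0" for xs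
    proof -
      have c: "qvec xs \<in> carrier_vec 16" using that(1) by (simp add: qvec_def)
      have "u \<bullet> qvec xs = qvec xs \<bullet> u" by (rule comm_scalar_prod[of _ 16]) (use c uA in auto)
      then show ?thesis using that(2) scalar_prod_root[OF c pq(1,2)] pq(4) by simp
    qed
    then have "al ! p = al ! q \<and> bl ! p = bl ! q \<and> cl ! p = cl ! q"
      using uN lengths pq by (simp add: orth_abc_def qvec_def)
    then show "u \<in> (\<lambda>(p, q). A_root p q) ` ?S" using pq S by (intro image_eqI[of _ _ "(p, q)"]) auto
  next
    fix u assume "u \<in> (\<lambda>(p, q). A_root p q) ` ?S"
    then obtain p q where pq: "(p, q) \<in> ?S" "u = A_root p q" by auto
    then show "u \<in> {u \<in> N. u \<bullet> u = 2}" using S N_rootI[of p q] A_root_norm[of p q] by auto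
  qed
  moreover have "inj_on (\<lambda>(p, q). A_root p q) ?S"
  proof (rule inj_onI)
    fix x y assume xy: "x \<in> ?S" "y \<in> ?S" "(\<lambda>(p, q). A_root p q) x = (\<lambda>(p, q). A_root p q) y"
    obtain p q p' q' where [simp]: "x = (p, q)" "y = (p', q')" by (cases x, cases y) auto
    have pq: "p < 16" "q < 16" "p \<noteq> q" "p' < 16" "q' < 16" "p' \<noteq> q'" using xy S by auto
    have "A_root p q $ p = A_root p' q' $ p" "A_root p q $ q = A_root p' q' $ q" using xy by auto
    then show "x = y" using pq by (auto simp: rt of_bool_def split: if_splits)
  qed
  ultimately have "card {u \<in> N. u \<bullet> u = 2} = card ?S" by (simp add: card_image)
  also have "\<dots> = length (norm2_pairs cl)"
    by (rule distinct_card) (simp add: norm2_pairs_def distinct_product)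
  finally show ?thesis .
qed

end

lemma isometric_card_norm:
  assumes "isometric L M"
  shows "card {x \<in> L. x \<bullet> x = r} = card {x \<in> M. x \<bullet> x = r}"
proof -
  obtain f where f: "bij_betw f L M" "\<And>x. x \<in> L \<Longrightarrow> f x \<bullet> f x = x \<bullet> x"
    using assms unfolding isometric_def by blast
  have "bij_betw f {x \<in> L. x \<bullet> x = r} {x \<in> M. x \<bullet> x = r}"
  proof (rule bij_betw_imageI)
    show "inj_on f {x \<in> L. x \<bullet> x = r}"
      using bij_betw_imp_inj_on[OF f(1)] by (rule inj_on_subset) auto
    show "f ` {x \<in> L. x \<bullet> x = r} = {x \<in> M. x \<bullet> x = r}"
      using bij_betw_imp_surj_on[OF f(1)] f(2) by auto
  qed
  then show ?thesis by (rule bij_betw_same_card)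
qed

text \<open>Cells of sizes 2, 3, 8 yield 2 + 6 + 56 = 64 roots, and cells of sizes 3, 2, 9 yield 6 +
  2 + 72 = 80.\<close>

lemma complements_not_isometric: "\<not> isometric (orth_abc cl_one) (orth_abc cl_two)"
proof
  assume "isometric (orth_abc cl_one) (orth_abc cl_two)"
  then have "length (norm2_pairs cl_one) = length (norm2_pairs cl_two)"
    unfolding A15_complement.card_norm_2[OF A15_complement_one, symmetric]
      A15_complement.card_norm_2[OF A15_complement_two, symmetric] by (rule isometric_card_norm)
  moreover have "length (norm2_pairs cl_one) = 64" by code_simp
  moreover have "length (norm2_pairs cl_two) = 80" by code_simp
  ultimately show False by simp
qed

section \<open>Orthogonal matrices acting on spans, orbits and complements\<close>

lemma zspan_mono:
  assumes "S \<subseteq> carrier_vec n" "T \<subseteq> carrier_vec n" "S \<subseteq> zspan n T"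
  shows "zspan n S \<subseteq> zspan n T"
  using assms zspan_zero zspan_add zspan_uminus[OF assms(2)] by (intro zspan_subset) auto

lemma zspan_signs:
  fixes r s t :: real
  assumes "x \<in> carrier_vec n" "y \<in> carrier_vec n" "z \<in> carrier_vec n"
    and "r = 1 \<or> r = -1" "s = 1 \<or> s = -1" "t = 1 \<or> t = -1"
  shows "zspan n {r \<cdot>\<^sub>v x, s \<cdot>\<^sub>v y, t \<cdot>\<^sub>v z} = zspan n {x, y, z}"
proof
  have sm: "r \<cdot>\<^sub>v v \<in> zspan n S" if "S \<subseteq> carrier_vec n" "v \<in> zspan n S" "r = 1 \<or> r = -1" for r :: real and v S
  proof -
    have "\<exists>k :: int. r = of_int k" using that(3) by (metis of_int_1 of_int_minus)
    then show ?thesis using zspan_smult[OF that(1,2)] by auto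
  qed
  have invol: "r \<cdot>\<^sub>v (r \<cdot>\<^sub>v v) = v" if "r = 1 \<or> r = -1" for r :: real and v :: "real vec"
    using that by (intro eq_vecI) auto
  let ?T = "{r \<cdot>\<^sub>v x, s \<cdot>\<^sub>v y, t \<cdot>\<^sub>v z}"
  have S: "{x, y, z} \<subseteq> carrier_vec n" "?T \<subseteq> carrier_vec n" using assms by auto
  have "r \<cdot>\<^sub>v x \<in> zspan n {x, y, z}" "s \<cdot>\<^sub>v y \<in> zspan n {x, y, z}" "t \<cdot>\<^sub>v z \<in> zspan n {x, y, z}"
    using sm[OF S(1) zspan_incl assms(4), of x] sm[OF S(1) zspan_incl assms(5), of y] sm[OF S(1) zspan_incl assms(6), of z]
    by simp_all
  then show "zspan n ?T \<subseteq> zspan n {x, y, z}" by (intro zspan_mono[OF S(2,1)]) simp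
  have "r \<cdot>\<^sub>v (r \<cdot>\<^sub>v x) \<in> zspan n ?T" "s \<cdot>\<^sub>v (s \<cdot>\<^sub>v y) \<in> zspan n ?T" "t \<cdot>\<^sub>v (t \<cdot>\<^sub>v z) \<in> zspan n ?T"
    using sm[OF S(2) zspan_incl assms(4), of "r \<cdot>\<^sub>v x"] sm[OF S(2) zspan_incl assms(5), of "s \<cdot>\<^sub>v y"]
      sm[OF S(2) zspan_incl assms(6), of "t \<cdot>\<^sub>v z"] by simp_all
  then show "zspan n {x, y, z} \<subseteq> zspan n ?T"
    by (intro zspan_mono[OF S]) (simp add: invol[OF assms(4)] invol[OF assms(5)] invol[OF assms(6)])
qed

lemma mat_action_zspan:
  assumes P: "P \<in> carrier_mat n n" and S: "S \<subseteq> carrier_vec n"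
  shows "mat_action P (zspan n S) = zspan n ((\<lambda>x. P *\<^sub>v x) ` S)"
proof
  let ?T = "(\<lambda>x. P *\<^sub>v x) ` S"
  have T: "?T \<subseteq> carrier_vec n" using P S by auto
  have "zspan n S \<subseteq> {x \<in> carrier_vec n. P *\<^sub>v x \<in> zspan n ?T}"
  proof (rule zspan_subset[OF S])
    show "S \<subseteq> {x \<in> carrier_vec n. P *\<^sub>v x \<in> zspan n ?T}" using S by (auto intro: zspan_incl)
    have "P *\<^sub>v 0\<^sub>v n = 0\<^sub>v n" using P by (intro eq_vecI) (auto simp: scalar_prod_def)
    then show "0\<^sub>v n \<in> {x \<in> carrier_vec n. P *\<^sub>v x \<in> zspan n ?T}" by (simp add: zspan_zero)
  next
    fix x y assume "x \<in> {x \<in> carrier_vec n. P *\<^sub>v x \<in> zspan n ?T}" "y \<in> {x \<in> carrier_vec n. P *\<^sub>v x \<in> zspan n ?T}"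
    then show "x + y \<in> {x \<in> carrier_vec n. P *\<^sub>v x \<in> zspan n ?T}"
      using mult_add_distrib_mat_vec[OF P, of x y] by (auto intro: zspan_add)
  next
    fix x assume x: "x \<in> {x \<in> carrier_vec n. P *\<^sub>v x \<in> zspan n ?T}"
    then have "P *\<^sub>v (- x) = - (P *\<^sub>v x)" using P by (intro eq_vecI) auto
    then show "- x \<in> {x \<in> carrier_vec n. P *\<^sub>v x \<in> zspan n ?T}" using x zspan_uminus[OF T] by auto
  qed
  then show "mat_action P (zspan n S) \<subseteq> zspan n ?T" by (auto simp: mat_action_def)
  have Sc: "zspan n S \<subseteq> carrier_vec n" using zspan_carrier[OF S] .
  show "zspan n ?T \<subseteq> mat_action P (zspan n S)"
  proof (rule zspan_subset[OF T])
    show "?T \<subseteq> mat_action P (zspan n S)" by (auto simp: mat_action_def intro: zspan_incl)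
    have "P *\<^sub>v 0\<^sub>v n = 0\<^sub>v n" using P by (intro eq_vecI) (auto simp: scalar_prod_def)
    then show "0\<^sub>v n \<in> mat_action P (zspan n S)" unfolding mat_action_def using zspan_zero[of n S] by (metis imageI)
  next
    fix x y assume "x \<in> mat_action P (zspan n S)" "y \<in> mat_action P (zspan n S)"
    then obtain x' y' where *: "x' \<in> zspan n S" "y' \<in> zspan n S" "x = P *\<^sub>v x'" "y = P *\<^sub>v y'"
      by (auto simp: mat_action_def)
    moreover have "x' \<in> carrier_vec n" "y' \<in> carrier_vec n" using * Sc by auto
    ultimately have "x + y = P *\<^sub>v (x' + y')" using mult_add_distrib_mat_vec[OF P, of x' y'] by simp
    then show "x + y \<in> mat_action P (zspan n S)" using * zspan_add by (auto simp: mat_action_def)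
  next
    fix x assume "x \<in> mat_action P (zspan n S)"
    then obtain x' where *: "x' \<in> zspan n S" "x = P *\<^sub>v x'" by (auto simp: mat_action_def)
    then have "- x = P *\<^sub>v (- x')" using P Sc by (intro eq_vecI) auto
    then show "- x \<in> mat_action P (zspan n S)" using * zspan_uminus[OF S] by (auto simp: mat_action_def)
  qed
qed

lemma mat_action_mult:
  assumes "P \<in> carrier_mat n n" "Q \<in> carrier_mat n n" "M \<subseteq> carrier_vec n"
  shows "mat_action (P * Q) M = mat_action P (mat_action Q M)"
proof -
  have "(P * Q) *\<^sub>v x = P *\<^sub>v (Q *\<^sub>v x)" if "x \<in> M" for x
    using assms that by (intro assoc_mult_mat_vec[of _ n n _ n]) auto
  then show ?thesis unfolding mat_action_def image_image by (intro image_cong) auto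
qed

lemma mat_action_one: "M \<subseteq> carrier_vec n \<Longrightarrow> mat_action (1\<^sub>m n) M = M"
proof -
  assume "M \<subseteq> carrier_vec n"
  then have "(\<lambda>x. 1\<^sub>m n *\<^sub>v x) ` M = (\<lambda>x. x) ` M" by (intro image_cong) auto
  then show ?thesis by (simp add: mat_action_def)
qed

lemma lattice_Aut_iff:
  "P \<in> carrier (lattice_Aut n L) \<longleftrightarrow> P \<in> carrier_mat n n \<and> P\<^sup>T * P = 1\<^sub>m n \<and> mat_action P L = L"
  by (simp add: lattice_Aut_def mat_action_def)

lemma lattice_Aut_mult:
  assumes "L \<subseteq> carrier_vec n" "P \<in> carrier (lattice_Aut n L)" "Q \<in> carrier (lattice_Aut n L)"
  shows "P * Q \<in> carrier (lattice_Aut n L)"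
proof -
  have P: "P \<in> carrier_mat n n" "P\<^sup>T * P = 1\<^sub>m n" "mat_action P L = L"
    and Q: "Q \<in> carrier_mat n n" "Q\<^sup>T * Q = 1\<^sub>m n" "mat_action Q L = L"
    using assms by (auto simp: lattice_Aut_iff)
  have "(P * Q)\<^sup>T * (P * Q) = (Q\<^sup>T * P\<^sup>T) * (P * Q)" using P Q by (simp add: transpose_mult)
  also have "\<dots> = Q\<^sup>T * (P\<^sup>T * P * Q)"
    using P(1) Q(1) by (simp add: assoc_mult_mat[of _ n n _ n _ n])
  also have "\<dots> = 1\<^sub>m n" using P Q by simp
  finally show ?thesis
    using P Q assms(1) mat_action_mult[OF P(1) Q(1) assms(1)] by (simp add: lattice_Aut_iff)
qed

lemma lattice_Aut_transpose:
  assumes "L \<subseteq> carrier_vec n" "P \<in> carrier (lattice_Aut n L)"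
  shows "P\<^sup>T \<in> carrier (lattice_Aut n L)" "P * P\<^sup>T = 1\<^sub>m n"
proof -
  have P: "P \<in> carrier_mat n n" "P\<^sup>T * P = 1\<^sub>m n" "mat_action P L = L"
    using assms by (auto simp: lattice_Aut_iff)
  show PP: "P * P\<^sup>T = 1\<^sub>m n" using mat_mult_left_right_inverse[of "P\<^sup>T" n P] P by simp
  have "mat_action P\<^sup>T L = mat_action P\<^sup>T (mat_action P L)" using P(3) by simp
  also have "\<dots> = L" using mat_action_mult[of "P\<^sup>T" n P L] P assms(1) mat_action_one by simp
  finally show "P\<^sup>T \<in> carrier (lattice_Aut n L)" using P(1) PP by (simp add: lattice_Aut_iff)
qed

text \<open>The inverse of \<open>P\<close> is its transpose, again an automorphism, so each
  inclusion is a composition.\<close>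

lemma orbit_eq:
  assumes L: "L \<subseteq> carrier_vec n" and P: "P \<in> carrier (lattice_Aut n L)" and M: "M \<subseteq> carrier_vec n"
  shows "orbit (lattice_Aut n L) mat_action (mat_action P M) = orbit (lattice_Aut n L) mat_action M"
proof -
  have Pc: "P \<in> carrier_mat n n" using P by (simp add: lattice_Aut_iff)
  show ?thesis unfolding orbit_def
  proof (intro subset_antisym subsetI)
    fix X assume "X \<in> {mat_action g (mat_action P M) | g. g \<in> carrier (lattice_Aut n L)}"
    then obtain g where g: "g \<in> carrier (lattice_Aut n L)" "X = mat_action g (mat_action P M)" by blast
    then have "X = mat_action (g * P) M" using mat_action_mult[OF _ Pc M] by (simp add: lattice_Aut_iff)
    then show "X \<in> {mat_action g M | g. g \<in> carrier (lattice_Aut n L)}"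
      using lattice_Aut_mult[OF L g(1) P] by blast
  next
    fix X assume "X \<in> {mat_action g M | g. g \<in> carrier (lattice_Aut n L)}"
    then obtain g where g: "g \<in> carrier (lattice_Aut n L)" "X = mat_action g M" by blast
    have gc: "g \<in> carrier_mat n n" using g by (simp add: lattice_Aut_iff)
    have Ptc: "P\<^sup>T \<in> carrier_mat n n" using Pc by simp
    have PM: "mat_action P M \<subseteq> carrier_vec n" using Pc M by (auto simp: mat_action_def)
    have "mat_action P\<^sup>T (mat_action P M) = M"
      using mat_action_mult[OF Ptc Pc M] P mat_action_one[OF M] by (simp add: lattice_Aut_iff)
    then have "X = mat_action (g * P\<^sup>T) (mat_action P M)"
      using g(2) mat_action_mult[OF gc Ptc PM] by simp
    then show "X \<in> {mat_action g (mat_action P M) | g. g \<in> carrier (lattice_Aut n L)}"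
      using lattice_Aut_mult[OF L g(1) lattice_Aut_transpose(1)[OF L P]] by blast
  qed
qed

text \<open>This separates the two orbits: an automorphism carrying one sublattice to the other
  would make their complements isometric.\<close>

lemma orth_isometric:
  assumes L: "L \<subseteq> carrier_vec n" and P: "P \<in> carrier (lattice_Aut n L)" and M: "M \<subseteq> carrier_vec n"
  shows "isometric (lattice_orth L M) (lattice_orth L (mat_action P M))"
proof -
  have Pc: "P \<in> carrier_mat n n" and PP: "P\<^sup>T * P = 1\<^sub>m n" and PL: "mat_action P L = L"
    using P by (auto simp: lattice_Aut_iff)
  have prod: "(P *\<^sub>v x) \<bullet> (P *\<^sub>v y) = x \<bullet> y" if x: "x \<in> carrier_vec n" and y: "y \<in> carrier_vec n" for x y
  proof -
    have "(P *\<^sub>v x) \<bullet> (P *\<^sub>v y) = (P\<^sup>T *\<^sub>v (P *\<^sub>v x)) \<bullet> y"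
      using transpose_vec_mult_scalar[of P n n y "P *\<^sub>v x"] Pc x y by simp
    also have "P\<^sup>T *\<^sub>v (P *\<^sub>v x) = (P\<^sup>T * P) *\<^sub>v x"
      using Pc x by (intro assoc_mult_mat_vec[symmetric, of _ n n _ n]) auto
    finally show ?thesis using PP x by simp
  qed
  have inj: "inj_on (\<lambda>x. P *\<^sub>v x) (carrier_vec n)"
  proof (rule inj_onI)
    fix x y assume xy: "x \<in> carrier_vec n" "y \<in> carrier_vec n" "P *\<^sub>v x = P *\<^sub>v y"
    have "z = P\<^sup>T *\<^sub>v (P *\<^sub>v z)" if "z \<in> carrier_vec n" for z
      using assoc_mult_mat_vec[of "P\<^sup>T" n n P n z] Pc PP that by simp
    then show "x = y" using xy by metis
  qed
  have "bij_betw (\<lambda>x. P *\<^sub>v x) (lattice_orth L M) (lattice_orth L (mat_action P M))"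
  proof (rule bij_betw_imageI)
    show "inj_on (\<lambda>x. P *\<^sub>v x) (lattice_orth L M)"
      using inj by (rule inj_on_subset) (use L in \<open>auto simp: lattice_orth_def\<close>)
    show "(\<lambda>x. P *\<^sub>v x) ` lattice_orth L M = lattice_orth L (mat_action P M)"
    proof (intro subset_antisym subsetI)
      fix y assume "y \<in> (\<lambda>x. P *\<^sub>v x) ` lattice_orth L M"
      then obtain x where x: "x \<in> L" "\<forall>v\<in>M. x \<bullet> v = 0" "y = P *\<^sub>v x" by (auto simp: lattice_orth_def)
      have "y \<in> L" using PL x by (auto simp: mat_action_def)
      then show "y \<in> lattice_orth L (mat_action P M)"
        using x prod L M by (auto simp: lattice_orth_def mat_action_def subset_iff)
    next
      fix y assume y: "y \<in> lattice_orth L (mat_action P M)"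
      then have "y \<in> mat_action P L" using PL by (auto simp: lattice_orth_def)
      then obtain x where x: "x \<in> L" "y = P *\<^sub>v x" by (auto simp: mat_action_def)
      have "x \<bullet> v = 0" if "v \<in> M" for v
        using y x prod[of x v] L M that by (auto simp: lattice_orth_def mat_action_def subset_iff)
      then show "y \<in> (\<lambda>x. P *\<^sub>v x) ` lattice_orth L M" using x by (auto simp: lattice_orth_def)
    qed
  qed
  moreover have "\<forall>x\<in>lattice_orth L M. \<forall>y\<in>lattice_orth L M. P *\<^sub>v (x + y) = P *\<^sub>v x + P *\<^sub>v y"
    using mult_add_distrib_mat_vec[OF Pc] L by (auto simp: lattice_orth_def)
  moreover have "\<forall>x\<in>lattice_orth L M. \<forall>y\<in>lattice_orth L M. (P *\<^sub>v x) \<bullet> (P *\<^sub>v y) = x \<bullet> y"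
    using prod L by (auto simp: lattice_orth_def)
  ultimately show ?thesis unfolding isometric_def by blast
qed

section \<open>Coordinate permutations as automorphisms\<close>

definition perm_mat :: "(nat \<Rightarrow> nat) \<Rightarrow> real mat" where
  "perm_mat \<pi> = mat 16 16 (\<lambda>(i, j). of_bool (j = \<pi> i))"

lemma perm_mat_mult_vec:
  assumes "\<pi> permutes {..<16}" "x \<in> carrier_vec 16"
  shows "perm_mat \<pi> *\<^sub>v x = vec 16 (\<lambda>i. x $ \<pi> i)"
proof (rule eq_vecI)
  fix i assume "i < dim_vec (vec 16 (\<lambda>i. x $ \<pi> i))"
  then have i: "i < 16" by simp
  have \<pi>i: "\<pi> i < 16" using permutes_in_image[OF assms(1), of i] i by simp
  have "(perm_mat \<pi> *\<^sub>v x) $ i = (\<Sum>j<16. of_bool (j = \<pi> i) * x $ j)"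
    using i assms(2) by (simp add: perm_mat_def scalar_prod_def atLeast0LessThan)
  also have "\<dots> = (\<Sum>j<16. if j = \<pi> i then x $ j else 0)" by (intro sum.cong) auto
  also have "\<dots> = x $ \<pi> i" using \<pi>i by simp
  finally show "(perm_mat \<pi> *\<^sub>v x) $ i = vec 16 (\<lambda>i. x $ \<pi> i) $ i" using i by simp
qed (simp add: perm_mat_def)

lemma perm_mat_A15_plus:
  assumes \<pi>: "\<pi> permutes {..<16}" and x: "x \<in> A15_plus"
  shows "perm_mat \<pi> *\<^sub>v x \<in> A15_plus"
proof -
  obtain k z where kz: "x \<in> carrier_vec 16" "(\<Sum>i<16. x $ i) = 0" "\<And>i. i < 16 \<Longrightarrow> x $ i = of_int k / 4 + of_int (z i)"
    using x by (rule A15_plusE) (rule that)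
  have pi: "\<pi> i < 16" if "i < 16" for i using permutes_in_image[OF \<pi>, of i] that by simp
  have "(\<Sum>i<16. x $ \<pi> i) = (\<Sum>i<16. x $ i)"
    using sum.permute[OF \<pi>, of "\<lambda>i. x $ i"] by (simp add: o_def)
  then show ?thesis unfolding perm_mat_mult_vec[OF \<pi> kz(1)]
    using kz pi by (intro A15_plusI[of _ k "\<lambda>i. z (\<pi> i)"]) auto
qed

lemma perm_mat_Aut:
  assumes \<pi>: "\<pi> permutes {..<16}"
  shows "perm_mat \<pi> \<in> carrier (lattice_Aut 16 A15_plus)"
proof -
  have pi: "\<pi> i < 16" if "i < 16" for i using permutes_in_image[OF \<pi>, of i] that by simp
  have c: "perm_mat \<pi> \<in> carrier_mat 16 16" by (simp add: perm_mat_def)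
  have "(perm_mat \<pi>)\<^sup>T * perm_mat \<pi> = 1\<^sub>m 16"
  proof (rule eq_matI)
    fix i j assume "i < dim_row (1\<^sub>m 16 :: real mat)" "j < dim_col (1\<^sub>m 16 :: real mat)"
    then have ij: "i < 16" "j < 16" by auto
    have "((perm_mat \<pi>)\<^sup>T * perm_mat \<pi>) $$ (i, j) = (\<Sum>k<16. of_bool (i = \<pi> k) * of_bool (j = \<pi> k))"
      using ij by (simp add: perm_mat_def scalar_prod_def atLeast0LessThan)
    also have "\<dots> = (\<Sum>k<16. of_bool (i = k) * of_bool (j = k))"
      using sum.permute[OF \<pi>, of "\<lambda>k. of_bool (i = k) * of_bool (j = k) :: real"] by (simp add: o_def)
    also have "\<dots> = (\<Sum>k<16. if k = i then of_bool (j = i) else 0)" by (intro sum.cong) auto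
    also have "\<dots> = 1\<^sub>m 16 $$ (i, j)" using ij by simp
    finally show "((perm_mat \<pi>)\<^sup>T * perm_mat \<pi>) $$ (i, j) = 1\<^sub>m 16 $$ (i, j)" .
  qed (auto simp: perm_mat_def)
  moreover have "mat_action (perm_mat \<pi>) A15_plus = A15_plus"
  proof (intro subset_antisym subsetI)
    fix y assume "y \<in> mat_action (perm_mat \<pi>) A15_plus"
    then show "y \<in> A15_plus" using perm_mat_A15_plus[OF \<pi>] by (auto simp: mat_action_def)
  next
    fix y assume y: "y \<in> A15_plus"
    let ?\<rho> = "Hilbert_Choice.inv \<pi>"
    have \<rho>: "?\<rho> permutes {..<16}" using permutes_inv[OF \<pi>] .
    let ?x = "perm_mat ?\<rho> *\<^sub>v y"
    have "?x \<in> A15_plus" using perm_mat_A15_plus[OF \<rho> y] .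
    moreover have "perm_mat \<pi> *\<^sub>v ?x = y"
      using y pi permutes_inverses[OF \<pi>] by (simp add: perm_mat_mult_vec[OF \<pi>] perm_mat_mult_vec[OF \<rho>]) (auto intro!: eq_vecI)
    ultimately show "y \<in> mat_action (perm_mat \<pi>) A15_plus"
      unfolding mat_action_def by (intro image_eqI[of _ _ ?x]) simp_all
  qed
  ultimately show ?thesis using c by (simp add: lattice_Aut_iff)
qed

text \<open>\<open>perm_mat\<close> pulls coordinates back along \<pi>, so a fourset is replaced by
  its preimage.\<close>

lemma perm_mat_fourset:
  assumes \<pi>: "\<pi> permutes {..<16}" and "\<And>i. i < 16 \<Longrightarrow> i \<in> T \<longleftrightarrow> \<pi> i \<in> S"
  shows "perm_mat \<pi> *\<^sub>v fourset_vec S = fourset_vec T"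
proof -
  have pi: "\<pi> i < 16" if "i < 16" for i using permutes_in_image[OF \<pi>, of i] that by simp
  show ?thesis
    using assms(2) pi by (subst perm_mat_mult_vec[OF \<pi>]) (auto simp: fourset_vec_def)
qed

text \<open>Both triples have the same number of points in each of the eight cells of their Venn diagram.\<close>

lemma ex_permutation_triples:
  fixes S\<^sub>1 S\<^sub>2 S\<^sub>3 T\<^sub>1 T\<^sub>2 T\<^sub>3 :: "nat set"
  assumes sub: "S\<^sub>1 \<subseteq> {..<n}" "S\<^sub>2 \<subseteq> {..<n}" "S\<^sub>3 \<subseteq> {..<n}" "T\<^sub>1 \<subseteq> {..<n}" "T\<^sub>2 \<subseteq> {..<n}" "T\<^sub>3 \<subseteq> {..<n}"
    and c: "card S\<^sub>1 = card T\<^sub>1" "card S\<^sub>2 = card T\<^sub>2" "card S\<^sub>3 = card T\<^sub>3"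
      "card (S\<^sub>1 \<inter> S\<^sub>2) = card (T\<^sub>1 \<inter> T\<^sub>2)" "card (S\<^sub>1 \<inter> S\<^sub>3) = card (T\<^sub>1 \<inter> T\<^sub>3)"
      "card (S\<^sub>2 \<inter> S\<^sub>3) = card (T\<^sub>2 \<inter> T\<^sub>3)" "card (S\<^sub>1 \<inter> S\<^sub>2 \<inter> S\<^sub>3) = card (T\<^sub>1 \<inter> T\<^sub>2 \<inter> T\<^sub>3)"
  obtains \<pi> where "\<pi> permutes {..<n}"
    "\<And>i. i < n \<Longrightarrow> (i \<in> T\<^sub>1 \<longleftrightarrow> \<pi> i \<in> S\<^sub>1) \<and> (i \<in> T\<^sub>2 \<longleftrightarrow> \<pi> i \<in> S\<^sub>2) \<and> (i \<in> T\<^sub>3 \<longleftrightarrow> \<pi> i \<in> S\<^sub>3)"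
proof -
  define E :: "nat set \<Rightarrow> nat \<Rightarrow> real" where "E S x = of_bool (x \<in> S)" for S x
  have sE: "(\<Sum>x<n. E S x) = real (card S)" if "S \<subseteq> {..<n}" for S
    unfolding E_def using sum_of_bool_mem[OF that] .
  have EE: "E S x * E T x = E (S \<inter> T) x" for S T x by (simp add: E_def)
  define ind where "ind \<alpha> S x = (if \<alpha> then E S x else 1 - E S x)" for \<alpha> S x
  have cell: "real (card {x \<in> {..<n}. (x \<in> A, x \<in> B, x \<in> C) = (\<alpha>, \<beta>, \<gamma>)})
      = (\<Sum>x<n. ind \<alpha> A x * ind \<beta> B x * ind \<gamma> C x)" for A B C :: "nat set" and \<alpha> \<beta> \<gamma>
  proof -
    have "real (card {x \<in> {..<n}. (x \<in> A, x \<in> B, x \<in> C) = (\<alpha>, \<beta>, \<gamma>)})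
      = (\<Sum>x<n. of_bool (x \<in> {x \<in> {..<n}. (x \<in> A, x \<in> B, x \<in> C) = (\<alpha>, \<beta>, \<gamma>)}))"
      by (subst sum_of_bool_mem) auto
    also have "\<dots> = (\<Sum>x<n. ind \<alpha> A x * ind \<beta> B x * ind \<gamma> C x)"
      by (intro sum.cong refl) (auto simp: ind_def E_def)
    finally show ?thesis .
  qed
  \<comment> \<open>Pointwise inclusion-exclusion: every cell indicator is a combination of
    indicators of intersections, whose sizes are given.\<close>
  have expand: "ind \<alpha> A x * ind \<beta> B x * ind \<gamma> C x =
      (if \<alpha> \<and> \<beta> \<and> \<gamma> then E (A \<inter> B \<inter> C) x
       else if \<alpha> \<and> \<beta> then E (A \<inter> B) x - E (A \<inter> B \<inter> C) x
       else if \<alpha> \<and> \<gamma> then E (A \<inter> C) x - E (A \<inter> B \<inter> C) x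
       else if \<beta> \<and> \<gamma> then E (B \<inter> C) x - E (A \<inter> B \<inter> C) x
       else if \<alpha> then E A x - E (A \<inter> B) x - E (A \<inter> C) x + E (A \<inter> B \<inter> C) x
       else if \<beta> then E B x - E (A \<inter> B) x - E (B \<inter> C) x + E (A \<inter> B \<inter> C) x
       else if \<gamma> then E C x - E (A \<inter> C) x - E (B \<inter> C) x + E (A \<inter> B \<inter> C) x
       else 1 - E A x - E B x - E C x + E (A \<inter> B) x + E (A \<inter> C) x + E (B \<inter> C) x - E (A \<inter> B \<inter> C) x)"
    for \<alpha> \<beta> \<gamma> A B C x
    by (auto simp: ind_def E_def)
  have subI: "A \<inter> B \<subseteq> {..<n}" if "A \<subseteq> {..<n}" for A B :: "nat set" using that by auto
  have "card {x \<in> {..<n}. (x \<in> T\<^sub>1, x \<in> T\<^sub>2, x \<in> T\<^sub>3) = y} = card {x \<in> {..<n}. (x \<in> S\<^sub>1, x \<in> S\<^sub>2, x \<in> S\<^sub>3) = y}" for y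
  proof -
    obtain \<alpha> \<beta> \<gamma> where y: "y = (\<alpha>, \<beta>, \<gamma>)" by (cases y)
    have "real (card {x \<in> {..<n}. (x \<in> T\<^sub>1, x \<in> T\<^sub>2, x \<in> T\<^sub>3) = y}) = real (card {x \<in> {..<n}. (x \<in> S\<^sub>1, x \<in> S\<^sub>2, x \<in> S\<^sub>3) = y})"
      unfolding y cell expand using c sub
      by (cases \<alpha>; cases \<beta>; cases \<gamma>) (simp_all add: sum.distrib sum_subtractf sE subI)
    then show ?thesis by simp
  qed
  \<comment> \<open>Equal fibre sizes say that the two multisets of membership patterns agree, and a
    permutation matching the patterns follows.\<close>
  then have "image_mset (\<lambda>x. (x \<in> T\<^sub>1, x \<in> T\<^sub>2, x \<in> T\<^sub>3)) (mset_set {..<n}) = image_mset (\<lambda>x. (x \<in> S\<^sub>1, x \<in> S\<^sub>2, x \<in> S\<^sub>3)) (mset_set {..<n})"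
    by (intro multiset_eqI) (simp only: count_image_mset_eq_card_vimage[OF finite_lessThan])
  from image_mset_eq_implies_permutes[OF finite_lessThan this]
  obtain \<pi> where \<pi>: "\<pi> permutes {..<n}" "\<forall>x\<in>{..<n}. (x \<in> T\<^sub>1, x \<in> T\<^sub>2, x \<in> T\<^sub>3) = (\<pi> x \<in> S\<^sub>1, \<pi> x \<in> S\<^sub>2, \<pi> x \<in> S\<^sub>3)" .
  show ?thesis by (rule that[OF \<pi>(1)]) (use \<pi>(2) in auto)
qed

section \<open>Classification of the sublattices with the given Gram matrix\<close>

definition gram_abc :: "real mat" where
  "gram_abc = mat_of_rows_list 3 [[3,2,0],[2,3,0],[0,0,3]]"

lemma gram_abc_dim: "dim_row gram_abc = 3"
  by (simp add: gram_abc_def mat_of_rows_list_def)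

lemma gram_abc_entries:
  "gram_abc $$ (0, 0) = 3" "gram_abc $$ (0, 1) = 2" "gram_abc $$ (0, 2) = 0"
  "gram_abc $$ (1, 0) = 2" "gram_abc $$ (1, 1) = 3" "gram_abc $$ (1, 2) = 0"
  "gram_abc $$ (2, 0) = 0" "gram_abc $$ (2, 1) = 0" "gram_abc $$ (2, 2) = 3"
  by (simp_all add: gram_abc_def mat_of_rows_list_def)

lemma gram_matrix_3_iff:
  "gram_matrix [x, y, z] = gram_abc \<longleftrightarrow>
    x \<bullet> x = 3 \<and> x \<bullet> y = 2 \<and> x \<bullet> z = 0 \<and> y \<bullet> x = 2 \<and> y \<bullet> y = 3 \<and> y \<bullet> z = 0 \<and> z \<bullet> x = 0 \<and> z \<bullet> y = 0 \<and> z \<bullet> z = 3"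
  (is "?G = _ \<longleftrightarrow> ?R")
proof
  assume e: "?G = gram_abc"
  have "?G $$ (i, j) = gram_abc $$ (i, j)" for i j by (simp add: e)
  from this[of 0 0] this[of 0 1] this[of 0 2] this[of 1 0] this[of 1 1] this[of 1 2] this[of 2 0] this[of 2 1] this[of 2 2]
  show ?R unfolding gram_abc_entries by (simp add: gram_matrix_def)
next
  assume r: ?R
  show "?G = gram_abc"
  proof (rule eq_matI)
    fix i j assume "i < dim_row gram_abc" "j < dim_col gram_abc"
    then have "i \<in> {0, 1, 2}" "j \<in> {0, 1, 2}" by (auto simp: gram_abc_def mat_of_rows_list_def)
    then show "?G $$ (i, j) = gram_abc $$ (i, j)"
      using r gram_abc_entries by (auto simp: gram_matrix_def)
  qed (simp_all add: gram_matrix_def gram_abc_def mat_of_rows_list_def)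
qed

lemma (in A15_complement) abc_sublattice:
  "zspan 16 {a, b, c} \<in> sublattices_with_gram 16 A15_plus gram_abc"
proof -
  have S: "set [a, b, c] \<subseteq> carrier_vec 16" "set [a, b, c] \<subseteq> A15_plus" using abc_mem by auto
  have sub: "zspan 16 (set [a, b, c]) \<subseteq> A15_plus"
    by (rule zspan_subset[OF S A15_plus_zero A15_plus_add A15_plus_uminus])
  have basis: "lattice_basis 16 (zspan 16 (set [a, b, c])) [a, b, c]"
  proof (rule lattice_basisI[OF S(1)])
    fix f assume f: "lcomb 16 [a, b, c] f = 0\<^sub>v 16"
    have "0 = f 0 * (a \<bullet> x) + f 1 * (b \<bullet> x) + f 2 * (c \<bullet> x)" if x: "x \<in> carrier_vec 16" for x
    proof -
      have "0 = lcomb 16 [a, b, c] f \<bullet> x" using f x by simp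
      then show ?thesis using lcomb_scalar_prod[OF S(1) x, of f] by (simp add: lessThan_Suc numeral_2_eq_2 algebra_simps)
    qed
    from this[of a] this[of b] this[of c] have "f 0 = 0" "f 1 = 0" "f 2 = 0"
      using abc_mem abc_gram by auto
    then show "\<forall>i<length [a, b, c]. f i = 0" by (auto simp: less_Suc_eq numeral_2_eq_2)
  qed
  have "\<forall>x\<in>zspan 16 (set [a, b, c]). \<forall>y\<in>zspan 16 (set [a, b, c]). x \<bullet> y \<in> \<int>"
    using sub A15_plus_integral by blast
  then have "sublattice 16 (zspan 16 (set [a, b, c])) A15_plus"
    unfolding sublattice_def int_lattice_def using basis sub by blast
  moreover have "gram_matrix [a, b, c] = gram_abc" using abc_gram by (simp add: gram_matrix_3_iff)
  ultimately show ?thesis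
    unfolding sublattices_with_gram_def using basis by auto
qed

lemma qvec_eq_fourset_vec:
  assumes "length xs = 16" "\<forall>i<16. xs ! i = (if i \<in> S then - 3 else 1)"
  shows "qvec xs = fourset_vec S"
  using assms by (intro eq_vecI) (auto simp: qvec_def fourset_vec_def)

lemma
  shows al_fourset: "qvec al = fourset_vec {0,1,2,3}"
    and bl_fourset: "qvec bl = fourset_vec {0,1,2,4}"
    and cl_one_fourset: "qvec cl_one = fourset_vec {0,5,6,7}"
    and cl_two_fourset: "qvec cl_two = fourset_vec {3,4,5,6}"
  by (rule qvec_eq_fourset_vec; code_simp)+

lemma signed_foursets:
  fixes s t :: real
  assumes "s = 1 \<or> s = -1" "t = 1 \<or> t = -1" "S \<subseteq> {..<16}" "T \<subseteq> {..<16}" "card S = 4" "card T = 4"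
  shows "(s \<cdot>\<^sub>v fourset_vec S) \<bullet> (t \<cdot>\<^sub>v fourset_vec T) = s * t * (real (card (S \<inter> T)) - 1)"
  using fourset_vec_scalar_prod[OF assms(3-6)] by (simp add: fourset_vec_def)

text \<open>Permutations suffice as automorphisms: they adjust the foursets, while the signs of the
  three norm 3 vectors do not affect their span.\<close>

lemma sublattice_in_orbit:
  assumes M: "M \<in> sublattices_with_gram 16 A15_plus gram_abc"
  obtains P cl where "P \<in> carrier (lattice_Aut 16 A15_plus)" "cl = cl_one \<or> cl = cl_two"
    "mat_action P M = zspan 16 {qvec al, qvec bl, qvec cl}"
proof -
  note result = that
  obtain bs where "sublattice 16 M A15_plus" and bs: "lattice_basis 16 M bs" "gram_matrix bs = gram_abc"
    using M by (auto simp: sublattices_with_gram_def)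
  then have MA: "M \<subseteq> A15_plus" by (simp add: sublattice_def)
  have "length bs = 3" using arg_cong[OF bs(2), of dim_row] by (simp add: gram_matrix_def gram_abc_dim)
  then obtain x y z where xyz: "bs = [x, y, z]" by (auto simp: numeral_3_eq_3 length_Suc_conv)
  have Mz: "M = zspan 16 {x, y, z}" using bs(1) xyz by (simp add: lattice_basis_def)
  then have A: "x \<in> A15_plus" "y \<in> A15_plus" "z \<in> A15_plus"
    using MA zspan_incl[of _ "{x, y, z}" 16] by auto
  have g: "x \<bullet> x = 3" "x \<bullet> y = 2" "x \<bullet> z = 0" "y \<bullet> y = 3" "y \<bullet> z = 0" "z \<bullet> z = 3"
    using bs(2) unfolding xyz gram_matrix_3_iff by auto
  obtain r S\<^sub>1 where 1: "r = 1 \<or> r = (-1::real)" "S\<^sub>1 \<subseteq> {..<16}" "card S\<^sub>1 = 4" "x = r \<cdot>\<^sub>v fourset_vec S\<^sub>1"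
    using A15_plus_norm_3[OF A(1) g(1)] .
  obtain s S\<^sub>2 where 2: "s = 1 \<or> s = (-1::real)" "S\<^sub>2 \<subseteq> {..<16}" "card S\<^sub>2 = 4" "y = s \<cdot>\<^sub>v fourset_vec S\<^sub>2"
    using A15_plus_norm_3[OF A(2) g(4)] .
  obtain t S\<^sub>3 where 3: "t = 1 \<or> t = (-1::real)" "S\<^sub>3 \<subseteq> {..<16}" "card S\<^sub>3 = 4" "z = t \<cdot>\<^sub>v fourset_vec S\<^sub>3"
    using A15_plus_norm_3[OF A(3) g(6)] .
  have fin: "finite S\<^sub>1" "finite S\<^sub>2" "finite S\<^sub>3" using 1(2) 2(2) 3(2) by (auto intro: finite_subset)
  have "r * s * (real (card (S\<^sub>1 \<inter> S\<^sub>2)) - 1) = 2"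
    using signed_foursets[OF 1(1) 2(1) 1(2) 2(2) 1(3) 2(3)] g(2) 1(4) 2(4) by simp
  \<comment> \<open>The size minus 1 is 2 up to sign, and -1 is not a cardinality.\<close>
  then have c12: "card (S\<^sub>1 \<inter> S\<^sub>2) = 3" using 1(1) 2(1) by auto
  have "r * t * (real (card (S\<^sub>1 \<inter> S\<^sub>3)) - 1) = 0"
    using signed_foursets[OF 1(1) 3(1) 1(2) 3(2) 1(3) 3(3)] g(3) 1(4) 3(4) by simp
  then have c13: "card (S\<^sub>1 \<inter> S\<^sub>3) = 1" using 1(1) 3(1) by auto
  have "s * t * (real (card (S\<^sub>2 \<inter> S\<^sub>3)) - 1) = 0"
    using signed_foursets[OF 2(1) 3(1) 2(2) 3(2) 2(3) 3(3)] g(5) 2(4) 3(4) by simp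
  then have c23: "card (S\<^sub>2 \<inter> S\<^sub>3) = 1" using 2(1) 3(1) by auto
  \<comment> \<open>The single common point of \<open>S\<^sub>1\<close> and \<open>S\<^sub>3\<close>
    either lies in \<open>S\<^sub>2\<close> or does not; these two possibilities become the two
    orbits.\<close>
  have "card (S\<^sub>1 \<inter> S\<^sub>2 \<inter> S\<^sub>3) \<le> card (S\<^sub>1 \<inter> S\<^sub>3)" using fin by (intro card_mono) auto
  then have c123: "card (S\<^sub>1 \<inter> S\<^sub>2 \<inter> S\<^sub>3) = 1 \<or> card (S\<^sub>1 \<inter> S\<^sub>2 \<inter> S\<^sub>3) = 0" using c13 by linarith
  let ?A = "{0,1,2,3::nat}" and ?B = "{0,1,2,4::nat}"
  have move: thesis
    if cl: "cl = cl_one \<or> cl = cl_two" and C: "qvec cl = fourset_vec C" "C \<subseteq> {..<16}" "card C = 4" "card (?A \<inter> C) = 1"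
      "card (?B \<inter> C) = 1" and t: "card (S\<^sub>1 \<inter> S\<^sub>2 \<inter> S\<^sub>3) = card (?A \<inter> ?B \<inter> C)" for cl C
  proof -
    obtain \<pi> where \<pi>: "\<pi> permutes {..<16}"
      and m: "\<And>i. i < 16 \<Longrightarrow> (i \<in> ?A \<longleftrightarrow> \<pi> i \<in> S\<^sub>1) \<and> (i \<in> ?B \<longleftrightarrow> \<pi> i \<in> S\<^sub>2) \<and> (i \<in> C \<longleftrightarrow> \<pi> i \<in> S\<^sub>3)"
    proof (rule ex_permutation_triples[of S\<^sub>1 16 S\<^sub>2 S\<^sub>3 ?A ?B C])
      show "card (S\<^sub>1 \<inter> S\<^sub>2) = card (?A \<inter> ?B)" using c12 by simp
    qed (use 1 2 3 C t c13 c23 that in auto)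
    let ?P = "perm_mat \<pi>"
    have P: "?P \<in> carrier_mat 16 16" by (simp add: perm_mat_def)
    have fc: "fourset_vec S \<in> carrier_vec 16" for S by (simp add: fourset_vec_def)
    have "?P *\<^sub>v x = r \<cdot>\<^sub>v qvec al"
      unfolding 1(4) al_fourset using mult_mat_vec[OF P fc] perm_mat_fourset[OF \<pi>, of ?A S\<^sub>1] m by simp
    moreover have "?P *\<^sub>v y = s \<cdot>\<^sub>v qvec bl"
      unfolding 2(4) bl_fourset using mult_mat_vec[OF P fc] perm_mat_fourset[OF \<pi>, of ?B S\<^sub>2] m by simp
    moreover have "?P *\<^sub>v z = t \<cdot>\<^sub>v qvec cl"
      unfolding 3(4) C(1) using mult_mat_vec[OF P fc] perm_mat_fourset[OF \<pi>, of C S\<^sub>3] m by simp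
    ultimately have "mat_action ?P M = zspan 16 {r \<cdot>\<^sub>v qvec al, s \<cdot>\<^sub>v qvec bl, t \<cdot>\<^sub>v qvec cl}"
      unfolding Mz using mat_action_zspan[OF P, of "{x, y, z}"] A by simp
    also have "\<dots> = zspan 16 {qvec al, qvec bl, qvec cl}"
      by (rule zspan_signs) (use 1(1) 2(1) 3(1) fc in \<open>auto simp: al_fourset bl_fourset C(1)\<close>)
    finally show ?thesis by (rule result[OF perm_mat_Aut[OF \<pi>] cl])
  qed
  from c123 show ?thesis
  proof
    assume "card (S\<^sub>1 \<inter> S\<^sub>2 \<inter> S\<^sub>3) = 1"
    then show ?thesis using move[of cl_one "{0,5,6,7}"] cl_one_fourset by simp
  next
    assume "card (S\<^sub>1 \<inter> S\<^sub>2 \<inter> S\<^sub>3) = 0"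
    then show ?thesis using move[of cl_two "{3,4,5,6}"] cl_two_fourset by simp
  qed
qed

theorem theorem1p3:
  fixes a b c c' :: "real vec" and G :: "real mat"
  assumes a: "a = (1/4) \<cdot>\<^sub>v vec_of_list [-3,-3,-3,-3,1,1,1,1,1,1,1,1,1,1,1,1]"
    and b: "b = (1/4) \<cdot>\<^sub>v vec_of_list [-3,-3,-3,1,-3,1,1,1,1,1,1,1,1,1,1,1]"
    and c: "c = (1/4) \<cdot>\<^sub>v vec_of_list [-3,1,1,1,1,-3,-3,-3,1,1,1,1,1,1,1,1]"
    and c': "c' = (1/4) \<cdot>\<^sub>v vec_of_list [1,1,1,-3,-3,-3,-3,1,1,1,1,1,1,1,1,1]"
    and G: "G = mat_of_rows_list 3 [[3,2,0],[2,3,0],[0,0,3]]"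
  shows "{a, b, c, c'} \<subseteq> A15_plus \<and>
    card (orbits (lattice_Aut 16 A15_plus) (sublattices_with_gram 16 A15_plus G) mat_action) = 2 \<and>
    orbits (lattice_Aut 16 A15_plus) (sublattices_with_gram 16 A15_plus G) mat_action =
      {orbit (lattice_Aut 16 A15_plus) mat_action (zspan 16 {a, b, c}),
       orbit (lattice_Aut 16 A15_plus) mat_action (zspan 16 {a, b, c'})} \<and>
    \<not> isometric (lattice_orth A15_plus (zspan 16 {a, b, c}))
                (lattice_orth A15_plus (zspan 16 {a, b, c'})) \<and>
    (\<forall>N \<in> {lattice_orth A15_plus (zspan 16 {a, b, c}), lattice_orth A15_plus (zspan 16 {a, b, c'})}.
       minimal_non_s_integrable 16 2 N \<and> lattice_rank 16 N = 12 \<and> lattice_det 16 N = 15)"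
proof -
  interpret one: A15_complement cl_one basis_one dual_one corr_one 8 cert_one blocks_one
    by (rule A15_complement_one)
  interpret two: A15_complement cl_two basis_two dual_two corr_two 7 cert_two blocks_two
    by (rule A15_complement_two)
  have lists: "map real_of_int al = [-3,-3,-3,-3,1,1,1,1,1,1,1,1,1,1,1,1]"
    "map real_of_int bl = [-3,-3,-3,1,-3,1,1,1,1,1,1,1,1,1,1,1]"
    "map real_of_int cl_one = [-3,1,1,1,1,-3,-3,-3,1,1,1,1,1,1,1,1]"
    "map real_of_int cl_two = [1,1,1,-3,-3,-3,-3,1,1,1,1,1,1,1,1,1]"
    by (simp_all add: al_def bl_def cl_one_def cl_two_def)
  have v: "a = qvec al" "b = qvec bl" "c = qvec cl_one" "c' = qvec cl_two"
    unfolding a b c c' lists[symmetric] by (rule qvec_alt)+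
  have G': "G = gram_abc" using G by (simp add: gram_abc_def)
  let ?Aut = "lattice_Aut 16 A15_plus" and ?M = "zspan 16 {a, b, c}" and ?M' = "zspan 16 {a, b, c'}"
  let ?O = "orbit ?Aut mat_action ?M" and ?O' = "orbit ?Aut mat_action ?M'"
  have orth: "lattice_orth A15_plus ?M = orth_abc cl_one" "lattice_orth A15_plus ?M' = orth_abc cl_two"
    unfolding v by (rule one.orth_zspan, rule two.orth_zspan)
  have mem: "{a, b, c, c'} \<subseteq> A15_plus" using one.abc_mem two.abc_mem by (simp add: v)
  have Mc: "?M \<subseteq> carrier_vec 16" "?M' \<subseteq> carrier_vec 16"
    using mem by (auto intro!: zspan_carrier)
  have E: "?M \<in> sublattices_with_gram 16 A15_plus G" "?M' \<in> sublattices_with_gram 16 A15_plus G"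
    unfolding v G' by (rule one.abc_sublattice, rule two.abc_sublattice)
  have orbs: "orbits ?Aut (sublattices_with_gram 16 A15_plus G) mat_action = {?O, ?O'}"
  proof (intro subset_antisym subsetI)
    fix X assume "X \<in> orbits ?Aut (sublattices_with_gram 16 A15_plus G) mat_action"
    then obtain M where M: "M \<in> sublattices_with_gram 16 A15_plus gram_abc" "X = orbit ?Aut mat_action M"
      unfolding orbits_def G' by blast
    obtain P cl where P: "P \<in> carrier ?Aut" "cl = cl_one \<or> cl = cl_two"
      "mat_action P M = zspan 16 {qvec al, qvec bl, qvec cl}"
      using sublattice_in_orbit[OF M(1)] .
    have "M \<subseteq> carrier_vec 16"
      using M(1) A15_plus_carrier by (auto simp: sublattices_with_gram_def sublattice_def)
    from orbit_eq[OF A15_plus_carrier P(1) this]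
    have "X = orbit ?Aut mat_action (zspan 16 {qvec al, qvec bl, qvec cl})" using M(2) P(3) by simp
    then show "X \<in> {?O, ?O'}" using P(2) v by auto
  next
    fix X assume "X \<in> {?O, ?O'}"
    then show "X \<in> orbits ?Aut (sublattices_with_gram 16 A15_plus G) mat_action"
      unfolding orbits_def using E by blast
  qed
  have niso: "\<not> isometric (lattice_orth A15_plus ?M) (lattice_orth A15_plus ?M')"
    unfolding orth by (rule complements_not_isometric)
  have "?O \<noteq> ?O'"
  proof
    assume "?O = ?O'"
    moreover have "1\<^sub>m 16 \<in> carrier ?Aut"
      by (simp add: lattice_Aut_iff mat_action_one[OF A15_plus_carrier])
    then have "?M' \<in> ?O'" unfolding orbit_def using mat_action_one[OF Mc(2)] by (metis (mono_tags, lifting) mem_Collect_eq)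
    ultimately have "?M' \<in> ?O" by simp
    then obtain P where P: "P \<in> carrier ?Aut" "?M' = mat_action P ?M" unfolding orbit_def by blast
    have "isometric (lattice_orth A15_plus ?M) (lattice_orth A15_plus ?M')"
      unfolding P(2) by (rule orth_isometric[OF A15_plus_carrier P(1) Mc(1)])
    then show False using niso by simp
  qed
  then have "card {?O, ?O'} = 2" by simp
  moreover have "minimal_non_s_integrable 16 2 N \<and> lattice_rank 16 N = 12 \<and> lattice_det 16 N = 15"
    if "N \<in> {lattice_orth A15_plus ?M, lattice_orth A15_plus ?M'}" for N
    using that one.N_minimal_non_integrable one.N_rank one.N_det det_one
      two.N_minimal_non_integrable two.N_rank two.N_det det_two unfolding orth by auto
  ultimately show ?thesis using mem orbs niso by simp
qed

end
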